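(* Let $L:\mathbb{R}^d\to\mathbb{R}$ be a twice continuously differentiable function attaining its global minimum at a unique point, with $L_m:=\inf L>0$ and $$c_L:=\max\Big(\big\|\max_i|\partial_{ii}L|\big\|_\infty,\ \big\|r(\nabla^2L)\big\|_\infty\Big)<\infty ,$$ where $r(\nabla^2 L)$ is the spectral radius of the Hessian. Let $\beta,\lambda,\sigma>0$, and let $X=X(t)$, $t\ge 0$, be a solution of the mean-field stochastic differential equation $$dX=-\lambda(X-\bar x^* )\,dt+\sigma\sum_{i=1}^d\vec e_i\,(X-\bar x^* )_i\,dW_i,\qquad \bar x^*(t)=\frac{\mathbb{E}\big(X(t)e^{-\beta L(X(t))}\big)}{\mathbb{E}\big(e^{-\beta L(X(t))}\big)} .$$ Put $V(t):=\mathbb{E}|X(t)-\mathbb{E}X(t)|^2$ and $M_L(t):=\mathbb{E}e^{-\beta L(X(t))}$. If $\beta,\lambda,\sigma$ and the initial distribution (the law of $X(0)$) are chosen such that $$\mu:=2\lambda-\sigma^2-2\sigma^2\frac{e^{-\beta L_m}}{M_L(0)}>0,$$ $$\nu:=\frac{2V(0)}{\mu M_L^2(0)}\,\beta e^{-2\beta L_m}c_L(2\lambda+\sigma^2)\le\frac34 ,$$ then $V(t)\to0$ exponentially fast as $t\to\infty$, and there exists $\tilde x\in\mathbb{R}^d$ such that $\bar x^*(t)\to\tilde x$ and $\mathbb{E}X(t)\to\tilde x$ exponentially fast as $t\to\infty$. Moreover, $$L(\tilde x)\le-\frac1\beta\log M_L(0)-\frac1{2\beta}\log(1-\nu)\le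 L_m+r(\beta)+\frac{\log2}{\beta},$$ where $$r(\beta):=-\frac1\beta\log M_L(0)-L_m\to 0\qquad\text{as }\beta\to\infty .$$
   Context: $W_1,\dots,W_d$ are independent standard one-dimensional Brownian motions, independent of $X(0)$; $\vec e_i$ is the $i$-th standard basis vector of $\mathbb{R}^d$; $(v)_i$ is the $i$-th component of a vector $v$; $|\cdot|$ is the Euclidean norm; $\|\cdot\|_\infty$ is the supremum norm over $\mathbb{R}^d$; $\partial_{ii}L$ is the $i$-th diagonal entry of the Hessian $\nabla^2L$. The function $r(\beta)$ is not to be confused with the spectral radius $r(\nabla^2 L)$; in it, $M_L(0)=\mathbb{E}e^{-\beta L(X(0))}$ is regarded as a function of $\beta$. The stochastic differential equation is understood in the It\^o sense, and it is nonlinear in the sense of McKean: $\bar x^*(t)$ is a deterministic vector depending on the law of $X(t)$. A solution is a continuous adapted process on $[0,\infty)$ satisfying the equation, with $\sup_{t\in[0,T]}\mathbb{E}|X(t)|^2<\infty$ for each $T>0$, so that all quantities above are well defined. "A quantity $q(t)$ tends to $q_\infty$ exponentially fast" means that there are constants $C,\kappa>0$ with $|q(t)-q_\infty|\le Ce^{-\kappa t}$ for all $t\ge0$.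
   Formalization: The clause r(β)→0 is stated only when the essential infimum of L(X(0)) equals inf L; without this it fails, e.g. for X(t)=x0 constant and not the minimiser, where r(β)=L(x0)-L_m>0. All other conclusions are unconditional. *)

theory Defs
  imports "HOL-Probability.Probability"
begin

section \<open>Brownian motion and the Ito integral\<close>

text \<open>Processes are indexed by \<^typ>\<open>real\<close>; only times \<open>t \<ge> 0\<close> are ever constrained.  A filtration
  on \<open>[0,\<infinity>)\<close> becomes one in the sense of the library locale \<^locale>\<open>filtration\<close> by
  taking \<open>F t = F 0\<close> for \<open>t < 0\<close>.\<close>

definition standard_brownian_motion :: "'w measure \<Rightarrow> (real \<Rightarrow> 'w \<Rightarrow> real) \<Rightarrow> bool" where
  "standard_brownian_motion M B \<longleftrightarrow>
     (\<forall>t\<ge>0. B t \<in> borel_measurable M) \<and>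
     (AE \<omega> in M. B 0 \<omega> = 0) \<and>
     (\<forall>n \<tau>. 0 \<le> \<tau> 0 \<and> (\<forall>k<n. \<tau> k \<le> \<tau> (Suc k)) \<longrightarrow>
        prob_space.indep_vars M (\<lambda>_. borel) (\<lambda>k \<omega>. B (\<tau> (Suc k)) \<omega> - B (\<tau> k) \<omega>) {..<n::nat}) \<and>
     (\<forall>s t. 0 \<le> s \<and> s < t \<longrightarrow>
        distributed M lborel (\<lambda>\<omega>. B t \<omega> - B s \<omega>) (normal_density 0 (sqrt (t - s)))) \<and>
     (AE \<omega> in M. continuous_on {0..} (\<lambda>t. B t \<omega>))"

text \<open>The components of \<open>W\<close> are independent standard Brownian motions, and \<open>W\<close> is a Brownian motion
  relative to the filtration \<open>F\<close> of the stochastic basis.\<close>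

definition brownian_basis ::
  "'w measure \<Rightarrow> (real \<Rightarrow> 'w measure) \<Rightarrow> (real \<Rightarrow> 'w \<Rightarrow> real ^ 'd) \<Rightarrow> bool" where
  "brownian_basis M F W \<longleftrightarrow>
     prob_space M \<and> filtration (space M) F \<and> (\<forall>t. subalgebra M (F t)) \<and>
     (\<forall>i. standard_brownian_motion M (\<lambda>t \<omega>. W t \<omega> $ i)) \<and>
     prob_space.indep_vars M (\<lambda>_. PiM {0..} (\<lambda>_. borel)) (\<lambda>i \<omega>. \<lambda>t\<in>{0..}. W t \<omega> $ i) UNIV \<and>
     (\<forall>t\<ge>0. W t \<in> borel_measurable (F t)) \<and>
     (\<forall>s t. 0 \<le> s \<and> s \<le> t \<longrightarrow>
        prob_space.indep_set M (sets (F s))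
          (sets (vimage_algebra (space M) (\<lambda>\<omega>. W t \<omega> - W s \<omega>) borel)))"

text \<open>A simple process on \<open>[0,T]\<close> takes the bounded, \<open>F (\<tau> k)\<close>-measurable value \<open>\<xi> k\<close> on
  \<open>(\<tau> k, \<tau> (k+1)]\<close>, where \<open>0 = \<tau> 0 \<le> \<dots> \<le> \<tau> n = T\<close>.\<close>

definition simple_process ::
  "'w measure \<Rightarrow> (real \<Rightarrow> 'w measure) \<Rightarrow> real \<Rightarrow> nat \<Rightarrow> (nat \<Rightarrow> real) \<Rightarrow> (nat \<Rightarrow> 'w \<Rightarrow> real) \<Rightarrow> bool" where
  "simple_process M F T n \<tau> \<xi> \<longleftrightarrow>
     \<tau> 0 = 0 \<and> \<tau> n = T \<and> (\<forall>k<n. \<tau> k \<le> \<tau> (Suc k)) \<and>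
     (\<forall>k<n. \<xi> k \<in> borel_measurable (F (\<tau> k)) \<and> (\<exists>C. \<forall>\<omega>\<in>space M. \<bar>\<xi> k \<omega>\<bar> \<le> C))"

definition simple_value ::
  "nat \<Rightarrow> (nat \<Rightarrow> real) \<Rightarrow> (nat \<Rightarrow> 'w \<Rightarrow> real) \<Rightarrow> real \<Rightarrow> 'w \<Rightarrow> real" where
  "simple_value n \<tau> \<xi> s \<omega> = (\<Sum>k<n. \<xi> k \<omega> * indicator {\<tau> k<..\<tau> (Suc k)} s)"

definition simple_integral ::
  "(real \<Rightarrow> 'w \<Rightarrow> real) \<Rightarrow> nat \<Rightarrow> (nat \<Rightarrow> real) \<Rightarrow> (nat \<Rightarrow> 'w \<Rightarrow> real) \<Rightarrow> 'w \<Rightarrow> real" where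
  "simple_integral B n \<tau> \<xi> \<omega> = (\<Sum>k<n. \<xi> k \<omega> * (B (\<tau> (Suc k)) \<omega> - B (\<tau> k) \<omega>))"

text \<open>\<open>I\<close> is (a version of) the Ito integral of \<open>H\<close> against \<open>B\<close> over \<open>[0,T]\<close>: simple processes
  converge to \<open>H\<close> in \<open>L\<^sup>2([0,T] \<times> M)\<close> while their elementary integrals converge to \<open>I\<close> in
  \<open>L\<^sup>2(M)\<close>.  It is a relation because \<open>I\<close> is determined only up to null sets.\<close>

definition ito_integral ::
  "'w measure \<Rightarrow> (real \<Rightarrow> 'w measure) \<Rightarrow> (real \<Rightarrow> 'w \<Rightarrow> real) \<Rightarrow> (real \<Rightarrow> 'w \<Rightarrow> real) \<Rightarrow> real \<Rightarrow>
     ('w \<Rightarrow> real) \<Rightarrow> bool" where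
  "ito_integral M F B H T I \<longleftrightarrow>
     I \<in> borel_measurable M \<and>
     (\<exists>n \<tau> \<xi>. (\<forall>m::nat. simple_process M F T (n m) (\<tau> m) (\<xi> m)) \<and>
        (\<lambda>m. \<integral>\<^sup>+\<omega>. (\<integral>\<^sup>+s\<in>{0..T}. ennreal ((H s \<omega> - simple_value (n m) (\<tau> m) (\<xi> m) s \<omega>)\<^sup>2) \<partial>lborel) \<partial>M)
          \<longlonglongrightarrow> 0 \<and>
        (\<lambda>m. \<integral>\<^sup>+\<omega>. ennreal ((I \<omega> - simple_integral B (n m) (\<tau> m) (\<xi> m) \<omega>)\<^sup>2) \<partial>M) \<longlonglongrightarrow> 0)"

section \<open>The mean-field equation\<close>

definition laplace_mean :: "'w measure \<Rightarrow> (real ^ 'd \<Rightarrow> real) \<Rightarrow> ('w \<Rightarrow> real ^ 'd) \<Rightarrow> real \<Rightarrow> real" where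
  "laplace_mean M L Y \<beta> = (\<integral>\<omega>. exp (- \<beta> * L (Y \<omega>)) \<partial>M)"

definition consensus_point ::
  "'w measure \<Rightarrow> (real ^ 'd \<Rightarrow> real) \<Rightarrow> real \<Rightarrow> ('w \<Rightarrow> real ^ 'd) \<Rightarrow> real ^ 'd" where
  "consensus_point M L \<beta> Y =
     (\<integral>\<omega>. exp (- \<beta> * L (Y \<omega>)) *\<^sub>R Y \<omega> \<partial>M) /\<^sub>R laplace_mean M L Y \<beta>"

definition mean_sq_deviation :: "'w measure \<Rightarrow> ('w \<Rightarrow> real ^ 'd) \<Rightarrow> real" where
  "mean_sq_deviation M Y = (\<integral>\<omega>. (norm (Y \<omega> - (\<integral>\<omega>'. Y \<omega>' \<partial>M)))\<^sup>2 \<partial>M)"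

text \<open>The drift rate is written \<open>\<Lambda>\<close>, since the lower-case letter is the abstraction symbol.
  The equation is required for each fixed \<open>t\<close> outside a null set that may depend on \<open>t\<close>.
  The moment condition makes the integrands square integrable over \<open>[0,t] \<times> M\<close>, so that the
  \<open>L\<^sup>2\<close> theory of the Ito integral applies.  Independence of \<open>W\<close> and \<open>X 0\<close> already follows from
  adaptedness and the \<open>brownian_basis\<close> condition; it is stated for readability.\<close>

definition mean_field_solution ::
  "'w measure \<Rightarrow> (real \<Rightarrow> 'w measure) \<Rightarrow> (real \<Rightarrow> 'w \<Rightarrow> real ^ 'd) \<Rightarrow> (real ^ 'd \<Rightarrow> real) \<Rightarrow>
     real \<Rightarrow> real \<Rightarrow> real \<Rightarrow> (real \<Rightarrow> 'w \<Rightarrow> real ^ 'd) \<Rightarrow> bool" where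
  "mean_field_solution M F W L \<beta> \<Lambda> \<sigma> X \<longleftrightarrow>
     brownian_basis M F W \<and>
     prob_space.indep_set M (sets (vimage_algebra (space M) (X 0) borel))
       (sets (vimage_algebra (space M) (\<lambda>\<omega>. \<lambda>t\<in>{0..}. W t \<omega>) (PiM {0..} (\<lambda>_. borel)))) \<and>
     (\<forall>t\<ge>0. X t \<in> borel_measurable (F t)) \<and>
     (\<forall>\<omega>\<in>space M. continuous_on {0..} (\<lambda>t. X t \<omega>)) \<and>
     (\<forall>T>0. (SUP t\<in>{0..T}. \<integral>\<^sup>+\<omega>. ennreal ((norm (X t \<omega>))\<^sup>2) \<partial>M) < \<infinity>) \<and>
     (\<exists>J. \<forall>t\<ge>0.
        (\<forall>i. ito_integral M F (\<lambda>s \<omega>. W s \<omega> $ i)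
               (\<lambda>s \<omega>. (X s \<omega> - consensus_point M L \<beta> (X s)) $ i) t (J i t)) \<and>
        (AE \<omega> in M. X t \<omega> = X 0 \<omega>
            - \<Lambda> *\<^sub>R (LINT s:{0..t}|lborel. X s \<omega> - consensus_point M L \<beta> (X s))
            + \<sigma> *\<^sub>R (\<Sum>i\<in>UNIV. J i t \<omega> *\<^sub>R axis i 1)))"

section \<open>The objective function\<close>

definition grad :: "(real ^ 'd \<Rightarrow> real) \<Rightarrow> real ^ 'd \<Rightarrow> real ^ 'd" where
  "grad L x = (\<chi> i. frechet_derivative L (at x) (axis i 1))"

definition hessian :: "(real ^ 'd \<Rightarrow> real) \<Rightarrow> real ^ 'd \<Rightarrow> real ^ 'd ^ 'd" where
  "hessian L x = jacobian (grad L) (at x)"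

definition twice_continuously_differentiable :: "(real ^ 'd \<Rightarrow> real) \<Rightarrow> bool" where
  "twice_continuously_differentiable L \<longleftrightarrow>
     (\<forall>x. L differentiable at x) \<and> (\<forall>x. grad L differentiable at x) \<and>
     continuous_on UNIV (hessian L)"

text \<open>Largest modulus of a complex eigenvalue.\<close>

definition spectral_radius :: "real ^ 'd ^ 'd \<Rightarrow> real" where
  "spectral_radius A =
     Sup {cmod z | z. \<exists>v::complex ^ 'd. v \<noteq> 0 \<and> (\<chi> i j. complex_of_real (A $ i $ j)) *v v = z *s v}"

definition sup_norm :: "(real ^ 'd \<Rightarrow> real) \<Rightarrow> ennreal" where
  "sup_norm f = (SUP x. ennreal \<bar>f x\<bar>)"

definition hessian_bound :: "(real ^ 'd \<Rightarrow> real) \<Rightarrow> ennreal" where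
  "hessian_bound L =
     max (sup_norm (\<lambda>x. MAX i. \<bar>hessian L x $ i $ i\<bar>)) (sup_norm (\<lambda>x. spectral_radius (hessian L x)))"

section \<open>The conclusion\<close>

definition tends_exponentially :: "(real \<Rightarrow> 'a::real_normed_vector) \<Rightarrow> 'a \<Rightarrow> bool" where
  "tends_exponentially q l \<longleftrightarrow> (\<exists>C>0. \<exists>\<kappa>>0. \<forall>t\<ge>0. norm (q t - l) \<le> C * exp (- \<kappa> * t))"

definition laplace_gap :: "'w measure \<Rightarrow> (real ^ 'd \<Rightarrow> real) \<Rightarrow> ('w \<Rightarrow> real ^ 'd) \<Rightarrow> real \<Rightarrow> real" where
  "laplace_gap M L Y \<beta> = - (1 / \<beta>) * ln (laplace_mean M L Y \<beta>) - Inf (range L)"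

text \<open>Standing condition of the Laplace principle: the essential infimum of \<open>L(Y)\<close> is \<open>inf L\<close>.
  It holds whenever the minimiser lies in the support of the law of \<open>Y\<close>.  It cannot be
  dropped: \<open>-(1/\<beta>) log E exp(-\<beta> L(Y))\<close> tends to that essential infimum, so the gap vanishes only
  under this condition, and for \<open>X(t) = X(0)\<close> constant and different from the minimiser
  (a solution with \<open>V = 0\<close>) the gap is a positive constant.\<close>

definition law_reaches_infimum :: "'w measure \<Rightarrow> (real ^ 'd \<Rightarrow> real) \<Rightarrow> ('w \<Rightarrow> real ^ 'd) \<Rightarrow> bool" where
  "law_reaches_infimum M L Y \<longleftrightarrow>
     (\<forall>\<epsilon>>0. measure M {\<omega>\<in>space M. L (Y \<omega>) < Inf (range L) + \<epsilon>} > 0)"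

end

theory Submission
  imports Defs
begin

text \<open>
  Write \<open>weight(x) = exp (-\<beta> L(x))\<close>, \<open>Z(t) = E weight(X(t))\<close> and \<open>a(t) = E |X - xbar|\<^sup>2\<close>.  No Ito formula is
  needed: Taylor expansion over a short interval, the orthogonality of the stochastic integral
  to the past and the Ito isometry bound one-sided Dini derivatives.  The variance satisfies
  \<open>V' \<le> -2\<Lambda>V + \<sigma>\<^sup>2 a\<close>.  As \<open>weight\<close> is semiconvex, with constant \<open>\<beta> c exp (-\<beta> L\<^sub>m)\<close>, and
  \<open>E weight(X)(X - xbar) = 0\<close>, also \<open>Z' \<ge> -1/2 \<beta> c exp (-\<beta> L\<^sub>m)(2\<Lambda> + \<sigma>\<^sup>2) a\<close>.  The Cauchy-Schwarz
  inequality gives \<open>a \<le> V (1 + exp (-\<beta> L\<^sub>m)/Z)\<close>.  As long as \<open>Z \<ge> Z(0)/2\<close>, therefore, \<open>V\<close> decays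
  like \<open>exp (-\<mu>t)\<close>, and integrating the bound for \<open>(Z\<^sup>2)'\<close> yields \<open>Z\<^sup>2 \<ge> Z(0)\<^sup>2 (1 - \<nu>(1 - exp (-\<mu>t)))\<close>,
  which exceeds \<open>Z(0)\<^sup>2/4\<close> since \<open>\<nu> \<le> 3/4\<close>; so the condition persists for all times.  The mean
  then moves at an exponentially decaying speed, and \<open>weight\<close> at its limit is at least
  \<open>Z(0) sqrt (1 - \<nu>)\<close>.
\<close>

section \<open>Hessian bounds\<close>

text \<open>Each quantity needs only a one-sided estimate: \<open>V\<close> must not grow too fast
  and \<open>Z\<close> must not drop too fast. Inequalities that are sharp to second order at the
  left end point \<open>X(s)\<close> therefore suffice. The Hessian of \<open>weight\<close> is
  \<open>weight\<close> times the sum of \<open>\<beta>^2 grad L (grad L)^T\<close> and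
  \<open>- \<beta> hessian L\<close>. The first summand is nonnegative and is dropped, so no bound
  on the gradient of \<open>L\<close> enters the constant. In the drift term the gradient at
  \<open>xbar\<close> may be subtracted, because \<open>X - xbar\<close> has weighted mean zero;
  this term thus becomes quadratic as well. Drift and noise account for \<open>2\<Lambda>\<close>
  and \<open>\<sigma>^2\<close> in the factor \<open>2\<Lambda> + \<sigma>^2\<close>. The estimates
  are coupled: decay of \<open>V\<close> needs a lower bound on \<open>Z\<close>, and the loss of
  \<open>Z\<close> is governed by the time integral of \<open>V\<close>. Working with
  \<open>Z^2\<close> cancels the \<open>1/Z\<close> in the bound for \<open>a\<close>, so that this
  integral alone remains. The definitions shape the stochastic part: every end time has its own
  approximating sequence for the Ito integral and its own null set in the equation. All estimates
  are therefore L2 estimates of increments between two fixed times.\<close>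

lemma has_derivative_grad:
  assumes "L differentiable at x"
  shows "(L has_derivative (\<lambda>h. grad L x \<bullet> h)) (at x)"
proof -
  let ?D = "frechet_derivative L (at x)"
  have D: "(L has_derivative ?D) (at x)"
    using assms by (simp add: frechet_derivative_works)
  then interpret linear ?D by (rule has_derivative_linear)
  have "?D h = grad L x \<bullet> h" for h
  proof -
    have "?D h = ?D (\<Sum>i\<in>UNIV. (h $ i) *\<^sub>R axis i 1)"
      by (simp add: basis_expansion flip: scalar_mult_eq_scaleR)
    then show ?thesis
      by (simp add: sum scale inner_vec_def grad_def mult.commute)
  qed
  with D show ?thesis by (metis (no_types, lifting) ext)
qed

context
  fixes L :: "real ^ 'd \<Rightarrow> real"
  assumes C2: "twice_continuously_differentiable L"
begin

lemma grad_deriv: "(L has_derivative (\<lambda>h. grad L x \<bullet> h)) (at x)"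
  using C2 by (intro has_derivative_grad) (simp add: twice_continuously_differentiable_def)

lemma hessian_deriv: "(grad L has_derivative (\<lambda>h. hessian L x *v h)) (at x)"
  using C2 unfolding hessian_def
  by (simp add: twice_continuously_differentiable_def flip: jacobian_works)

lemma grad_line_deriv:
  "((\<lambda>t. L (x + t *\<^sub>R v)) has_real_derivative (grad L (x + t *\<^sub>R v) \<bullet> v)) (at t)"
proof -
  have "((\<lambda>t. L (x + t *\<^sub>R v)) has_derivative (\<lambda>h. grad L (x + t *\<^sub>R v) \<bullet> (h *\<^sub>R v))) (at t)"
    by (rule has_derivative_in_compose2[where t=UNIV and g'="\<lambda>x h. grad L x \<bullet> h"])
       (auto intro!: derivative_eq_intros grad_deriv[THEN has_derivative_at_withinI])
  then show ?thesis
    by (simp add: has_field_derivative_def mult.commute[of _ "_ \<bullet> _"])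
qed

lemma hessian_line_deriv:
  "((\<lambda>t. grad L (x + t *\<^sub>R v) \<bullet> w) has_real_derivative (w \<bullet> (hessian L (x + t *\<^sub>R v) *v v))) (at t)"
proof -
  have "((\<lambda>t. grad L (x + t *\<^sub>R v)) has_derivative (\<lambda>h. hessian L (x + t *\<^sub>R v) *v (h *\<^sub>R v))) (at t)"
    by (rule has_derivative_in_compose2[where t=UNIV and g'="\<lambda>x h. hessian L x *v h"])
       (auto intro!: derivative_eq_intros hessian_deriv[THEN has_derivative_at_withinI])
  then have "((\<lambda>t. grad L (x + t *\<^sub>R v) \<bullet> w) has_derivative
      (\<lambda>h. (hessian L (x + t *\<^sub>R v) *v (h *\<^sub>R v)) \<bullet> w)) (at t)"
    by (rule has_derivative_inner_left)
  then show ?thesis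
    by (simp add: has_field_derivative_def mult.commute[of _ "_ \<bullet> _"] inner_commute
         matrix_vector_mult_scaleR)
qed

text \<open>Mean value theorem twice, first along \<open>u\<close> for the difference of two
  parallel lines, then along \<open>v\<close> for the directional derivative in direction
  \<open>u\<close>. The left side is symmetric in \<open>u\<close> and \<open>v\<close>, the right
  side is not.\<close>

lemma second_difference:
  assumes h: "0 < h"
  shows "\<exists>\<xi> \<eta>. 0 \<le> \<xi> \<and> \<xi> \<le> h \<and> 0 \<le> \<eta> \<and> \<eta> \<le> h \<and>
    L (x + h *\<^sub>R u + h *\<^sub>R v) - L (x + h *\<^sub>R u) - L (x + h *\<^sub>R v) + L x
      = h\<^sup>2 * (u \<bullet> (hessian L (x + \<xi> *\<^sub>R u + \<eta> *\<^sub>R v) *v v))"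
proof -
  let ?p = "\<lambda>s. L ((x + h *\<^sub>R v) + s *\<^sub>R u) - L (x + s *\<^sub>R u)"
  have "\<exists>\<xi>. 0 < \<xi> \<and> \<xi> < h \<and> ?p h - ?p 0 =
      (h - 0) * (grad L ((x + h *\<^sub>R v) + \<xi> *\<^sub>R u) \<bullet> u - grad L (x + \<xi> *\<^sub>R u) \<bullet> u)"
    using h by (intro MVT2) (auto intro!: derivative_intros grad_line_deriv)
  then obtain \<xi> where \<xi>: "0 < \<xi>" "\<xi> < h" and p: "?p h - ?p 0 =
      h * (grad L ((x + h *\<^sub>R v) + \<xi> *\<^sub>R u) \<bullet> u - grad L (x + \<xi> *\<^sub>R u) \<bullet> u)"
    by auto
  let ?q = "\<lambda>r. grad L ((x + \<xi> *\<^sub>R u) + r *\<^sub>R v) \<bullet> u"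
  have "\<exists>\<eta>. 0 < \<eta> \<and> \<eta> < h \<and> ?q h - ?q 0 =
      (h - 0) * (u \<bullet> (hessian L ((x + \<xi> *\<^sub>R u) + \<eta> *\<^sub>R v) *v v))"
    using h by (intro MVT2) (auto intro!: derivative_intros hessian_line_deriv)
  then obtain \<eta> where \<eta>: "0 < \<eta>" "\<eta> < h" and q: "?q h - ?q 0 =
      h * (u \<bullet> (hessian L ((x + \<xi> *\<^sub>R u) + \<eta> *\<^sub>R v) *v v))"
    by auto
  show ?thesis
    using \<xi> \<eta> p q by (intro exI[of _ \<xi>] exI[of _ \<eta>]) (simp add: power2_eq_square algebra_simps)
qed

text \<open>Exchanging \<open>u\<close> and \<open>v\<close> leaves the second difference unchanged,
  so the two Hessian forms agree at nearby points; these points converge to \<open>x\<close>, and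
  continuity of the Hessian carries the identity to the limit. Symmetry matters because the spectral
  radius of a general matrix does not control its quadratic form.\<close>

lemma hessian_symmetric: "u \<bullet> (hessian L x *v v) = v \<bullet> (hessian L x *v u)"
proof -
  define h where "h n = 1 / real (Suc n)" for n
  have h: "0 < h n" for n by (simp add: h_def)
  have "\<forall>n. \<exists>\<xi> \<eta>. 0 \<le> \<xi> \<and> \<xi> \<le> h n \<and> 0 \<le> \<eta> \<and> \<eta> \<le> h n \<and>
    L (x + h n *\<^sub>R u + h n *\<^sub>R v) - L (x + h n *\<^sub>R u) - L (x + h n *\<^sub>R v) + L x
      = (h n)\<^sup>2 * (u \<bullet> (hessian L (x + \<xi> *\<^sub>R u + \<eta> *\<^sub>R v) *v v))" for u v
    using second_difference[OF h] by blast
  then obtain \<xi> \<eta> where *: "0 \<le> \<xi> u v n" "\<xi> u v n \<le> h n" "0 \<le> \<eta> u v n" "\<eta> u v n \<le> h n"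
    "L (x + h n *\<^sub>R u + h n *\<^sub>R v) - L (x + h n *\<^sub>R u) - L (x + h n *\<^sub>R v) + L x
      = (h n)\<^sup>2 * (u \<bullet> (hessian L (x + \<xi> u v n *\<^sub>R u + \<eta> u v n *\<^sub>R v) *v v))" for u v n
    by metis
  have h0: "h \<longlonglongrightarrow> 0"
    unfolding h_def by (rule LIMSEQ_Suc[OF lim_1_over_n])
  have \<xi>0: "\<xi> u v \<longlonglongrightarrow> 0" for u v
    by (rule tendsto_sandwich[OF _ _ tendsto_const h0]) (use * in auto)
  have \<eta>0: "\<eta> u v \<longlonglongrightarrow> 0" for u v
    by (rule tendsto_sandwich[OF _ _ tendsto_const h0]) (use * in auto)
  have "continuous_on UNIV (hessian L)"
    using C2 by (simp add: twice_continuously_differentiable_def)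
  then have cH: "isCont (hessian L) x"
    by (simp add: continuous_on_eq_continuous_at)
  have lim: "(\<lambda>n. u \<bullet> (hessian L (x + \<xi> u v n *\<^sub>R u + \<eta> u v n *\<^sub>R v) *v v)) \<longlonglongrightarrow> u \<bullet> (hessian L x *v v)" for u v
  proof -
    have "(\<lambda>n. x + \<xi> u v n *\<^sub>R u + \<eta> u v n *\<^sub>R v) \<longlonglongrightarrow> x + 0 *\<^sub>R u + 0 *\<^sub>R v"
      by (intro tendsto_intros \<xi>0 \<eta>0)
    then have "(\<lambda>n. hessian L (x + \<xi> u v n *\<^sub>R u + \<eta> u v n *\<^sub>R v)) \<longlonglongrightarrow> hessian L x"
      using isCont_tendsto_compose[OF cH] by simp
    then show ?thesis
      by (auto simp: matrix_vector_mult_def inner_vec_def intro!: tendsto_intros)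
  qed
  have "u \<bullet> (hessian L (x + \<xi> u v n *\<^sub>R u + \<eta> u v n *\<^sub>R v) *v v)
      = v \<bullet> (hessian L (x + \<xi> v u n *\<^sub>R v + \<eta> v u n *\<^sub>R u) *v u)" for n
  proof -
    have "(h n)\<^sup>2 * (u \<bullet> (hessian L (x + \<xi> u v n *\<^sub>R u + \<eta> u v n *\<^sub>R v) *v v))
       = (h n)\<^sup>2 * (v \<bullet> (hessian L (x + \<xi> v u n *\<^sub>R v + \<eta> v u n *\<^sub>R u) *v u))"
      using *(5)[of n u v] *(5)[of n v u] by (simp add: algebra_simps)
    then show ?thesis using h[of n] by simp
  qed
  with lim[of u v] lim[of v u] show ?thesis
    by (simp add: LIMSEQ_unique)
qed

end

text \<open>The eigenvector is a maximiser of the quadratic form on the compact unit sphere; scaling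
  extends the inequality to all \<open>v\<close>. The residual \<open>w\<close> is shown to vanish
  by a variation in the direction \<open>w\<close> itself.\<close>

lemma symmetric_max_eigenvector:
  fixes A :: "real ^ 'n ^ 'n"
  assumes sym: "\<And>u v. u \<bullet> (A *v v) = v \<bullet> (A *v u)"
  shows "\<exists>l u. u \<noteq> 0 \<and> A *v u = l *\<^sub>R u \<and> (\<forall>v. v \<bullet> (A *v v) \<le> l * (v \<bullet> v))"
proof -
  have "continuous_on (sphere 0 1) (\<lambda>v::real^'n. v \<bullet> (A *v v))"
    by (intro continuous_intros)
  moreover have "axis undefined 1 \<in> sphere (0::real^'n) 1"
    by (simp add: norm_eq_1 inner_axis_axis)
  ultimately obtain u where u: "u \<in> sphere 0 1"
    and max: "\<And>v. v \<in> sphere 0 1 \<Longrightarrow> v \<bullet> (A *v v) \<le> u \<bullet> (A *v u)"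
    using continuous_attains_sup[of "sphere (0::real^'n) 1" "\<lambda>v. v \<bullet> (A *v v)"] compact_sphere by blast
  define l where "l = u \<bullet> (A *v u)"
  have uu: "u \<bullet> u = 1" using u by (simp add: norm_eq_1)
  have q: "v \<bullet> (A *v v) \<le> l * (v \<bullet> v)" for v
  proof (cases "v = 0")
    case False
    let ?w = "v /\<^sub>R norm v"
    have "?w \<bullet> (A *v ?w) \<le> l"
      unfolding l_def using False by (intro max) simp
    then have "(norm v)\<^sup>2 * (?w \<bullet> (A *v ?w)) \<le> (norm v)\<^sup>2 * l"
      by (intro mult_left_mono) auto
    moreover have "(norm v)\<^sup>2 * (?w \<bullet> (A *v ?w)) = v \<bullet> (A *v v)"
      using False by (simp add: matrix_vector_mult_scaleR power2_eq_square field_simps)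
    ultimately show ?thesis by (simp add: power2_norm_eq_inner mult.commute)
  qed simp
  define w where "w = l *\<^sub>R u - A *v u"
  have "w \<bullet> w = 0"
  proof -
    let ?k = "l * (w \<bullet> w) - w \<bullet> (A *v w)"
    \<comment> \<open>The nonnegative quadratic form \<open>l|v|\<^sup>2 - v\<cdot>Av\<close> vanishes at \<open>u\<close>, so it is stationary there.\<close>
    have *: "0 \<le> 2 * t * (w \<bullet> w) + t\<^sup>2 * ?k" for t
    proof -
      have "0 \<le> l * ((u + t *\<^sub>R w) \<bullet> (u + t *\<^sub>R w)) - (u + t *\<^sub>R w) \<bullet> (A *v (u + t *\<^sub>R w))"
        using q[of "u + t *\<^sub>R w"] by simp
      also have "\<dots> = (l * (u \<bullet> u) - u \<bullet> (A *v u)) + 2 * t * (l * (w \<bullet> u) - w \<bullet> (A *v u)) + t\<^sup>2 * ?k"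
        using sym[of u w] by (simp add: matrix_vector_right_distrib matrix_vector_mult_scaleR
            inner_add_left inner_add_right inner_commute[of u w] power2_eq_square algebra_simps)
      also have "l * (w \<bullet> u) - w \<bullet> (A *v u) = w \<bullet> w"
        by (simp add: w_def inner_diff_right inner_diff_left)
      also have "l * (u \<bullet> u) - u \<bullet> (A *v u) = 0"
        by (simp add: uu l_def)
      finally show ?thesis by simp
    qed
    have k: "?k \<ge> 0" using q[of w] by simp
    \<comment> \<open>With \<open>t = - r\<close> the expression in \<open>*\<close> becomes
      \<open>- r^2 * (2 + ?k)\<close>. The summand 1 keeps the denominator positive when
      \<open>?k\<close> is 0.\<close>
    define r where "r = (w \<bullet> w) / (1 + ?k)"
    have ww: "w \<bullet> w = r * (1 + ?k)" using k by (simp add: r_def)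
    have "0 \<le> 2 * (- r) * (r * (1 + ?k)) + (- r)\<^sup>2 * ?k"
      using *[of "- r"] ww by simp
    then have "r\<^sup>2 * (2 + ?k) \<le> 0" by (simp add: power2_eq_square algebra_simps)
    then have "r = 0" using k by (simp add: mult_le_0_iff)
    then show ?thesis using ww by simp
  qed
  then have "A *v u = l *\<^sub>R u" by (simp add: w_def)
  moreover have "u \<noteq> 0" using uu by auto
  ultimately show ?thesis using q by blast
qed

text \<open>A real eigenvector is also a complex one. Boundedness of the set of moduli has to be
  shown too, since \<open>Sup\<close> says nothing about unbounded sets; the operator norm bounds
  every eigenvalue.\<close>

lemma spectral_radius_ge:
  fixes A :: "real ^ 'n ^ 'n"
  assumes u: "u \<noteq> 0" and Au: "A *v u = l *\<^sub>R u"
  shows "\<bar>l\<bar> \<le> spectral_radius A"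
  unfolding spectral_radius_def
proof (rule cSup_upper)
  let ?A = "(\<chi> i j. complex_of_real (A $ i $ j)) :: complex ^ 'n ^ 'n"
  let ?v = "(\<chi> i. complex_of_real (u $ i)) :: complex ^ 'n"
  have "?A *v ?v = complex_of_real l *s ?v"
  proof (rule vec_eq_iff[THEN iffD2], rule allI)
    fix i
    have "(\<Sum>j\<in>UNIV. A $ i $ j * u $ j) = l * u $ i"
      using Au by (simp add: vec_eq_iff matrix_vector_mult_def)
    then have "complex_of_real (\<Sum>j\<in>UNIV. A $ i $ j * u $ j) = complex_of_real (l * u $ i)"
      by simp
    then show "(?A *v ?v) $ i = (complex_of_real l *s ?v) $ i"
      by (simp add: matrix_vector_mult_def)
  qed
  moreover have "?v \<noteq> 0" using u by (auto simp: vec_eq_iff)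
  ultimately show "\<bar>l\<bar> \<in> {cmod z |z. \<exists>v::complex^'n. v \<noteq> 0 \<and> ?A *v v = z *s v}"
    by (intro CollectI exI[of _ "complex_of_real l"]) auto
  show "bdd_above {cmod z |z. \<exists>v::complex^'n. v \<noteq> 0 \<and> ?A *v v = z *s v}"
  proof (rule bdd_aboveI[of _ "onorm ((*v) ?A)"], clarify)
    fix z and v :: "complex^'n" assume v: "v \<noteq> 0" and e: "?A *v v = z *s v"
    have "norm (z *s v) = cmod z * norm v"
      by (simp add: norm_vec_def norm_mult L2_set_right_distrib)
    moreover have "norm (?A *v v) \<le> onorm ((*v) ?A) * norm v"
      by (rule onorm) simp
    ultimately show "cmod z \<le> onorm ((*v) ?A)" using v e by simp
  qed
qed

text \<open>The largest eigenvalue of \<open>A\<close> bounds the form from above and that of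
  \<open>- A\<close> bounds it from below; up to sign both are eigenvalues of \<open>A\<close>,
  hence at most the spectral radius.\<close>

lemma symmetric_quadratic_form_le:
  fixes A :: "real ^ 'n ^ 'n"
  assumes sym: "\<And>u v. u \<bullet> (A *v v) = v \<bullet> (A *v u)"
  shows "\<bar>v \<bullet> (A *v v)\<bar> \<le> spectral_radius A * (v \<bullet> v)"
proof -
  obtain l u where 1: "u \<noteq> 0" "A *v u = l *\<^sub>R u" "\<And>v. v \<bullet> (A *v v) \<le> l * (v \<bullet> v)"
    using symmetric_max_eigenvector[OF sym] by blast
  have neg: "(- A) *v w = - (A *v w)" for w
    by (simp add: vec_eq_iff matrix_vector_mult_def sum_negf)
  have "u \<bullet> ((- A) *v w) = w \<bullet> ((- A) *v u)" for u w
    using sym[of u w] by (simp add: neg)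
  then obtain l' u' where 2: "u' \<noteq> 0" "(- A) *v u' = l' *\<^sub>R u'" "\<And>v. v \<bullet> ((- A) *v v) \<le> l' * (v \<bullet> v)"
    using symmetric_max_eigenvector[of "- A"] by blast
  have "A *v u' = (- l') *\<^sub>R u'"
    using 2(2) by (simp add: neg) (metis add.inverse_inverse)
  then have "l' \<le> spectral_radius A" "l \<le> spectral_radius A"
    using spectral_radius_ge[OF 1(1,2)] spectral_radius_ge[OF 2(1)] by fastforce+
  then have "l' * (v \<bullet> v) \<le> spectral_radius A * (v \<bullet> v)" "l * (v \<bullet> v) \<le> spectral_radius A * (v \<bullet> v)"
    by (auto intro!: mult_right_mono)
  then show ?thesis using 1(3)[of v] 2(3)[of v] by (simp add: neg)
qed

text \<open>Here the extended-real bound becomes a real constant. Finiteness is essential: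
  \<open>enn2real\<close> maps infinity to 0.\<close>

lemma hessian_quadratic_form_le:
  assumes C2: "twice_continuously_differentiable L" and fin: "hessian_bound L < \<infinity>"
  shows "\<bar>v \<bullet> (hessian L x *v v)\<bar> \<le> enn2real (hessian_bound L) * (v \<bullet> v)"
proof -
  have "ennreal \<bar>spectral_radius (hessian L x)\<bar> \<le> sup_norm (\<lambda>x. spectral_radius (hessian L x))"
    unfolding sup_norm_def by (rule SUP_upper) simp
  also have "\<dots> \<le> hessian_bound L" by (simp add: hessian_bound_def)
  finally have "enn2real (ennreal \<bar>spectral_radius (hessian L x)\<bar>) \<le> enn2real (hessian_bound L)"
    using fin by (intro enn2real_mono) (auto simp: less_top)
  then have "spectral_radius (hessian L x) * (v \<bullet> v) \<le> enn2real (hessian_bound L) * (v \<bullet> v)"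
    by (intro mult_right_mono) auto
  then show ?thesis
    using symmetric_quadratic_form_le[OF hessian_symmetric[OF C2], of v x] by linarith
qed

section \<open>Taylor estimates under a bound on the Hessian form\<close>

context
  fixes L :: "real ^ 'd \<Rightarrow> real" and c :: real
  assumes C2: "twice_continuously_differentiable L"
    and bound: "\<And>x v. \<bar>v \<bullet> (hessian L x *v v)\<bar> \<le> c * (v \<bullet> v)"
begin

lemma grad_line_bound:
  assumes "0 \<le> t"
  shows "grad L (x + t *\<^sub>R v) \<bullet> v \<le> grad L x \<bullet> v + c * (v \<bullet> v) * t"
    and "grad L (x + t *\<^sub>R v) \<bullet> v \<ge> grad L x \<bullet> v - c * (v \<bullet> v) * t"
proof -
  let ?f = "\<lambda>t. grad L (x + t *\<^sub>R v) \<bullet> v"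
  have d: "((\<lambda>t. ?f t + k * t) has_real_derivative v \<bullet> (hessian L (x + s *\<^sub>R v) *v v) + k) (at s)" for k s
    by (rule derivative_eq_intros hessian_line_deriv[OF C2] refl | simp)+
  have b: "v \<bullet> (hessian L (x + s *\<^sub>R v) *v v) + - (c * (v \<bullet> v)) \<le> 0"
    "0 \<le> v \<bullet> (hessian L (x + s *\<^sub>R v) *v v) + c * (v \<bullet> v)" for s
    using bound[of v "x + s *\<^sub>R v"] by linarith+
  have "?f t + - (c * (v \<bullet> v)) * t \<le> ?f 0 + - (c * (v \<bullet> v)) * 0"
    using d b(1) by (intro DERIV_nonpos_imp_nonincreasing[OF assms]) blast
  then show "?f t \<le> grad L x \<bullet> v + c * (v \<bullet> v) * t" by simp
  have "?f t + c * (v \<bullet> v) * t \<ge> ?f 0 + c * (v \<bullet> v) * 0"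
    using d b(2) by (intro DERIV_nonneg_imp_nondecreasing[OF assms]) blast
  then show "?f t \<ge> grad L x \<bullet> v - c * (v \<bullet> v) * t" by simp
qed

lemma descent: "L y \<le> L x + grad L x \<bullet> (y - x) + c / 2 * (norm (y - x))\<^sup>2"
proof -
  let ?v = "y - x"
  let ?f = "\<lambda>t. L (x + t *\<^sub>R ?v) - (grad L x \<bullet> ?v) * t - c / 2 * (?v \<bullet> ?v) * t\<^sup>2"
  have "?f 1 \<le> ?f 0"
  proof (rule DERIV_nonpos_imp_nonincreasing[where f="?f"])
    fix t :: real assume t: "0 \<le> t" "t \<le> 1"
    have "(?f has_real_derivative grad L (x + t *\<^sub>R ?v) \<bullet> ?v - grad L x \<bullet> ?v - c * (?v \<bullet> ?v) * t) (at t)"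
      by (rule derivative_eq_intros grad_line_deriv[OF C2] refl | simp)+
    moreover have "grad L (x + t *\<^sub>R ?v) \<bullet> ?v - grad L x \<bullet> ?v - c * (?v \<bullet> ?v) * t \<le> 0"
      using grad_line_bound(1)[OF t(1), of x ?v] by linarith
    ultimately show "\<exists>d. (?f has_real_derivative d) (at t) \<and> d \<le> 0" by blast
  qed simp
  then show ?thesis by (simp add: power2_norm_eq_inner)
qed

lemma grad_one_sided: "(grad L y - grad L x) \<bullet> (y - x) \<ge> - c * (norm (y - x))\<^sup>2"
  using grad_line_bound(2)[of 1 x "y - x"] by (simp add: power2_norm_eq_inner inner_diff_left)

text \<open>The descent inequality at the gradient step of length \<open>1 / c\<close>, which
  minimises its right-hand side, cannot fall below \<open>m\<close>. Thus the gradient grows at most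
  like the square root of \<open>L - m\<close>, which the exponential weight later absorbs.\<close>

lemma grad_sq_le:
  assumes c: "c > 0" and inf: "\<And>x. m \<le> L x"
  shows "(norm (grad L x))\<^sup>2 \<le> 2 * c * (L x - m)"
proof -
  have "m \<le> L (x - (1 / c) *\<^sub>R grad L x)" by (rule inf)
  also have "\<dots> \<le> L x - (1 / c) * (norm (grad L x))\<^sup>2 + c / 2 * ((1 / c) * norm (grad L x))\<^sup>2"
    using descent[of "x - (1 / c) *\<^sub>R grad L x" x] c by (simp add: power2_norm_eq_inner)
  also have "\<dots> = L x - 1 / (2 * c) * (norm (grad L x))\<^sup>2"
    using c by (simp add: power2_eq_square field_simps)
  finally show ?thesis using c by (simp add: field_simps)
qed

end

section \<open>Square-integrable functions\<close>

definition sq_integrable :: "'a measure \<Rightarrow> ('a \<Rightarrow> 'b::euclidean_space) \<Rightarrow> bool" where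
  "sq_integrable M f \<longleftrightarrow> f \<in> borel_measurable M \<and> integrable M (\<lambda>x. (norm (f x))\<^sup>2)"

text \<open>A seminorm on functions rather than a norm on classes, so that versions of stochastic
  integrals can be compared directly. The Bochner integral of a non-integrable square defaults to 0,
  hence the integrability hypotheses in the inequalities below.\<close>

definition l2norm :: "'a measure \<Rightarrow> ('a \<Rightarrow> 'b::euclidean_space) \<Rightarrow> real" where
  "l2norm M f = sqrt (\<integral>x. (norm (f x))\<^sup>2 \<partial>M)"

lemma sq_integrable_measurable: "sq_integrable M f \<Longrightarrow> f \<in> borel_measurable M"
  by (simp add: sq_integrable_def)

lemma l2norm_nonneg [simp]: "0 \<le> l2norm M f"
  by (simp add: l2norm_def)

lemma l2norm_sq: "(l2norm M f)\<^sup>2 = (\<integral>x. (norm (f x))\<^sup>2 \<partial>M)"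
  by (simp add: l2norm_def)

lemma sq_integrable_bound:
  fixes f :: "'a \<Rightarrow> 'b::euclidean_space" and g :: "'a \<Rightarrow> 'c::euclidean_space"
  assumes "sq_integrable M g" "f \<in> borel_measurable M" "\<And>x. x \<in> space M \<Longrightarrow> norm (f x) \<le> C * norm (g x)"
  shows "sq_integrable M f"
  unfolding sq_integrable_def
proof
  have "integrable M (\<lambda>x. C\<^sup>2 * (norm (g x))\<^sup>2)"
    using assms by (simp add: sq_integrable_def)
  then show "integrable M (\<lambda>x. (norm (f x))\<^sup>2)"
  proof (rule Bochner_Integration.integrable_bound)
    have "(norm (f x))\<^sup>2 \<le> (C * norm (g x))\<^sup>2" if "x \<in> space M" for x
      using assms(3)[OF that] by (intro power_mono) auto
    then show "AE x in M. norm ((norm (f x))\<^sup>2) \<le> norm (C\<^sup>2 * (norm (g x))\<^sup>2)"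
      by (intro AE_I2) (simp add: power_mult_distrib)
  qed (use assms in measurable)
qed (use assms in simp)

lemma sq_integrable_add:
  assumes f: "sq_integrable M f" and g: "sq_integrable M g"
  shows "sq_integrable M (\<lambda>x. f x + g x)"
  unfolding sq_integrable_def
proof
  have [measurable]: "f \<in> borel_measurable M" "g \<in> borel_measurable M"
    using f g by (auto simp: sq_integrable_def)
  show "(\<lambda>x. f x + g x) \<in> borel_measurable M" by measurable
  have "integrable M (\<lambda>x. 2 * (norm (f x))\<^sup>2 + 2 * (norm (g x))\<^sup>2)"
    using f g by (simp add: sq_integrable_def)
  then show "integrable M (\<lambda>x. (norm (f x + g x))\<^sup>2)"
  proof (rule Bochner_Integration.integrable_bound)
    have "(norm (f x + g x))\<^sup>2 \<le> 2 * (norm (f x))\<^sup>2 + 2 * (norm (g x))\<^sup>2" for x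
    proof -
      have "(norm (f x + g x))\<^sup>2 \<le> (norm (f x) + norm (g x))\<^sup>2"
        by (intro power_mono norm_triangle_ineq) auto
      also have "\<dots> \<le> 2 * (norm (f x))\<^sup>2 + 2 * (norm (g x))\<^sup>2"
        using sum_squares_bound[of "norm (f x)" "norm (g x)"] by (simp add: power2_sum)
      finally show ?thesis .
    qed
    then show "AE x in M. norm ((norm (f x + g x))\<^sup>2) \<le> norm (2 * (norm (f x))\<^sup>2 + 2 * (norm (g x))\<^sup>2)"
      by simp
  qed measurable
qed

lemma sq_integrable_scaleR: "sq_integrable M f \<Longrightarrow> sq_integrable M (\<lambda>x. c *\<^sub>R f x)"
  by (rule sq_integrable_bound[where g=f and C="\<bar>c\<bar>"]) (auto simp: sq_integrable_def)

lemma sq_integrable_norm: "sq_integrable M f \<Longrightarrow> sq_integrable M (\<lambda>x. norm (f x))"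
  by (rule sq_integrable_bound[where g=f and C=1]) (auto simp: sq_integrable_def)

lemma sq_integrable_minus: "sq_integrable M f \<Longrightarrow> sq_integrable M (\<lambda>x. - f x)"
  using sq_integrable_scaleR[of M f "- 1"] by simp

lemma sq_integrable_diff:
  "sq_integrable M f \<Longrightarrow> sq_integrable M g \<Longrightarrow> sq_integrable M (\<lambda>x. f x - g x)"
  using sq_integrable_add[OF _ sq_integrable_minus] by fastforce

lemma integrable_inner_sq:
  assumes f: "sq_integrable M f" and g: "sq_integrable M g"
  shows "integrable M (\<lambda>x. f x \<bullet> g x)" "integrable M (\<lambda>x. norm (f x) * norm (g x))"
proof -
  have [measurable]: "f \<in> borel_measurable M" "g \<in> borel_measurable M"
    using f g by (auto simp: sq_integrable_def)
  have int: "integrable M (\<lambda>x. (norm (f x))\<^sup>2 + (norm (g x))\<^sup>2)"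
    using f g by (simp add: sq_integrable_def)
  have *: "norm (f x) * norm (g x) \<le> (norm (f x))\<^sup>2 + (norm (g x))\<^sup>2" for x
    using sum_squares_bound[of "norm (f x)" "norm (g x)"] mult_nonneg_nonneg[OF norm_ge_zero norm_ge_zero, of "f x" "g x"]
    by linarith
  show "integrable M (\<lambda>x. norm (f x) * norm (g x))"
    by (rule Bochner_Integration.integrable_bound[OF int]) (use * in auto)
  then show "integrable M (\<lambda>x. f x \<bullet> g x)"
    by (rule Bochner_Integration.integrable_bound) (auto intro: Cauchy_Schwarz_ineq2)
qed

lemma integrable_mult_sq:
  fixes f g :: "'a \<Rightarrow> real"
  shows "sq_integrable M f \<Longrightarrow> sq_integrable M g \<Longrightarrow> integrable M (\<lambda>x. f x * g x)"
  using integrable_inner_sq(1)[of M f g] by simp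

lemma Cauchy_Schwarz_integral:
  assumes f: "sq_integrable M f" and g: "sq_integrable M g"
  shows "(\<integral>x. norm (f x) * norm (g x) \<partial>M) \<le> l2norm M f * l2norm M g"
    and "\<bar>\<integral>x. f x \<bullet> g x \<partial>M\<bar> \<le> l2norm M f * l2norm M g"
proof -
  have [measurable]: "f \<in> borel_measurable M" "g \<in> borel_measurable M"
    and i: "integrable M (\<lambda>x. (norm (f x))\<^sup>2)" "integrable M (\<lambda>x. (norm (g x))\<^sup>2)"
    using f g by (auto simp: sq_integrable_def)
  let ?p = "\<integral>x. norm (f x) * norm (g x) \<partial>M"
  have p: "0 \<le> ?p" by simp
  have "(\<integral>\<^sup>+x. ennreal (norm (f x)) * ennreal (norm (g x)) \<partial>M) = ennreal ?p"
    using nn_integral_eq_integral[OF integrable_inner_sq(2)[OF f g]] by (simp add: ennreal_mult)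
  moreover have "(\<integral>\<^sup>+x. ennreal (norm (f x)) ^ 2 \<partial>M) = ennreal ((l2norm M f)\<^sup>2)"
    using nn_integral_eq_integral[OF i(1)] by (simp add: ennreal_power l2norm_sq)
  moreover have "(\<integral>\<^sup>+x. ennreal (norm (g x)) ^ 2 \<partial>M) = ennreal ((l2norm M g)\<^sup>2)"
    using nn_integral_eq_integral[OF i(2)] by (simp add: ennreal_power l2norm_sq)
  ultimately have "ennreal (?p\<^sup>2) \<le> ennreal ((l2norm M f * l2norm M g)\<^sup>2)"
    using Cauchy_Schwarz_nn_integral[of "\<lambda>x. ennreal (norm (f x))" M "\<lambda>x. ennreal (norm (g x))"] p
    by (simp add: ennreal_power ennreal_mult power_mult_distrib)
  then have "?p\<^sup>2 \<le> (l2norm M f * l2norm M g)\<^sup>2"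
    by (simp add: ennreal_le_iff)
  then show 1: "?p \<le> l2norm M f * l2norm M g"
    by (rule power2_le_imp_le) simp
  have "\<bar>\<integral>x. f x \<bullet> g x \<partial>M\<bar> \<le> (\<integral>x. \<bar>f x \<bullet> g x\<bar> \<partial>M)" by (rule integral_abs_bound)
  also have "\<dots> \<le> ?p"
    by (intro integral_mono integrable_abs integrable_inner_sq f g Cauchy_Schwarz_ineq2)
  finally show "\<bar>\<integral>x. f x \<bullet> g x \<partial>M\<bar> \<le> l2norm M f * l2norm M g" using 1 by linarith
qed

lemma integral_norm_add_sq:
  assumes f: "sq_integrable M f" and g: "sq_integrable M g"
  shows "(\<integral>x. (norm (f x + g x))\<^sup>2 \<partial>M) =
    (\<integral>x. (norm (f x))\<^sup>2 \<partial>M) + 2 * (\<integral>x. f x \<bullet> g x \<partial>M) + (\<integral>x. (norm (g x))\<^sup>2 \<partial>M)"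
proof -
  have "(\<lambda>x. (norm (f x + g x))\<^sup>2) = (\<lambda>x. (norm (f x))\<^sup>2 + 2 * (f x \<bullet> g x) + (norm (g x))\<^sup>2)"
    by (simp add: power2_norm_eq_inner inner_add_left inner_add_right inner_commute fun_eq_iff)
  moreover have "integrable M (\<lambda>x. (norm (f x))\<^sup>2)" "integrable M (\<lambda>x. (norm (g x))\<^sup>2)"
      "integrable M (\<lambda>x. f x \<bullet> g x)"
    using f g integrable_inner_sq by (auto simp: sq_integrable_def)
  ultimately show ?thesis by simp
qed

lemma l2norm_triangle:
  assumes f: "sq_integrable M f" and g: "sq_integrable M g"
  shows "l2norm M (\<lambda>x. f x + g x) \<le> l2norm M f + l2norm M g"
proof (rule power2_le_imp_le)
  have "(l2norm M (\<lambda>x. f x + g x))\<^sup>2 = (l2norm M f)\<^sup>2 + 2 * (\<integral>x. f x \<bullet> g x \<partial>M) + (l2norm M g)\<^sup>2"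
    by (simp add: l2norm_sq integral_norm_add_sq[OF f g])
  also have "\<dots> \<le> (l2norm M f + l2norm M g)\<^sup>2"
    using Cauchy_Schwarz_integral(2)[OF f g] by (simp add: power2_sum)
  finally show "(l2norm M (\<lambda>x. f x + g x))\<^sup>2 \<le> (l2norm M f + l2norm M g)\<^sup>2" .
qed simp

lemma l2norm_minus [simp]: "l2norm M (\<lambda>x. - f x) = l2norm M f"
  by (simp add: l2norm_def)

lemma l2norm_scaleR: "l2norm M (\<lambda>x. c *\<^sub>R f x) = \<bar>c\<bar> * l2norm M f"
  by (simp add: l2norm_def power_mult_distrib real_sqrt_mult)

lemma l2norm_triangle_diff:
  assumes f: "sq_integrable M f" and g: "sq_integrable M g"
  shows "l2norm M (\<lambda>x. f x - g x) \<le> l2norm M f + l2norm M g"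
  using l2norm_triangle[OF f sq_integrable_minus[OF g]] by simp

lemma l2norm_mono:
  assumes g: "sq_integrable M g" and f: "f \<in> borel_measurable M"
    and le: "\<And>x. x \<in> space M \<Longrightarrow> norm (f x) \<le> norm (g x)"
  shows "l2norm M f \<le> l2norm M g"
proof -
  have "sq_integrable M f"
    using sq_integrable_bound[OF g f, of 1] le by simp
  then show ?thesis
    using g unfolding l2norm_def sq_integrable_def
    by (intro real_sqrt_le_mono integral_mono) (auto intro: power_mono le)
qed

lemma nn_integral_sq_eq_l2norm:
  fixes f :: "'a \<Rightarrow> real"
  assumes "sq_integrable M f"
  shows "(\<integral>\<^sup>+x. ennreal ((f x)\<^sup>2) \<partial>M) = ennreal ((l2norm M f)\<^sup>2)"
  using assms nn_integral_eq_integral[of M "\<lambda>x. (f x)\<^sup>2"] by (simp add: sq_integrable_def l2norm_sq)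

lemma sq_integrable_if_nn_integral:
  fixes f :: "'a \<Rightarrow> 'b::euclidean_space"
  assumes "f \<in> borel_measurable M" "(\<integral>\<^sup>+x. ennreal ((norm (f x))\<^sup>2) \<partial>M) < \<infinity>"
  shows "sq_integrable M f"
  using assms by (auto simp: sq_integrable_def integrable_iff_bounded)

lemma tendsto_ennreal_sq_zero:
  fixes f :: "nat \<Rightarrow> real"
  assumes "(\<lambda>m. ennreal ((f m)\<^sup>2)) \<longlonglongrightarrow> 0"
  shows "f \<longlonglongrightarrow> 0"
proof -
  have "(\<lambda>m. (f m)\<^sup>2) \<longlonglongrightarrow> 0"
    using assms by (subst (asm) ennreal_0[symmetric], subst (asm) tendsto_ennreal_iff) auto
  then have "(\<lambda>m. sqrt ((f m)\<^sup>2)) \<longlonglongrightarrow> sqrt 0" by (intro tendsto_real_sqrt)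
  then show ?thesis by (simp add: tendsto_rabs_zero_iff)
qed

context prob_space
begin

lemma sq_integrable_const [simp]: "sq_integrable M (\<lambda>x. c)"
  by (simp add: sq_integrable_def)

lemma sq_integrable_imp_integrable:
  assumes f: "sq_integrable M f"
  shows "integrable M f"
proof -
  have "sq_integrable M (\<lambda>x. norm (f x))" by (rule sq_integrable_norm[OF f])
  then have "integrable M (\<lambda>x. norm (f x))"
    by (rule square_integrable_imp_integrable[OF sq_integrable_measurable])
      (use f in \<open>simp add: sq_integrable_def\<close>)
  then show ?thesis by (rule integrable_norm_cancel[OF _ sq_integrable_measurable[OF f]])
qed

lemma sq_integrable_bounded:
  assumes "f \<in> borel_measurable M" "\<And>x. x \<in> space M \<Longrightarrow> norm (f x) \<le> C"
  shows "sq_integrable M f"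
  by (rule sq_integrable_bound[OF sq_integrable_const[of "1::real"] assms(1), of C]) (use assms in auto)

end

section \<open>Ito increments\<close>

text \<open>Conditional mean 0 and conditional variance \<open>t - s\<close> of an increment,
  expressed by integrals against past variables \<open>Y\<close> instead of conditional
  expectations. Isometry and orthogonality are derived from these two identities.\<close>

locale brownian_filtration = prob_space M for M :: "'w measure" +
  fixes F :: "real \<Rightarrow> 'w measure" and B :: "real \<Rightarrow> 'w \<Rightarrow> real"
  assumes subalg: "subalgebra M (F t)"
    and F_mono: "s \<le> t \<Longrightarrow> sets (F s) \<subseteq> sets (F t)"
    and adapted: "0 \<le> t \<Longrightarrow> B t \<in> borel_measurable (F t)"
    and incr1: "0 \<le> s \<Longrightarrow> s \<le> t \<Longrightarrow> Y \<in> borel_measurable (F s) \<Longrightarrow> integrable M Y \<Longrightarrow>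
       has_bochner_integral M (\<lambda>w. Y w * (B t w - B s w)) 0"
    and incr2: "0 \<le> s \<Longrightarrow> s \<le> t \<Longrightarrow> Y \<in> borel_measurable (F s) \<Longrightarrow> integrable M Y \<Longrightarrow>
       has_bochner_integral M (\<lambda>w. Y w * (B t w - B s w)\<^sup>2) ((\<integral>w. Y w \<partial>M) * (t - s))"

text \<open>Independence of \<open>W t - W s\<close> from \<open>F s\<close> factorises the
  expectation; the factors belonging to the increment are normal moments.\<close>

lemma brownian_basis_component:
  fixes W :: "real \<Rightarrow> 'w \<Rightarrow> real ^ 'd"
  assumes "brownian_basis M F W"
  shows "brownian_filtration M F (\<lambda>t w. W t w $ i)"
proof -
  interpret prob_space M using assms by (simp add: brownian_basis_def)
  interpret filtration "space M" F using assms by (simp add: brownian_basis_def)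
  have sub: "subalgebra M (F t)" for t using assms by (simp add: brownian_basis_def)
  have W: "t \<ge> 0 \<Longrightarrow> W t \<in> borel_measurable (F t)" for t
    using assms by (simp add: brownian_basis_def)
  let ?B = "\<lambda>t w. W t w $ i"
  have dist: "distributed M lborel (\<lambda>w. ?B t w - ?B s w) (normal_density 0 (sqrt (t - s)))"
    if "0 \<le> s" "s < t" for s t
    using assms that by (simp add: brownian_basis_def standard_brownian_motion_def)
  have prod: "has_bochner_integral M (\<lambda>w. Y w * g (?B t w - ?B s w))
      ((\<integral>w. Y w \<partial>M) * (\<integral>w. g (?B t w - ?B s w) \<partial>M))"
    if st: "0 \<le> s" "s \<le> t" and Y: "Y \<in> borel_measurable (F s)" "integrable M Y"
      and g: "g \<in> borel_measurable borel" "integrable M (\<lambda>w. g (?B t w - ?B s w))"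
    for s t and Y :: "'w \<Rightarrow> real" and g :: "real \<Rightarrow> real"
  proof -
    let ?G = "\<lambda>w. g (?B t w - ?B s w)"
    let ?V = "vimage_algebra (space M) (\<lambda>w. W t w - W s w) borel"
    have ind: "indep_set (sets (F s)) (sets ?V)"
      using assms st by (simp add: brownian_basis_def)
    have sp: "space ?V = space M" by simp
    have "(\<lambda>w. W t w - W s w) \<in> measurable ?V borel"
      by (rule measurable_vimage_algebra1) auto
    then have GV: "?G \<in> borel_measurable ?V"
      using measurable_compose[of "\<lambda>w. W t w - W s w" ?V borel "\<lambda>v. g (v $ i)" borel] g(1) by simp
    \<comment> \<open>Both generated sigma-algebras lie inside independent ones: that of
      \<open>Y\<close> in \<open>sets (F s)\<close>, that of \<open>?G\<close> in the one generated
      by the whole vector increment.\<close>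
    have "indep_var borel Y borel ?G"
      unfolding indep_var_eq
    proof (intro conjI)
      show "random_variable borel Y" using Y(2) by simp
      show "random_variable borel ?G" using g(2) by simp
      have "sigma_sets (space M) {Y -` A \<inter> space M |A. A \<in> sets borel} \<subseteq> sets (F s)"
        using measurable_sets[OF Y(1)] by (intro sets.sigma_sets_subset[of _ "F s", unfolded space_F]) (auto simp: space_F)
      moreover have "sigma_sets (space M) {?G -` A \<inter> space M |A. A \<in> sets borel} \<subseteq> sets ?V"
        using measurable_sets[OF GV] by (intro sets.sigma_sets_subset[of _ ?V, unfolded sp]) auto
      ultimately show "indep_set (sigma_sets (space M) {Y -` A \<inter> space M |A. A \<in> sets borel})
          (sigma_sets (space M) {?G -` A \<inter> space M |A. A \<in> sets borel})"
        using ind unfolding indep_set_def by (elim indep_sets_mono_sets) (auto split: bool.split)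
    qed
    then show ?thesis
      using indep_var_integrable[OF _ Y(2) g(2)] indep_var_lebesgue_integral[OF _ Y(2) g(2)]
      by (simp add: has_bochner_integral_iff)
  qed
  have mom: "integrable M (\<lambda>w. ?B t w - ?B s w)" "(\<integral>w. ?B t w - ?B s w \<partial>M) = 0"
     "integrable M (\<lambda>w. (?B t w - ?B s w)\<^sup>2)" "(\<integral>w. (?B t w - ?B s w)\<^sup>2 \<partial>M) = t - s"
    if st: "0 \<le> s" "s \<le> t" for s t
  proof -
    have "integrable M (\<lambda>w. ?B t w - ?B s w) \<and> (\<integral>w. ?B t w - ?B s w \<partial>M) = 0 \<and>
     integrable M (\<lambda>w. (?B t w - ?B s w)\<^sup>2) \<and> (\<integral>w. (?B t w - ?B s w)\<^sup>2 \<partial>M) = t - s"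
    \<comment> \<open>The normal law is specified for \<open>s < t\<close> only; for
      \<open>s = t\<close> the increment is 0.\<close>
    proof (cases "s = t")
      case False
      with st have "s < t" by simp
      note d = dist[OF st(1) this]
      have pos: "0 < sqrt (t - s)" using \<open>s < t\<close> by simp
      have "integrable M (\<lambda>w. ?B t w - ?B s w)"
        using distributed_integrable[OF d, of "\<lambda>x. x"] integrable_normal_moment_nz_1[OF pos, of 0] by simp
      moreover have "(\<integral>w. ?B t w - ?B s w \<partial>M) = 0"
        using distributed_integral[OF d, of "\<lambda>x. x"] integral_normal_moment_nz_1[OF pos, of 0] by simp
      moreover have "integrable M (\<lambda>w. (?B t w - ?B s w)\<^sup>2)"
        using distributed_integrable[OF d, of "\<lambda>x. x\<^sup>2"] integrable_normal_moment[OF pos, of 0 2] by simp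
      moreover have "(\<integral>w. (?B t w - ?B s w)\<^sup>2 \<partial>M) = t - s"
        using distributed_integral[OF d, of "\<lambda>x. x\<^sup>2"] integral_normal_moment_even[OF pos, of 0 1] \<open>s < t\<close>
        by simp
      ultimately show ?thesis by blast
    qed simp
    then show "integrable M (\<lambda>w. ?B t w - ?B s w)" "(\<integral>w. ?B t w - ?B s w \<partial>M) = 0"
     "integrable M (\<lambda>w. (?B t w - ?B s w)\<^sup>2)" "(\<integral>w. (?B t w - ?B s w)\<^sup>2 \<partial>M) = t - s"
      by blast+
  qed
  show ?thesis
  proof
    show "subalgebra M (F t)" for t by (rule sub)
    show "s \<le> t \<Longrightarrow> sets (F s) \<subseteq> sets (F t)" for s t by (rule sets_F_mono)
    show "0 \<le> t \<Longrightarrow> ?B t \<in> borel_measurable (F t)" for t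
      using measurable_compose[OF W borel_measurable_continuous_onI[of "\<lambda>v. v $ i"]]
      by (simp add: continuous_on_component)
    show "has_bochner_integral M (\<lambda>w. Y w * (?B t w - ?B s w)) 0"
      if "0 \<le> s" "s \<le> t" "Y \<in> borel_measurable (F s)" "integrable M Y" for s t Y
      using prod[OF that, of "\<lambda>x. x"] mom[OF that(1,2)] by simp
    show "has_bochner_integral M (\<lambda>w. Y w * (?B t w - ?B s w)\<^sup>2) ((\<integral>w. Y w \<partial>M) * (t - s))"
      if "0 \<le> s" "s \<le> t" "Y \<in> borel_measurable (F s)" "integrable M Y" for s t Y
      using prod[OF that, of "\<lambda>x. x\<^sup>2"] mom[OF that(1,2)] by simp
  qed
qed

lemma integrable_bounded_mult:
  fixes f g :: "'a \<Rightarrow> real"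
  assumes "integrable M f" "g \<in> borel_measurable M" "\<And>x. x \<in> space M \<Longrightarrow> \<bar>g x\<bar> \<le> C"
  shows "integrable M (\<lambda>x. g x * f x)"
proof (rule Bochner_Integration.integrable_bound)
  show "integrable M (\<lambda>x. C * f x)" using assms(1) by simp
  show "(\<lambda>x. g x * f x) \<in> borel_measurable M" using assms by measurable
  show "AE x in M. norm (g x * f x) \<le> norm (C * f x)"
  proof (rule AE_I2)
    fix x assume "x \<in> space M"
    then have "\<bar>g x\<bar> \<le> \<bar>C\<bar>" using assms(3)[of x] by linarith
    then show "norm (g x * f x) \<le> norm (C * f x)"
      by (simp add: abs_mult mult_right_mono)
  qed
qed

context brownian_filtration
begin

text \<open>One summand of a simple integral, detached from any partition. Clipping intervals at a
  time \<open>s\<close> and pooling two partitions then stay inside the same notion.\<close>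

definition elementary :: "real \<Rightarrow> real \<Rightarrow> ('w \<Rightarrow> real) \<Rightarrow> bool" where
  "elementary a b \<xi> \<longleftrightarrow> 0 \<le> a \<and> a \<le> b \<and> \<xi> \<in> borel_measurable (F a) \<and> (\<exists>C. \<forall>w\<in>space M. \<bar>\<xi> w\<bar> \<le> C)"

lemma F_measurable_mono:
  assumes st: "s \<le> t" and f: "f \<in> measurable (F s) N"
  shows "f \<in> measurable (F t) N"
proof (rule measurable_from_subalg[OF _ f])
  have "space (F s) = space M" "space (F t) = space M"
    using subalg by (simp_all only: subalgebra_def)
  then show "subalgebra (F t) (F s)"
    using F_mono[OF st] by (simp only: subalgebra_def)
qed

lemma F_measurable: "f \<in> measurable (F s) N \<Longrightarrow> f \<in> measurable M N"
  by (rule measurable_from_subalg[OF subalg])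

lemma incr_measurable [measurable]: "0 \<le> t \<Longrightarrow> B t \<in> borel_measurable M"
  by (rule F_measurable[OF adapted])

lemma incr_adapted: "0 \<le> s \<Longrightarrow> s \<le> t \<Longrightarrow> t \<le> u \<Longrightarrow> (\<lambda>w. B t w - B s w) \<in> borel_measurable (F u)"
  by (intro borel_measurable_diff F_measurable_mono[OF _ adapted]) auto

lemma incr_sq_integrable:
  assumes st: "0 \<le> s" "s \<le> t"
  shows "sq_integrable M (\<lambda>w. B t w - B s w)"
proof -
  have "has_bochner_integral M (\<lambda>w. 1 * (B t w - B s w)\<^sup>2) ((\<integral>w. 1 \<partial>M) * (t - s))"
    by (rule incr2[OF st]) auto
  then show ?thesis
    unfolding sq_integrable_def
    using F_measurable[OF incr_adapted[OF st order_refl]] by (simp add: has_bochner_integral_iff)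
qed

text \<open>Splitting both increments at \<open>c\<close> and at the earlier end point isolates the
  common interval, which contributes its length by \<open>incr2\<close>. Every other product
  contains an increment that begins after all remaining factors are known, so it vanishes by
  \<open>incr1\<close>.\<close>

lemma elementary_prod_aux:
  assumes \<xi>: "elementary a b \<xi>" and \<eta>: "elementary c d \<eta>" and ac: "a \<le> c"
  shows "has_bochner_integral M (\<lambda>w. (\<xi> w * (B b w - B a w)) * (\<eta> w * (B d w - B c w)))
           ((\<integral>w. \<xi> w * \<eta> w \<partial>M) * max 0 (min b d - c))"
proof -
  from \<xi> obtain C1 where a: "0 \<le> a" "a \<le> b" and \<xi>m: "\<xi> \<in> borel_measurable (F a)"
    and C1: "\<And>w. w \<in> space M \<Longrightarrow> \<bar>\<xi> w\<bar> \<le> C1" by (auto simp: elementary_def)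
  from \<eta> obtain C2 where c: "0 \<le> c" "c \<le> d" and \<eta>m: "\<eta> \<in> borel_measurable (F c)"
    and C2: "\<And>w. w \<in> space M \<Longrightarrow> \<bar>\<eta> w\<bar> \<le> C2" by (auto simp: elementary_def)
  have \<xi>c: "\<xi> \<in> borel_measurable (F c)" by (rule F_measurable_mono[OF ac \<xi>m])
  have [measurable]: "\<xi> \<in> borel_measurable M" "\<eta> \<in> borel_measurable M"
    by (rule F_measurable[OF \<xi>m], rule F_measurable[OF \<eta>m])
  have int: "integrable M (\<lambda>w. \<xi> w * \<eta> w * f w)" if "integrable M f" for f
    by (rule integrable_bounded_mult[OF that, of _ "C1 * C2"])
       (use C1 C2 in \<open>auto simp: abs_mult intro!: mult_mono intro: order_trans[OF abs_ge_zero]\<close>)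
  have \<xi>\<eta>: "integrable M (\<lambda>w. \<xi> w * \<eta> w)" using int[of "\<lambda>_. 1"] by simp
  have incr_int: "integrable M (\<lambda>w. B t w - B s w)" if "0 \<le> s" "s \<le> t" for s t
    by (rule sq_integrable_imp_integrable[OF incr_sq_integrable[OF that]])
  show ?thesis
  proof (cases "b \<le> c")
    case True
    have "has_bochner_integral M (\<lambda>w. (\<xi> w * \<eta> w * (B b w - B a w)) * (B d w - B c w)) 0"
      using a c True \<xi>c \<eta>m by (intro incr1 int incr_int borel_measurable_times incr_adapted) auto
    moreover have "max 0 (min b d - c) = 0" using True c by auto
    ultimately show ?thesis by (simp add: ac_simps)
  next
    case False
    define e where "e = min b d"
    have e: "c \<le> e" "e \<le> b" "e \<le> d" using False c by (auto simp: e_def)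
    have 1: "has_bochner_integral M (\<lambda>w. (\<xi> w * \<eta> w * (B c w - B a w)) * (B d w - B c w)) 0"
      using a c ac \<xi>c \<eta>m by (intro incr1 int incr_int borel_measurable_times incr_adapted) auto
    have 2: "has_bochner_integral M (\<lambda>w. (\<xi> w * \<eta> w) * (B e w - B c w)\<^sup>2) ((\<integral>w. \<xi> w * \<eta> w \<partial>M) * (e - c))"
      using a c e \<xi>c \<eta>m by (intro incr2 \<xi>\<eta> borel_measurable_times) auto
    have m: "(\<lambda>w. \<xi> w * \<eta> w * (B e w - B c w)) \<in> borel_measurable (F e)"
      using a c e \<xi>c \<eta>m by (intro borel_measurable_times incr_adapted F_measurable_mono[OF e(1)]) auto
    have 3: "has_bochner_integral M (\<lambda>w. (\<xi> w * \<eta> w * (B e w - B c w)) * (B d w - B e w)) 0"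
      using a c e by (intro incr1 int incr_int m) auto
    have 4: "has_bochner_integral M (\<lambda>w. (\<xi> w * \<eta> w * (B e w - B c w)) * (B b w - B e w)) 0"
      using a c e by (intro incr1 int incr_int m) auto
    \<comment> \<open>Since \<open>e\<close> is \<open>b\<close> or \<open>d\<close>, one of the
      last two products is zero; writing both covers the two cases by one formula.\<close>
    have eq: "(\<xi> w * (B b w - B a w)) * (\<eta> w * (B d w - B c w)) =
       ((\<xi> w * \<eta> w * (B c w - B a w)) * (B d w - B c w) + (\<xi> w * \<eta> w) * (B e w - B c w)\<^sup>2) +
       ((\<xi> w * \<eta> w * (B e w - B c w)) * (B d w - B e w) + (\<xi> w * \<eta> w * (B e w - B c w)) * (B b w - B e w))" for w
    proof (cases "b \<le> d")
      case True
      then have "e = b" by (simp add: e_def)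
      then show ?thesis by (simp add: power2_eq_square algebra_simps)
    next
      case False
      then have "e = d" by (simp add: e_def)
      then show ?thesis by (simp add: power2_eq_square algebra_simps)
    qed
    have "max 0 (min b d - c) = e - c" using e(1) by (simp add: e_def)
    with has_bochner_integral_add[OF has_bochner_integral_add[OF 1 2] has_bochner_integral_add[OF 3 4]]
    show ?thesis by (simp add: eq)
  qed
qed

lemma elementary_prod:
  assumes "elementary a b \<xi>" "elementary c d \<eta>"
  shows "has_bochner_integral M (\<lambda>w. (\<xi> w * (B b w - B a w)) * (\<eta> w * (B d w - B c w)))
           ((\<integral>w. \<xi> w * \<eta> w \<partial>M) * max 0 (min b d - max a c))"
proof (cases "a \<le> c")
  case True
  then show ?thesis using elementary_prod_aux[OF assms] by (simp add: max_absorb2)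
next
  case False
  then show ?thesis using elementary_prod_aux[OF assms(2,1)] by (simp add: ac_simps max_absorb1)
qed

lemma elementary_measurable: "elementary a b \<xi> \<Longrightarrow> \<xi> \<in> borel_measurable M"
  by (auto simp: elementary_def intro: F_measurable)

lemma elementary_integrable_prod:
  assumes \<xi>: "elementary a b \<xi>" and \<eta>: "elementary c d \<eta>"
  shows "integrable M (\<lambda>w. \<xi> w * \<eta> w)"
proof -
  have "sq_integrable M \<xi>" "sq_integrable M \<eta>"
    using \<xi> \<eta> by (auto simp: elementary_def intro!: sq_integrable_bounded F_measurable)
  then show ?thesis by (rule integrable_mult_sq)
qed

text \<open>The intervals may overlap in any way. Both squared norms expand into the double sum
  \<open>?Q\<close>, in which a pair contributes the mean of the product of its coefficients times
  the length of the intersection. Hence a difference of two simple integrals over unrelated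
  partitions is covered with no common refinement.\<close>

lemma elementary_isometry:
  assumes K: "finite K" and el: "\<And>k. k \<in> K \<Longrightarrow> elementary (a k) (b k) (\<xi> k)"
  defines "S \<equiv> \<lambda>w. \<Sum>k\<in>K. \<xi> k w * (B (b k) w - B (a k) w)"
    and "v \<equiv> \<lambda>z. \<Sum>k\<in>K. \<xi> k (fst z) * indicator {a k<..b k} (snd z)"
  shows "sq_integrable M S" "sq_integrable (M \<Otimes>\<^sub>M lborel) v" "l2norm M S = l2norm (M \<Otimes>\<^sub>M lborel) v"
proof -
  interpret P: pair_sigma_finite M lborel ..
  let ?ov = "\<lambda>k l. max 0 (min (b k) (b l) - max (a k) (a l))"
  let ?Q = "\<Sum>k\<in>K. \<Sum>l\<in>K. (\<integral>w. \<xi> k w * \<xi> l w \<partial>M) * ?ov k l"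
  have [measurable]: "\<xi> k \<in> borel_measurable M" "B (b k) \<in> borel_measurable M" "B (a k) \<in> borel_measurable M"
    if "k \<in> K" for k
    using el[OF that] by (auto intro!: elementary_measurable incr_measurable) (auto simp: elementary_def)
  have Sm: "S \<in> borel_measurable M" unfolding S_def by measurable
  have vm: "v \<in> borel_measurable (M \<Otimes>\<^sub>M lborel)" unfolding v_def by measurable
  have S2: "(norm (S w))\<^sup>2 = (\<Sum>k\<in>K. \<Sum>l\<in>K. (\<xi> k w * (B (b k) w - B (a k) w)) * (\<xi> l w * (B (b l) w - B (a l) w)))" for w
    by (simp add: S_def power2_eq_square sum_product)
  have S: "has_bochner_integral M (\<lambda>w. (norm (S w))\<^sup>2) ?Q"
    unfolding S2 by (intro has_bochner_integral_sum elementary_prod el)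
  have v2: "(norm (v z))\<^sup>2 = (\<Sum>k\<in>K. \<Sum>l\<in>K. (\<xi> k (fst z) * \<xi> l (fst z)) * indicator {max (a k) (a l)<..min (b k) (b l)} (snd z))" for z
    unfolding v_def by (simp add: power2_eq_square sum_product) (auto intro!: sum.cong simp: indicator_def)
  have ov: "measure lborel {max (a k) (a l)<..min (b k) (b l)} = ?ov k l" for k l
    by (cases "max (a k) (a l) \<le> min (b k) (b l)") auto
  have "has_bochner_integral (M \<Otimes>\<^sub>M lborel) (\<lambda>z. (\<xi> k (fst z) * \<xi> l (fst z)) * indicator {max (a k) (a l)<..min (b k) (b l)} (snd z))
      ((\<integral>w. \<xi> k w * \<xi> l w \<partial>M) * ?ov k l)" if "k \<in> K" "l \<in> K" for k l
  proof -
    note i = elementary_integrable_prod[OF el[OF that(1)] el[OF that(2)]]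
    have j: "integrable lborel (indicator {max (a k) (a l)<..min (b k) (b l)} :: real \<Rightarrow> real)"
      by (rule integrable_real_indicator[OF _ emeasure_bounded_finite])
         (auto intro: bounded_subset[OF bounded_closed_interval[of "max (a k) (a l)" "min (b k) (b l)"]])
    have int: "integrable (M \<Otimes>\<^sub>M lborel) (\<lambda>z. (\<xi> k (fst z) * \<xi> l (fst z)) * indicator {max (a k) (a l)<..min (b k) (b l)} (snd z) :: real)"
    proof (rule P.Fubini_integrable)
      show "(\<lambda>z. (\<xi> k (fst z) * \<xi> l (fst z)) * indicator {max (a k) (a l)<..min (b k) (b l)} (snd z) :: real) \<in> borel_measurable (M \<Otimes>\<^sub>M lborel)"
        using that by measurable
      show "integrable M (\<lambda>x. LINT y|lborel. norm ((\<xi> k (fst (x,y)) * \<xi> l (fst (x,y))) * indicator {max (a k) (a l)<..min (b k) (b l)} (snd (x,y)) :: real))"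
        using integrable_abs[OF i] by (simp add: abs_mult ov)
      show "AE x in M. integrable lborel (\<lambda>y. (\<xi> k (fst (x,y)) * \<xi> l (fst (x,y))) * indicator {max (a k) (a l)<..min (b k) (b l)} (snd (x,y)) :: real)"
        using j by simp
    qed
    then show ?thesis
      unfolding has_bochner_integral_iff
      by (simp add: P.integral_fst'[OF int, symmetric] ov)
  qed
  then have v: "has_bochner_integral (M \<Otimes>\<^sub>M lborel) (\<lambda>z. (norm (v z))\<^sup>2) ?Q"
    unfolding v2 by (intro has_bochner_integral_sum)
  from S Sm show "sq_integrable M S" by (auto simp: sq_integrable_def has_bochner_integral_iff)
  from v vm show "sq_integrable (M \<Otimes>\<^sub>M lborel) v" by (auto simp: sq_integrable_def has_bochner_integral_iff)
  from S v show "l2norm M S = l2norm (M \<Otimes>\<^sub>M lborel) v"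
    by (simp add: l2norm_def has_bochner_integral_iff)
qed

lemma elementary_orthogonal:
  assumes el: "elementary a b \<xi>" and s: "s \<le> a"
    and Z: "Z \<in> borel_measurable (F s)" "sq_integrable M Z"
  shows "(\<integral>w. Z w * (\<xi> w * (B b w - B a w)) \<partial>M) = 0"
proof -
  from el obtain C where a: "0 \<le> a" "a \<le> b" and \<xi>m: "\<xi> \<in> borel_measurable (F a)"
    and C: "\<And>w. w \<in> space M \<Longrightarrow> \<bar>\<xi> w\<bar> \<le> C" by (auto simp: elementary_def)
  have "integrable M (\<lambda>w. \<xi> w * Z w)"
    by (rule integrable_bounded_mult[OF sq_integrable_imp_integrable[OF Z(2)] F_measurable[OF \<xi>m] C])
  then have "has_bochner_integral M (\<lambda>w. (\<xi> w * Z w) * (B b w - B a w)) 0"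
    using a \<xi>m F_measurable_mono[OF s Z(1)] by (intro incr1) auto
  then show ?thesis by (simp add: has_bochner_integral_iff ac_simps)
qed

lemma simple_process_times:
  assumes "simple_process M F T n \<tau> \<xi>"
  shows "k \<le> n \<Longrightarrow> 0 \<le> \<tau> k" "k \<le> n \<Longrightarrow> \<tau> k \<le> T" "k < n \<Longrightarrow> \<tau> k \<le> \<tau> (Suc k)"
proof -
  from assms have z: "\<tau> 0 = 0" "\<tau> n = T" and st: "\<And>k. k < n \<Longrightarrow> \<tau> k \<le> \<tau> (Suc k)"
    by (auto simp: simple_process_def)
  show "k < n \<Longrightarrow> \<tau> k \<le> \<tau> (Suc k)" by (rule st)
  have mono: "\<tau> i \<le> \<tau> j" if "i \<le> j" "j \<le> n" for i j
    using that
  proof (induction rule: dec_induct)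
    case (step m)
    then have "\<tau> i \<le> \<tau> m" "\<tau> m \<le> \<tau> (Suc m)" using st[of m] by auto
    then show ?case by linarith
  qed simp
  show "k \<le> n \<Longrightarrow> 0 \<le> \<tau> k" using mono[of 0 k] z by simp
  show "k \<le> n \<Longrightarrow> \<tau> k \<le> T" using mono[of k n] z by simp
qed

lemma simple_process_elementary:
  assumes s: "simple_process M F T n \<tau> \<xi>" and k: "k < n"
  shows "elementary (\<tau> k) (\<tau> (Suc k)) (\<xi> k)"
  using simple_process_times[OF s, of k] s k by (auto simp: elementary_def simple_process_def)

lemma elementary_minus: "elementary a b \<xi> \<Longrightarrow> elementary a b (\<lambda>w. - \<xi> w)"
  by (auto simp: elementary_def)

section \<open>From elementary integrals to Ito integrals\<close>

abbreviation P where "P \<equiv> M \<Otimes>\<^sub>M (lborel :: real measure)"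

lemma simple_integral_isometry:
  assumes s: "simple_process M F T n \<tau> \<xi>"
  shows "sq_integrable M (simple_integral B n \<tau> \<xi>)"
    and "sq_integrable P (\<lambda>z. simple_value n \<tau> \<xi> (snd z) (fst z))"
  using elementary_isometry(1,2)[of "{..<n}" \<tau> "\<lambda>k. \<tau> (Suc k)" \<xi>] simple_process_elementary[OF s]
  by (auto simp: simple_integral_def[abs_def] simple_value_def[abs_def])

text \<open>Recasts the defining limits as convergence of \<open>l2norm\<close> on \<open>P\<close>
  and on \<open>M\<close>, where the triangle and Cauchy-Schwarz inequalities are available.\<close>

lemma ito_integral_approx:
  assumes J: "ito_integral M F B H T J"
    and H: "sq_integrable P (\<lambda>z. indicator {0..T} (snd z) * H (snd z) (fst z))"
  obtains n \<tau> \<xi> where "\<And>m. simple_process M F T (n m) (\<tau> m) (\<xi> m)" "sq_integrable M J"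
    "(\<lambda>m. l2norm P (\<lambda>z. indicator {0..T} (snd z) * H (snd z) (fst z) - simple_value (n m) (\<tau> m) (\<xi> m) (snd z) (fst z))) \<longlonglongrightarrow> 0"
    "(\<lambda>m. l2norm M (\<lambda>w. J w - simple_integral B (n m) (\<tau> m) (\<xi> m) w)) \<longlonglongrightarrow> 0"
proof -
  from J obtain n \<tau> \<xi> where Jm: "J \<in> borel_measurable M"
    and s: "\<And>m. simple_process M F T (n m) (\<tau> m) (\<xi> m)"
    and 1: "(\<lambda>m. \<integral>\<^sup>+w. (\<integral>\<^sup>+s\<in>{0..T}. ennreal ((H s w - simple_value (n m) (\<tau> m) (\<xi> m) s w)\<^sup>2) \<partial>lborel) \<partial>M) \<longlonglongrightarrow> 0"
    and 2: "(\<lambda>m. \<integral>\<^sup>+w. ennreal ((J w - simple_integral B (n m) (\<tau> m) (\<xi> m) w)\<^sup>2) \<partial>M) \<longlonglongrightarrow> 0"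
    unfolding ito_integral_def by blast
  let ?S = "\<lambda>m. simple_integral B (n m) (\<tau> m) (\<xi> m)"
  let ?D = "\<lambda>m z. indicator {0..T} (snd z) * H (snd z) (fst z) - simple_value (n m) (\<tau> m) (\<xi> m) (snd z) (fst z)"
  have D: "sq_integrable P (?D m)" for m
    by (intro sq_integrable_diff H simple_integral_isometry[OF s])
  have "(\<integral>\<^sup>+w. (\<integral>\<^sup>+s\<in>{0..T}. ennreal ((H s w - simple_value (n m) (\<tau> m) (\<xi> m) s w)\<^sup>2) \<partial>lborel) \<partial>M)
      = ennreal ((l2norm P (?D m))\<^sup>2)" for m
  proof -
    \<comment> \<open>Simple processes vanish outside \<open>{0..T}\<close>, so cutting off
      \<open>H\<close> alone accounts for the restriction of the time integral.\<close>
    have "simple_value (n m) (\<tau> m) (\<xi> m) r w = 0" if r: "r \<notin> {0..T}" for r w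
      unfolding simple_value_def
    proof (intro sum.neutral ballI)
      fix k assume k: "k \<in> {..<n m}"
      then have "0 \<le> \<tau> m k" "\<tau> m (Suc k) \<le> T" using simple_process_times[OF s[of m]] by auto
      with r show "\<xi> m k w * indicator {\<tau> m k<..\<tau> m (Suc k)} r = 0"
        by (auto simp: indicator_def)
    qed
    then have "ennreal ((H r w - simple_value (n m) (\<tau> m) (\<xi> m) r w)\<^sup>2) * indicator {0..T} r = ennreal ((?D m (w, r))\<^sup>2)" for r w
      by (cases "r \<in> {0..T}") auto
    then have "(\<integral>\<^sup>+w. (\<integral>\<^sup>+s\<in>{0..T}. ennreal ((H s w - simple_value (n m) (\<tau> m) (\<xi> m) s w)\<^sup>2) \<partial>lborel) \<partial>M)
       = (\<integral>\<^sup>+w. \<integral>\<^sup>+r. ennreal ((?D m (w, r))\<^sup>2) \<partial>lborel \<partial>M)" by simp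
    also have "\<dots> = (\<integral>\<^sup>+z. ennreal ((?D m z)\<^sup>2) \<partial>P)"
      using measurable_compose[OF sq_integrable_measurable[OF D[of m]], of "\<lambda>x. ennreal (x\<^sup>2)" borel]
      by (intro lborel.nn_integral_fst) simp
    also have "\<dots> = ennreal ((l2norm P (?D m))\<^sup>2)"
      by (rule nn_integral_sq_eq_l2norm[OF D])
    finally show ?thesis .
  qed
  with 1 have a: "(\<lambda>m. l2norm P (?D m)) \<longlonglongrightarrow> 0"
    by (intro tendsto_ennreal_sq_zero) simp
  have "\<forall>\<^sub>F m in sequentially. (\<integral>\<^sup>+w. ennreal ((J w - ?S m w)\<^sup>2) \<partial>M) < \<infinity>"
    using order_tendstoD(2)[OF 2, of \<infinity>] by simp
  \<comment> \<open>Convergence to 0 in the extended reals makes at least one distance finite;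
    \<open>J\<close> is then a sum of two square-integrable functions.\<close>
  then obtain m where "(\<integral>\<^sup>+w. ennreal ((J w - ?S m w)\<^sup>2) \<partial>M) < \<infinity>"
    by (auto simp: eventually_sequentially)
  then have "sq_integrable M (\<lambda>w. J w - ?S m w)"
    using Jm sq_integrable_measurable[OF simple_integral_isometry(1)[OF s[of m]]]
    by (intro sq_integrable_if_nn_integral) auto
  from sq_integrable_add[OF this simple_integral_isometry(1)[OF s[of m]]]
  have J2: "sq_integrable M J" by simp
  have "(\<integral>\<^sup>+w. ennreal ((J w - ?S m w)\<^sup>2) \<partial>M) = ennreal ((l2norm M (\<lambda>w. J w - ?S m w))\<^sup>2)" for m
    by (intro nn_integral_sq_eq_l2norm sq_integrable_diff J2 simple_integral_isometry[OF s])
  with 2 have "(\<lambda>m. l2norm M (\<lambda>w. J w - ?S m w)) \<longlonglongrightarrow> 0"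
    by (intro tendsto_ennreal_sq_zero) simp
  with s J2 a show ?thesis by (rule that)
qed

text \<open>An increment \<open>J(t) - J(s)\<close> of the Ito integral is approximated by elementary integrals \<open>R\<close> over
  \<open>(s,t]\<close>, although \<open>J(s)\<close> and \<open>J(t)\<close> come with unrelated approximating sequences: on \<open>[0,s]\<close> both
  sequences converge to \<open>H\<close>, so by the isometry the discrepancy of their integrals vanishes.\<close>

lemma ito_increment_approx:
  assumes st: "0 \<le> s" "s \<le> t"
    and J: "ito_integral M F B H t J" and I: "ito_integral M F B H s I"
    and H: "sq_integrable P (\<lambda>z. indicator {0..t} (snd z) * H (snd z) (fst z))"
  obtains R e where "sq_integrable M (\<lambda>w. J w - I w)" "\<And>m. sq_integrable M (R m)"
    "(\<lambda>m. l2norm M (\<lambda>w. J w - I w - R m w)) \<longlonglongrightarrow> 0" "e \<longlonglongrightarrow> 0"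
    "\<And>m. l2norm M (R m) \<le> l2norm P (\<lambda>z. indicator {s..t} (snd z) * H (snd z) (fst z)) + e m"
    "\<And>m Z. Z \<in> borel_measurable (F s) \<Longrightarrow> sq_integrable M Z \<Longrightarrow> (\<integral>w. Z w * R m w \<partial>M) = 0"
proof -
  have restr: "sq_integrable P (\<lambda>z. indicator A (snd z) * f z)"
     "l2norm P (\<lambda>z. indicator A (snd z) * f z) \<le> l2norm P f"
    if f: "sq_integrable P f" and A: "A \<in> sets borel" for A and f :: "'w \<times> real \<Rightarrow> real"
  proof -
    have m: "(\<lambda>z. indicator A (snd z) * f z) \<in> borel_measurable P"
      using sq_integrable_measurable[OF f] A by measurable
    show "sq_integrable P (\<lambda>z. indicator A (snd z) * f z)"
      by (rule sq_integrable_bound[OF f m, of 1]) (auto simp: indicator_def)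
    show "l2norm P (\<lambda>z. indicator A (snd z) * f z) \<le> l2norm P f"
      by (rule l2norm_mono[OF f m]) (auto simp: indicator_def)
  qed
  let ?H = "\<lambda>a b z. indicator {a..b} (snd z) * H (snd z) (fst z)"
  have "sq_integrable P (\<lambda>z. indicator {0..s} (snd z) * ?H 0 t z)" by (rule restr(1)[OF H]) simp
  moreover have "(\<lambda>z. indicator {0..s} (snd z) * ?H 0 t z) = ?H 0 s"
    using st by (auto simp: indicator_def fun_eq_iff)
  ultimately have Hs: "sq_integrable P (?H 0 s)" by simp
  obtain n \<tau> \<xi> where \<xi>: "\<And>m. simple_process M F t (n m) (\<tau> m) (\<xi> m)" and J2: "sq_integrable M J"
    and \<xi>H: "(\<lambda>m. l2norm P (\<lambda>z. ?H 0 t z - simple_value (n m) (\<tau> m) (\<xi> m) (snd z) (fst z))) \<longlonglongrightarrow> 0"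
    and \<xi>J: "(\<lambda>m. l2norm M (\<lambda>w. J w - simple_integral B (n m) (\<tau> m) (\<xi> m) w)) \<longlonglongrightarrow> 0"
    by (rule ito_integral_approx[OF J H]) (rule that)
  obtain n' \<tau>' \<eta> where \<eta>: "\<And>m. simple_process M F s (n' m) (\<tau>' m) (\<eta> m)" and I2: "sq_integrable M I"
    and \<eta>H: "(\<lambda>m. l2norm P (\<lambda>z. ?H 0 s z - simple_value (n' m) (\<tau>' m) (\<eta> m) (snd z) (fst z))) \<longlonglongrightarrow> 0"
    and \<eta>I: "(\<lambda>m. l2norm M (\<lambda>w. I w - simple_integral B (n' m) (\<tau>' m) (\<eta> m) w)) \<longlonglongrightarrow> 0"
    by (rule ito_integral_approx[OF I Hs]) (rule that)
  let ?v = "\<lambda>m z. simple_value (n m) (\<tau> m) (\<xi> m) (snd z) (fst z)"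
  let ?w = "\<lambda>m z. simple_value (n' m) (\<tau>' m) (\<eta> m) (snd z) (fst z)"
  let ?S = "\<lambda>m. simple_integral B (n m) (\<tau> m) (\<xi> m)"
  let ?S' = "\<lambda>m. simple_integral B (n' m) (\<tau>' m) (\<eta> m)"
  have v: "sq_integrable P (?v m)" for m by (rule simple_integral_isometry(2)[OF \<xi>])
  have w: "sq_integrable P (?w m)" for m by (rule simple_integral_isometry(2)[OF \<eta>])
  \<comment> \<open>Clipping both grid times from below or from above by \<open>s\<close> splits
    each summand into its parts after and before \<open>s\<close>.\<close>
  let ?r = "\<lambda>m k w. \<xi> m k w * (B (max (\<tau> m (Suc k)) s) w - B (max (\<tau> m k) s) w)"
  let ?q = "\<lambda>m k w. \<xi> m k w * (B (min (\<tau> m (Suc k)) s) w - B (min (\<tau> m k) s) w)"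
  define e where "e m = l2norm P (\<lambda>z. ?H 0 t z - ?v m z)" for m
  define R where "R m w = (\<Sum>k<n m. ?r m k w)" for m w
  \<comment> \<open>Only summands starting by time \<open>s\<close> are kept: otherwise the clipped
    interval starts at \<open>s\<close>, where the coefficient need not be known yet. The increments
    dropped this way are zero.\<close>
  define K where "K m = {k. k < n m \<and> \<tau> m k \<le> s}" for m
  define A where "A m w = (\<Sum>k\<in>K m. ?q m k w)" for m w
  have elR: "elementary (max (\<tau> m k) s) (max (\<tau> m (Suc k)) s) (\<xi> m k)" if "k < n m" for m k
    using simple_process_elementary[OF \<xi> that] st
    by (auto simp: elementary_def intro: F_measurable_mono[of "\<tau> m k"])
  have elA: "elementary (min (\<tau> m k) s) (min (\<tau> m (Suc k)) s) (\<xi> m k)" if "k \<in> K m" for m k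
    using simple_process_elementary[OF \<xi>, of k m] that st
    by (auto simp: elementary_def K_def min_absorb1)
  have SAR: "?S m w = A m w + R m w" for m w
  proof -
    have "A m w = (\<Sum>k<n m. ?q m k w)"
      unfolding A_def
    proof (rule sum.mono_neutral_left)
      show "\<forall>k\<in>{..<n m} - K m. ?q m k w = 0"
      proof
        fix k assume k: "k \<in> {..<n m} - K m"
        then have "s < \<tau> m k" "\<tau> m k \<le> \<tau> m (Suc k)"
          using simple_process_times(3)[OF \<xi>, of k m] by (auto simp: K_def)
        then show "?q m k w = 0"
          by (simp add: min_absorb2)
      qed
    qed (auto simp: K_def)
    moreover have "B (min x s) w + B (max x s) w = B x w + B s w" for x
      by (cases "x \<le> s") (auto simp: min_def max_def)
    then have "B (\<tau> m (Suc k)) w - B (\<tau> m k) w =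
        (B (min (\<tau> m (Suc k)) s) w - B (min (\<tau> m k) s) w) + (B (max (\<tau> m (Suc k)) s) w - B (max (\<tau> m k) s) w)" for k
      by (smt (verit))
    ultimately show ?thesis
      by (simp add: simple_integral_def R_def sum.distrib[symmetric] distrib_left[symmetric])
  qed
  have R2: "sq_integrable M (R m)" for m
    unfolding R_def by (rule elementary_isometry(1)) (use elR in auto)
  have lR: "l2norm M (R m) \<le> l2norm P (?H s t) + e m" for m
  proof -
    let ?u = "\<lambda>z. \<Sum>k<n m. \<xi> m k (fst z) * indicator {max (\<tau> m k) s<..max (\<tau> m (Suc k)) s} (snd z)"
    have "l2norm M (R m) = l2norm P ?u"
      unfolding R_def by (rule elementary_isometry(3)) (use elR in auto)
    also have "?u = (\<lambda>z. indicator {s<..t} (snd z) * ?v m z)"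
    proof
      fix z :: "'w \<times> real"
      have "indicator {max (\<tau> m k) s<..max (\<tau> m (Suc k)) s} (snd z) = (indicator {s<..t} (snd z) * indicator {\<tau> m k<..\<tau> m (Suc k)} (snd z) :: real)"
        if "k < n m" for k
        using simple_process_times(2)[OF \<xi>, of "Suc k" m] that by (auto simp: indicator_def)
      then show "?u z = indicator {s<..t} (snd z) * ?v m z"
        unfolding simple_value_def sum_distrib_left by (intro sum.cong refl) simp
    qed
    also have "(\<lambda>z. indicator {s<..t} (snd z) * ?v m z) =
       (\<lambda>z. indicator {s<..t} (snd z) * ?H 0 t z - indicator {s<..t} (snd z) * (?H 0 t z - ?v m z))"
      by (simp add: algebra_simps)
    also have "l2norm P \<dots> \<le> l2norm P (\<lambda>z. indicator {s<..t} (snd z) * ?H 0 t z) + l2norm P (\<lambda>z. indicator {s<..t} (snd z) * (?H 0 t z - ?v m z))"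
      by (intro l2norm_triangle_diff restr(1) sq_integrable_diff H v) auto
    also have "l2norm P (\<lambda>z. indicator {s<..t} (snd z) * (?H 0 t z - ?v m z)) \<le> e m"
      unfolding e_def by (intro restr(2) sq_integrable_diff H v) auto
    also have "l2norm P (\<lambda>z. indicator {s<..t} (snd z) * ?H 0 t z) \<le> l2norm P (?H s t)"
    proof (rule l2norm_mono)
      have "?H s t = (\<lambda>z. indicator {s..t} (snd z) * ?H 0 t z)"
        using st by (auto simp: indicator_def fun_eq_iff)
      then show "sq_integrable P (?H s t)" using restr(1)[OF H, of "{s..t}"] by simp
      show "(\<lambda>z. indicator {s<..t} (snd z) * ?H 0 t z) \<in> borel_measurable P"
        by (intro sq_integrable_measurable restr(1)[OF H]) simp
    qed (use st in \<open>auto simp: indicator_def\<close>)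
    finally show ?thesis by simp
  qed
  have orth: "(\<integral>w. Z w * R m w \<partial>M) = 0" if Z: "Z \<in> borel_measurable (F s)" "sq_integrable M Z" for Z m
  proof -
    have i: "integrable M (\<lambda>w. Z w * (?r m k w))" if "k < n m" for k
      using elementary_isometry(1)[of "{k}" "\<lambda>k. max (\<tau> m k) s" "\<lambda>k. max (\<tau> m (Suc k)) s" "\<xi> m"] elR[OF that]
      by (intro integrable_mult_sq Z) simp
    have "(\<integral>w. Z w * R m w \<partial>M) = (\<Sum>k<n m. \<integral>w. Z w * (?r m k w) \<partial>M)"
      unfolding R_def sum_distrib_left by (rule Bochner_Integration.integral_sum) (use i in auto)
    also have "\<dots> = 0"
      by (intro sum.neutral ballI elementary_orthogonal[OF elR _ Z]) auto
    finally show ?thesis .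
  qed
  define U where "U m w = A m w - ?S' m w" for m w
  have U: "sq_integrable M (U m) \<and> l2norm M (U m) \<le> l2norm P (\<lambda>z. ?H 0 s z - ?w m z) + e m" for m
  proof -
    \<comment> \<open>The clipped integral and the one approximating \<open>I\<close> form a single
      elementary family, indexed by a disjoint sum with the second coefficients negated; the
      isometry then applies to their difference.\<close>
    let ?K = "K m <+> {..<n' m}"
    let ?a = "case_sum (\<lambda>k. min (\<tau> m k) s) (\<tau>' m)"
    let ?b = "case_sum (\<lambda>k. min (\<tau> m (Suc k)) s) (\<lambda>k. \<tau>' m (Suc k))"
    let ?x = "case_sum (\<xi> m) (\<lambda>k w. - \<eta> m k w)"
    have fin: "finite (K m)" by (simp add: K_def)
    have el: "elementary (?a k) (?b k) (?x k)" if "k \<in> ?K" for k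
      using that elA elementary_minus[OF simple_process_elementary[OF \<eta>]] by auto
    note iso = elementary_isometry[of ?K ?a ?b ?x, OF finite_Plus[OF fin finite_lessThan] el]
    have "(\<lambda>w. \<Sum>k\<in>?K. ?x k w * (B (?b k) w - B (?a k) w)) = U m"
      using fin by (simp add: sum.Plus U_def A_def simple_integral_def fun_eq_iff sum_negf)
    moreover have "(\<lambda>z. \<Sum>k\<in>?K. ?x k (fst z) * indicator {?a k<..?b k} (snd z)) =
        (\<lambda>z. indicator {0..s} (snd z) * ?v m z - ?w m z)"
    proof
      fix z :: "'w \<times> real"
      have "(\<Sum>k\<in>K m. \<xi> m k (fst z) * indicator {min (\<tau> m k) s<..min (\<tau> m (Suc k)) s} (snd z)) =
        (\<Sum>k<n m. \<xi> m k (fst z) * (indicator {0..s} (snd z) * indicator {\<tau> m k<..\<tau> m (Suc k)} (snd z)))"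
      proof (rule sum.mono_neutral_cong_left)
        show "\<forall>k\<in>{..<n m} - K m. \<xi> m k (fst z) * (indicator {0..s} (snd z) * indicator {\<tau> m k<..\<tau> m (Suc k)} (snd z)) = 0"
          by (auto simp: K_def indicator_def)
        fix k assume "k \<in> K m"
        then have "\<tau> m k \<le> s" "0 \<le> \<tau> m k" using simple_process_times(1)[OF \<xi>, of k m] by (auto simp: K_def)
        then show "\<xi> m k (fst z) * indicator {min (\<tau> m k) s<..min (\<tau> m (Suc k)) s} (snd z) =
           \<xi> m k (fst z) * (indicator {0..s} (snd z) * indicator {\<tau> m k<..\<tau> m (Suc k)} (snd z))"
          by (auto simp: indicator_def)
      qed (auto simp: K_def)
      then show "(\<Sum>k\<in>?K. ?x k (fst z) * indicator {?a k<..?b k} (snd z)) = indicator {0..s} (snd z) * ?v m z - ?w m z"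
        by (simp only: sum.Plus[OF fin finite_lessThan] comp_def sum.case simple_value_def sum_distrib_left
            mult_minus_left sum_negf add_uminus_conv_diff mult.left_commute)
    qed
    ultimately have 1: "sq_integrable M (U m)" "l2norm M (U m) = l2norm P (\<lambda>z. indicator {0..s} (snd z) * ?v m z - ?w m z)"
      using iso(1,3) by simp_all
    note 1(2)
    also have "(\<lambda>z. indicator {0..s} (snd z) * ?v m z - ?w m z) =
       (\<lambda>z. (?H 0 s z - ?w m z) - indicator {0..s} (snd z) * (?H 0 t z - ?v m z))"
      using st by (auto simp: indicator_def fun_eq_iff)
    also have "l2norm P \<dots> \<le> l2norm P (\<lambda>z. ?H 0 s z - ?w m z) + l2norm P (\<lambda>z. indicator {0..s} (snd z) * (?H 0 t z - ?v m z))"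
      by (intro l2norm_triangle_diff restr(1) sq_integrable_diff H Hs v w) auto
    also have "l2norm P (\<lambda>z. indicator {0..s} (snd z) * (?H 0 t z - ?v m z)) \<le> e m"
      unfolding e_def by (intro restr(2) sq_integrable_diff H v) auto
    finally show ?thesis using 1(1) by simp
  qed
  have e0: "e \<longlonglongrightarrow> 0" using \<xi>H by (simp add: e_def[abs_def])
  have "(\<lambda>m. l2norm M (\<lambda>w. J w - I w - R m w)) \<longlonglongrightarrow> 0"
  proof (rule tendsto_sandwich[OF _ _ tendsto_const])
    show "\<forall>\<^sub>F m in sequentially. 0 \<le> l2norm M (\<lambda>w. J w - I w - R m w)" by simp
    have "l2norm M (\<lambda>w. J w - I w - R m w) \<le> l2norm M (\<lambda>w. J w - ?S m w) +
        l2norm M (\<lambda>w. I w - ?S' m w) + (l2norm P (\<lambda>z. ?H 0 s z - ?w m z) + e m)" for m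
    proof -
      have a: "sq_integrable M (\<lambda>w. J w - ?S m w)"
        by (intro sq_integrable_diff J2 simple_integral_isometry(1)[OF \<xi>])
      have b: "sq_integrable M (\<lambda>w. I w - ?S' m w)"
        by (intro sq_integrable_diff I2 simple_integral_isometry(1)[OF \<eta>])
      \<comment> \<open>Three errors remain: those of the two approximations and the discrepancy
        \<open>U m\<close> on \<open>[0,s]\<close>.\<close>
      have "(\<lambda>w. J w - I w - R m w) = (\<lambda>w. ((J w - ?S m w) - (I w - ?S' m w)) + U m w)"
        by (simp add: U_def SAR fun_eq_iff)
      then have "l2norm M (\<lambda>w. J w - I w - R m w) \<le> l2norm M (\<lambda>w. (J w - ?S m w) - (I w - ?S' m w)) + l2norm M (U m)"
        using l2norm_triangle[OF sq_integrable_diff[OF a b]] U[of m] by simp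
      then show ?thesis using l2norm_triangle_diff[OF a b] U[of m] by linarith
    qed
    then show "\<forall>\<^sub>F m in sequentially. l2norm M (\<lambda>w. J w - I w - R m w) \<le> l2norm M (\<lambda>w. J w - ?S m w) +
        l2norm M (\<lambda>w. I w - ?S' m w) + (l2norm P (\<lambda>z. ?H 0 s z - ?w m z) + e m)" by simp
    show "(\<lambda>m. l2norm M (\<lambda>w. J w - ?S m w) +
        l2norm M (\<lambda>w. I w - ?S' m w) + (l2norm P (\<lambda>z. ?H 0 s z - ?w m z) + e m)) \<longlonglongrightarrow> 0"
      using tendsto_add[OF tendsto_add[OF \<xi>J \<eta>I] tendsto_add[OF \<eta>H e0]] by simp
  qed
  from sq_integrable_diff[OF J2 I2] R2 this e0 lR orth show ?thesis by (rule that)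
qed

context
  fixes s t :: real and H :: "real \<Rightarrow> 'w \<Rightarrow> real" and J I :: "'w \<Rightarrow> real"
  assumes st: "0 \<le> s" "s \<le> t"
    and J: "ito_integral M F B H t J" and I: "ito_integral M F B H s I"
    and H: "sq_integrable P (\<lambda>z. indicator {0..t} (snd z) * H (snd z) (fst z))"
begin

lemma ito_increment_sq_integrable: "sq_integrable M (\<lambda>w. J w - I w)"
  by (rule ito_increment_approx[OF st J I H])

lemma ito_increment_l2norm:
  "l2norm M (\<lambda>w. J w - I w) \<le> l2norm P (\<lambda>z. indicator {s..t} (snd z) * H (snd z) (fst z))"
    (is "_ \<le> ?h")
proof -
  obtain R e where 1: "sq_integrable M (\<lambda>w. J w - I w)" "\<And>m. sq_integrable M (R m)"
    "(\<lambda>m. l2norm M (\<lambda>w. J w - I w - R m w)) \<longlonglongrightarrow> 0" "e \<longlonglongrightarrow> 0"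
    "\<And>m. l2norm M (R m) \<le> ?h + e m"
    by (rule ito_increment_approx[OF st J I H]) (rule that)
  have "l2norm M (\<lambda>w. J w - I w) \<le> l2norm M (\<lambda>w. J w - I w - R m w) + (?h + e m)" for m
    using l2norm_triangle[OF sq_integrable_diff[OF 1(1) 1(2)[of m]] 1(2)[of m]] 1(5)[of m] by simp
  moreover have "(\<lambda>m. l2norm M (\<lambda>w. J w - I w - R m w) + (?h + e m)) \<longlonglongrightarrow> 0 + (?h + 0)"
    by (intro tendsto_intros 1)
  ultimately show ?thesis using LIMSEQ_le_const by fastforce
qed

text \<open>Each elementary approximation \<open>R m\<close> is exactly orthogonal to the past; the
  Cauchy-Schwarz inequality carries this to the L2 limit.\<close>

lemma ito_increment_orthogonal:
  assumes Z: "Z \<in> borel_measurable (F s)" "sq_integrable M Z"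
  shows "(\<integral>w. Z w * (J w - I w) \<partial>M) = 0"
proof -
  obtain R e where 1: "sq_integrable M (\<lambda>w. J w - I w)" "\<And>m. sq_integrable M (R m)"
    "(\<lambda>m. l2norm M (\<lambda>w. J w - I w - R m w)) \<longlonglongrightarrow> 0" "e \<longlonglongrightarrow> 0"
    "\<And>m. l2norm M (R m) \<le> l2norm P (\<lambda>z. indicator {s..t} (snd z) * H (snd z) (fst z)) + e m"
    and 2: "\<And>m Z. Z \<in> borel_measurable (F s) \<Longrightarrow> sq_integrable M Z \<Longrightarrow> (\<integral>w. Z w * R m w \<partial>M) = 0"
    by (rule ito_increment_approx[OF st J I H]) (rule that)
  have "\<bar>\<integral>w. Z w * (J w - I w) \<partial>M\<bar> \<le> l2norm M Z * l2norm M (\<lambda>w. J w - I w - R m w)" for m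
  proof -
    note d = sq_integrable_diff[OF 1(1) 1(2)[of m]]
    have "(\<integral>w. Z w * (J w - I w) \<partial>M) = (\<integral>w. Z w * (J w - I w - R m w) + Z w * R m w \<partial>M)"
      by (simp add: algebra_simps)
    also have "\<dots> = (\<integral>w. Z w * (J w - I w - R m w) \<partial>M) + (\<integral>w. Z w * R m w \<partial>M)"
      by (intro Bochner_Integration.integral_add integrable_mult_sq Z d 1(2))
    finally show ?thesis using Cauchy_Schwarz_integral(2)[OF Z(2) d] 2[OF Z] by simp
  qed
  moreover have "(\<lambda>m. l2norm M Z * l2norm M (\<lambda>w. J w - I w - R m w)) \<longlonglongrightarrow> l2norm M Z * 0"
    by (intro tendsto_intros 1)
  ultimately have "\<bar>\<integral>w. Z w * (J w - I w) \<partial>M\<bar> \<le> l2norm M Z * 0"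
    by (intro LIMSEQ_le_const) auto
  then show ?thesis by simp
qed

end

end

section \<open>Processes with continuous paths\<close>

lemma continuous_on_half_line:
  fixes f :: "real \<Rightarrow> 'b::topological_space"
  assumes "\<And>T. T > 0 \<Longrightarrow> continuous_on {0..T} f"
  shows "continuous_on {0..} f"
  unfolding continuous_on_eq_continuous_within
proof
  fix x :: real assume x: "x \<in> {0..}"
  have "continuous (at x within {0..x + 1}) f"
    using assms[of "x + 1"] x by (simp add: continuous_on_eq_continuous_within)
  moreover have "at x within {0..x + 1} = at x within {0..}"
    by (rule at_within_nhd[of x "{..<x + 1}"]) auto
  ultimately show "continuous (at x within {0..}) f" by simp
qed

lemma tendsto_floor_grid: "(\<lambda>n. real_of_int \<lfloor>real (Suc n) * r\<rfloor> / real (Suc n)) \<longlonglongrightarrow> r"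
proof (rule tendsto_sandwich)
  have "real (Suc n) * r - 1 \<le> real_of_int \<lfloor>real (Suc n) * r\<rfloor>" for n by linarith
  then have "(real (Suc n) * r - 1) / real (Suc n) \<le> real_of_int \<lfloor>real (Suc n) * r\<rfloor> / real (Suc n)" for n
    by (intro divide_right_mono) auto
  then have "r - 1 / real (Suc n) \<le> real_of_int \<lfloor>real (Suc n) * r\<rfloor> / real (Suc n)" for n
    by (simp only: diff_divide_distrib) simp
  then show "\<forall>\<^sub>F n in sequentially. r - 1 / real (Suc n) \<le> real_of_int \<lfloor>real (Suc n) * r\<rfloor> / real (Suc n)"
    by (rule always_eventually[OF allI])
  have "real_of_int \<lfloor>real (Suc n) * r\<rfloor> / real (Suc n) \<le> real (Suc n) * r / real (Suc n)" for n
    by (intro divide_right_mono) auto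
  then show "\<forall>\<^sub>F n in sequentially. real_of_int \<lfloor>real (Suc n) * r\<rfloor> / real (Suc n) \<le> r"
    by simp
  have "(\<lambda>n. r - 1 / real (Suc n)) \<longlonglongrightarrow> r - 0"
    by (intro tendsto_intros LIMSEQ_Suc[OF lim_1_over_n])
  then show "(\<lambda>n. r - 1 / real (Suc n)) \<longlonglongrightarrow> r" by simp
qed simp

text \<open>Continuity as a map into L2. Continuous paths with locally bounded second moments give
  continuous expectations for functions of linear growth, but not for quadratic quantities such as
  the variance; these call for the stronger notion.\<close>

definition l2_continuous :: "'w measure \<Rightarrow> (real \<Rightarrow> 'w \<Rightarrow> 'b::euclidean_space) \<Rightarrow> bool" where
  "l2_continuous M f \<longleftrightarrow> (\<forall>t\<ge>0. sq_integrable M (f t)) \<and>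
     (\<forall>s\<ge>0. ((\<lambda>t. l2norm M (\<lambda>w. f t w - f s w)) \<longlongrightarrow> 0) (at s within {0..}))"

lemma l2_continuous_sq: "l2_continuous M f \<Longrightarrow> 0 \<le> t \<Longrightarrow> sq_integrable M (f t)"
  by (simp add: l2_continuous_def)

lemma l2_continuous_inner:
  assumes f: "l2_continuous M f" and g: "l2_continuous M g"
  shows "continuous_on {0..} (\<lambda>t. \<integral>w. f t w \<bullet> g t w \<partial>M)"
  unfolding continuous_on_def
proof
  fix s :: real assume "s \<in> {0..}"
  then have s: "s \<ge> 0" by simp
  let ?a = "\<lambda>t. l2norm M (\<lambda>w. f t w - f s w)" and ?b = "\<lambda>t. l2norm M (\<lambda>w. g t w - g s w)"
  let ?c = "\<lambda>t. \<integral>w. f t w \<bullet> g t w \<partial>M"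
  note fs = l2_continuous_sq[OF f] and gs = l2_continuous_sq[OF g]
  have le: "\<bar>?c t - ?c s\<bar> \<le> ?a t * ?b t + l2norm M (f s) * ?b t + ?a t * l2norm M (g s)" if t: "t \<ge> 0" for t
  proof -
    note F = sq_integrable_diff[OF fs[OF t] fs[OF s]] and G = sq_integrable_diff[OF gs[OF t] gs[OF s]]
    have "?c t = (\<integral>w. (f t w - f s w) \<bullet> (g t w - g s w) + f s w \<bullet> (g t w - g s w) + (f t w - f s w) \<bullet> g s w + f s w \<bullet> g s w \<partial>M)"
      by (simp add: inner_diff_left inner_diff_right)
    also have "\<dots> = (\<integral>w. (f t w - f s w) \<bullet> (g t w - g s w) \<partial>M) + (\<integral>w. f s w \<bullet> (g t w - g s w) \<partial>M)
        + (\<integral>w. (f t w - f s w) \<bullet> g s w \<partial>M) + ?c s"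
      using integrable_inner_sq(1)[OF F G] integrable_inner_sq(1)[OF fs[OF s] G]
        integrable_inner_sq(1)[OF F gs[OF s]] integrable_inner_sq(1)[OF fs[OF s] gs[OF s]] by simp
    finally show ?thesis
      using Cauchy_Schwarz_integral(2)[OF F G] Cauchy_Schwarz_integral(2)[OF fs[OF s] G]
        Cauchy_Schwarz_integral(2)[OF F gs[OF s]] by linarith
  qed
  have "(?a \<longlongrightarrow> 0) (at s within {0..})" "(?b \<longlongrightarrow> 0) (at s within {0..})"
    using f g s by (auto simp: l2_continuous_def)
  then have "((\<lambda>t. ?a t * ?b t + l2norm M (f s) * ?b t + ?a t * l2norm M (g s)) \<longlongrightarrow>
      0 * 0 + l2norm M (f s) * 0 + 0 * l2norm M (g s)) (at s within {0..})"
    by (intro tendsto_intros)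
  then have "((\<lambda>t. ?a t * ?b t + l2norm M (f s) * ?b t + ?a t * l2norm M (g s)) \<longlongrightarrow> 0) (at s within {0..})"
    by simp
  moreover have "\<forall>\<^sub>F t in at s within {0..}. norm (?c t - ?c s) \<le> ?a t * ?b t + l2norm M (f s) * ?b t + ?a t * l2norm M (g s)"
    unfolding eventually_at using le by (intro exI[of _ 1]) auto
  ultimately have "((\<lambda>t. ?c t - ?c s) \<longlongrightarrow> 0) (at s within {0..})"
    by (rule Lim_null_comparison[rotated])
  then show "(?c \<longlongrightarrow> ?c s) (at s within {0..})" by (rule LIM_zero_cancel)
qed

lemma l2_continuous_diff:
  assumes f: "l2_continuous M f" and g: "l2_continuous M g"
  shows "l2_continuous M (\<lambda>t w. f t w - g t w)"
  unfolding l2_continuous_def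
proof (intro conjI allI impI)
  note fs = l2_continuous_sq[OF f] and gs = l2_continuous_sq[OF g]
  show "sq_integrable M (\<lambda>w. f t w - g t w)" if "t \<ge> 0" for t
    by (intro sq_integrable_diff fs gs that)
  fix s :: real assume s: "s \<ge> 0"
  let ?a = "\<lambda>t. l2norm M (\<lambda>w. f t w - f s w)" and ?b = "\<lambda>t. l2norm M (\<lambda>w. g t w - g s w)"
  have "(?a \<longlongrightarrow> 0) (at s within {0..})" "(?b \<longlongrightarrow> 0) (at s within {0..})"
    using f g s by (auto simp: l2_continuous_def)
  then have "((\<lambda>t. ?a t + ?b t) \<longlongrightarrow> 0) (at s within {0..})"
    using tendsto_add by fastforce
  moreover have le: "l2norm M (\<lambda>w. (f t w - g t w) - (f s w - g s w)) \<le> ?a t + ?b t" if t: "t \<ge> 0" for t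
    using l2norm_triangle_diff[OF sq_integrable_diff[OF fs[OF t] fs[OF s]] sq_integrable_diff[OF gs[OF t] gs[OF s]]]
    by (simp add: algebra_simps)
  have "\<forall>\<^sub>F t in at s within {0..}. norm (l2norm M (\<lambda>w. (f t w - g t w) - (f s w - g s w))) \<le> ?a t + ?b t"
    unfolding eventually_at using le by (intro exI[of _ 1]) auto
  ultimately show "((\<lambda>t. l2norm M (\<lambda>w. (f t w - g t w) - (f s w - g s w))) \<longlongrightarrow> 0) (at s within {0..})"
    by (rule Lim_null_comparison[rotated])
qed

lemma (in prob_space) l2_continuous_deterministic:
  fixes f :: "real \<Rightarrow> 'b::euclidean_space"
  assumes "continuous_on {0..} f"
  shows "l2_continuous M (\<lambda>t w. f t)"
  unfolding l2_continuous_def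
proof (intro conjI allI impI)
  fix s :: real assume s: "s \<ge> 0"
  then have "(f \<longlongrightarrow> f s) (at s within {0..})"
    using assms by (simp add: continuous_on_def)
  then have "((\<lambda>t. norm (f t - f s)) \<longlongrightarrow> 0) (at s within {0..})"
    by (simp add: LIM_zero tendsto_norm_zero)
  then show "((\<lambda>t. l2norm M (\<lambda>w. f t - f s)) \<longlongrightarrow> 0) (at s within {0..})"
    by (simp add: l2norm_def prob_space)
qed simp

section \<open>Expectations along continuous paths\<close>

locale continuous_process = prob_space M for M :: "'w measure" +
  fixes X :: "real \<Rightarrow> 'w \<Rightarrow> 'b::euclidean_space"
  assumes X_meas: "0 \<le> t \<Longrightarrow> X t \<in> borel_measurable M"
    and X_path: "w \<in> space M \<Longrightarrow> continuous_on {0..} (\<lambda>t. X t w)"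
    and X_moment: "T > 0 \<Longrightarrow> (SUP t\<in>{0..T}. \<integral>\<^sup>+w. ennreal ((norm (X t w))\<^sup>2) \<partial>M) < \<infinity>"
begin

lemma X_sq_bound:
  assumes "T > 0"
  obtains C where "C \<ge> 0" "\<And>t. t \<in> {0..T} \<Longrightarrow> sq_integrable M (X t)"
    "\<And>t. t \<in> {0..T} \<Longrightarrow> (\<integral>w. (norm (X t w))\<^sup>2 \<partial>M) \<le> C"
proof -
  let ?S = "SUP t\<in>{0..T}. \<integral>\<^sup>+w. ennreal ((norm (X t w))\<^sup>2) \<partial>M"
  have S: "?S = ennreal (enn2real ?S)" using X_moment[OF assms] by simp
  have le: "(\<integral>\<^sup>+w. ennreal ((norm (X t w))\<^sup>2) \<partial>M) \<le> ?S" if "t \<in> {0..T}" for t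
    using that by (rule SUP_upper)
  have sq: "sq_integrable M (X t)" if "t \<in> {0..T}" for t
    using le_less_trans[OF le[OF that] X_moment[OF assms]] that
    by (intro sq_integrable_if_nn_integral X_meas) auto
  show ?thesis
  proof (rule that[of "enn2real ?S", OF _ sq])
    fix t assume t: "t \<in> {0..T}"
    have "ennreal (\<integral>w. (norm (X t w))\<^sup>2 \<partial>M) \<le> ennreal (enn2real ?S)"
      using le[OF t] sq[OF t] S by (subst nn_integral_eq_integral[symmetric]) (auto simp: sq_integrable_def)
    then show "(\<integral>w. (norm (X t w))\<^sup>2 \<partial>M) \<le> enn2real ?S" by simp
  qed auto
qed

lemma X_sq: "0 \<le> t \<Longrightarrow> sq_integrable M (X t)"
  by (rule X_sq_bound[of "t + 1"]) auto

lemma X_integrable: "0 \<le> t \<Longrightarrow> integrable M (X t)"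
  by (rule sq_integrable_imp_integrable[OF X_sq])

lemma continuous_on_bounded_mean:
  fixes g :: "'b \<Rightarrow> 'c::euclidean_space"
  assumes g: "continuous_on UNIV g" and C: "\<And>x. norm (g x) \<le> C"
  shows "continuous_on {0..} (\<lambda>t. \<integral>w. g (X t w) \<partial>M)"
proof (rule continuous_on_sequentiallyI)
  fix u :: "nat \<Rightarrow> real" and a assume u: "\<forall>n. u n \<in> {0..}" "a \<in> {0..}" "u \<longlonglongrightarrow> a"
  have gm: "g \<in> borel_measurable borel" by (rule borel_measurable_continuous_onI[OF g])
  have m: "(\<lambda>w. g (X t w)) \<in> borel_measurable M" if "t \<ge> 0" for t
    by (rule measurable_compose[OF X_meas[OF that] gm])
  show "(\<lambda>n. \<integral>w. g (X (u n) w) \<partial>M) \<longlonglongrightarrow> (\<integral>w. g (X a w) \<partial>M)"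
  proof (rule integral_dominated_convergence[where w="\<lambda>_. C"])
    show "AE w in M. (\<lambda>n. g (X (u n) w)) \<longlonglongrightarrow> g (X a w)"
    proof (rule AE_I2)
      fix w assume "w \<in> space M"
      then have "(\<lambda>n. X (u n) w) \<longlonglongrightarrow> X a w"
        using continuous_on_tendsto_compose[OF X_path u(3,2)] u(1) by simp
      then show "(\<lambda>n. g (X (u n) w)) \<longlonglongrightarrow> g (X a w)"
        using continuous_on_tendsto_compose[OF g] by simp
    qed
  qed (use u m C in auto)
qed

text \<open>For \<open>g\<close> of linear growth, \<open>g/(1 + \<epsilon>|x|)\<close> is bounded and differs from \<open>g\<close> by at most \<open>C\<epsilon>|x|\<^sup>2\<close>;
  locally bounded second moments make the approximation uniform in time.\<close>

lemma continuous_on_linear_growth_mean: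
  fixes g :: "'b \<Rightarrow> 'c::euclidean_space"
  assumes g: "continuous_on UNIV g" and C: "\<And>x. norm (g x) \<le> C * norm x"
  shows "continuous_on {0..} (\<lambda>t. \<integral>w. g (X t w) \<partial>M)"
proof (rule continuous_on_half_line)
  fix T :: real assume "T > 0"
  then obtain K where K: "K \<ge> 0" "\<And>t. t \<in> {0..T} \<Longrightarrow> sq_integrable M (X t)"
    "\<And>t. t \<in> {0..T} \<Longrightarrow> (\<integral>w. (norm (X t w))\<^sup>2 \<partial>M) \<le> K" by (rule X_sq_bound) blast
  have C0: "0 \<le> C * norm x" for x :: 'b using C[of x] norm_ge_zero order_trans by blast
  define e where "e n = 1 / real (Suc n)" for n
  have e: "e n > 0" for n by (simp add: e_def)
  let ?g = "\<lambda>n x. g x /\<^sub>R (1 + e n * norm x)"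
  have pos: "1 + e n * norm x > 0" for n and x :: 'b using e[of n] by (simp add: add_pos_nonneg)
  have cont: "continuous_on UNIV (?g n)" for n
    using pos by (intro continuous_intros g) (auto simp: less_le)
  have gbound: "norm (?g n x) \<le> \<bar>C\<bar> / e n" for n x
  proof -
    have "norm (g x) \<le> \<bar>C\<bar> * norm x" using C[of x] by (meson abs_ge_self mult_right_mono norm_ge_zero order_trans)
    also have "\<bar>C\<bar> * norm x \<le> \<bar>C\<bar> / e n * (1 + e n * norm x)"
      using e[of n] by (simp add: field_simps)
    finally show ?thesis using pos[of n x] by (simp add: field_simps)
  qed
  have gdiff: "norm (?g n x - g x) \<le> \<bar>C\<bar> * e n * (norm x)\<^sup>2" for n x
  proof -
    have "inverse (1 + e n * norm x) - 1 = - (e n * norm x / (1 + e n * norm x))"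
      using pos[of n x] by (simp add: divide_simps)
    moreover have "?g n x - g x = (inverse (1 + e n * norm x) - 1) *\<^sub>R g x"
      by (simp add: scaleR_left_diff_distrib)
    ultimately have "?g n x - g x = - ((e n * norm x / (1 + e n * norm x)) *\<^sub>R g x)"
      by simp
    then have "norm (?g n x - g x) = (e n * norm x / (1 + e n * norm x)) * norm (g x)"
      using e[of n] pos[of n x] by simp
    also have "\<dots> \<le> (e n * norm x) * (\<bar>C\<bar> * norm x)"
    proof (rule mult_mono)
      show "e n * norm x / (1 + e n * norm x) \<le> e n * norm x"
        using e[of n] pos[of n x] by (simp add: field_simps)
      show "norm (g x) \<le> \<bar>C\<bar> * norm x"
        using C[of x] by (meson abs_ge_self mult_right_mono norm_ge_zero order_trans)
    qed (use e[of n] in auto)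
    finally show ?thesis by (simp add: power2_eq_square ac_simps)
  qed
  have gm: "(\<lambda>w. g (X t w)) \<in> borel_measurable M" if "t \<ge> 0" for t
    by (rule measurable_compose[OF X_meas[OF that] borel_measurable_continuous_onI[OF g]])
  show "continuous_on {0..T} (\<lambda>t. \<integral>w. g (X t w) \<partial>M)"
  proof (rule uniform_limit_theorem[of _ "\<lambda>n t. \<integral>w. ?g n (X t w) \<partial>M"])
    show "\<forall>\<^sub>F n in sequentially. continuous_on {0..T} (\<lambda>t. \<integral>w. ?g n (X t w) \<partial>M)"
      by (intro always_eventually allI continuous_on_subset[OF continuous_on_bounded_mean[OF cont gbound]]) auto
    have bd: "norm ((\<integral>w. ?g n (X t w) \<partial>M) - (\<integral>w. g (X t w) \<partial>M)) \<le> \<bar>C\<bar> * e n * K" if t: "t \<in> {0..T}" for n t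
    proof -
      have ig: "integrable M (\<lambda>w. g (X t w))"
        by (rule sq_integrable_imp_integrable[OF sq_integrable_bound[OF K(2)[OF t] gm C]]) (use t in auto)
      have ign: "integrable M (\<lambda>w. ?g n (X t w))"
        using t by (intro integrable_const_bound[of _ "\<bar>C\<bar> / e n"] AE_I2 gbound
            measurable_compose[OF X_meas borel_measurable_continuous_onI[OF cont]]) auto
      have "(\<integral>w. ?g n (X t w) \<partial>M) - (\<integral>w. g (X t w) \<partial>M) = (\<integral>w. ?g n (X t w) - g (X t w) \<partial>M)"
        using ig ign by simp
      also have "norm \<dots> \<le> (\<integral>w. norm (?g n (X t w) - g (X t w)) \<partial>M)" by (rule integral_norm_bound)
      also have "\<dots> \<le> (\<integral>w. \<bar>C\<bar> * e n * (norm (X t w))\<^sup>2 \<partial>M)"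
        using K(2)[OF t] ig ign by (intro integral_mono gdiff integrable_norm Bochner_Integration.integrable_diff) (auto simp: sq_integrable_def)
      also have "\<dots> = \<bar>C\<bar> * e n * (\<integral>w. (norm (X t w))\<^sup>2 \<partial>M)" by simp
      also have "\<dots> \<le> \<bar>C\<bar> * e n * K" using e[of n] K(3)[OF t] by (intro mult_left_mono) auto
      finally show ?thesis .
    qed
    have e0: "(\<lambda>n. \<bar>C\<bar> * e n * K) \<longlonglongrightarrow> \<bar>C\<bar> * 0 * K"
      unfolding e_def by (intro tendsto_intros LIMSEQ_Suc[OF lim_1_over_n])
    show "uniform_limit {0..T} (\<lambda>n t. \<integral>w. ?g n (X t w) \<partial>M) (\<lambda>t. \<integral>w. g (X t w) \<partial>M) sequentially"
    proof (rule uniform_limitI)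
      fix d :: real assume "d > 0"
      then have "\<forall>\<^sub>F n in sequentially. \<bar>C\<bar> * e n * K < d"
        using order_tendstoD(2)[OF e0, of d] by simp
      then show "\<forall>\<^sub>F n in sequentially. \<forall>t\<in>{0..T}. dist (\<integral>w. ?g n (X t w) \<partial>M) (\<integral>w. g (X t w) \<partial>M) < d"
        by eventually_elim (simp only: dist_norm, blast intro: le_less_trans[OF bd])
    qed
  qed simp
qed

text \<open>Fubini arguments over \<open>M\<close> and time need joint measurability. Rounding the
  time down to a grid leaves countably many measurable random variables, and path continuity gives
  the limit. The process is prescribed for nonnegative times only, hence
  \<open>max 0\<close>.\<close>

lemma X_jointly_measurable: "(\<lambda>z. X (max 0 (snd z)) (fst z)) \<in> borel_measurable (M \<Otimes>\<^sub>M lborel)"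
proof (rule borel_measurable_LIMSEQ_metric)
  fix n :: nat
  let ?k = "\<lambda>z. \<lfloor>real (Suc n) * snd z\<rfloor>"
  show "(\<lambda>z. X (max 0 (real_of_int (?k z) / real (Suc n))) (fst z)) \<in> borel_measurable (M \<Otimes>\<^sub>M lborel)"
  proof (rule measurable_compose_countable[where g="?k"])
    show "(\<lambda>z. X (max 0 (real_of_int i / real (Suc n))) (fst z)) \<in> borel_measurable (M \<Otimes>\<^sub>M lborel)" for i
      by (rule measurable_compose[OF measurable_fst X_meas]) simp
    show "?k \<in> measurable (M \<Otimes>\<^sub>M lborel) (count_space UNIV)" by measurable
  qed
next
  fix z :: "'w \<times> real" assume "z \<in> space (M \<Otimes>\<^sub>M lborel)"
  then have w: "fst z \<in> space M" by (auto simp: space_pair_measure)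
  have "(\<lambda>n. max 0 (real_of_int \<lfloor>real (Suc n) * snd z\<rfloor> / real (Suc n))) \<longlonglongrightarrow> max 0 (snd z)"
    by (intro tendsto_max tendsto_const tendsto_floor_grid)
  then show "(\<lambda>n. X (max 0 (real_of_int \<lfloor>real (Suc n) * snd z\<rfloor> / real (Suc n))) (fst z)) \<longlonglongrightarrow> X (max 0 (snd z)) (fst z)"
    by (rule continuous_on_tendsto_compose[OF X_path[OF w]]) auto
qed

end

section \<open>Moments of the mean-field dynamics\<close>

text \<open>The parameters \<open>c\<close> and \<open>l\<close> stand for c_L and L_m. The Hessian
  enters through its quadratic form, the shape in which the Taylor estimates use it.\<close>

locale consensus_dynamics =
  fixes M :: "'w measure" and F :: "real \<Rightarrow> 'w measure"
    and W X :: "real \<Rightarrow> 'w \<Rightarrow> real ^ 'd" and L :: "real ^ 'd \<Rightarrow> real"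
    and \<beta> \<Lambda> \<sigma> c l :: real
  assumes solution: "mean_field_solution M F W L \<beta> \<Lambda> \<sigma> X"
    and C2: "twice_continuously_differentiable L"
    and hess: "\<And>x v. \<bar>v \<bullet> (hessian L x *v v)\<bar> \<le> c * (v \<bullet> v)"
    and lower: "\<And>x. l \<le> L x"
    and \<beta>_pos: "\<beta> > 0" and \<Lambda>_pos: "\<Lambda> > 0" and \<sigma>_pos: "\<sigma> > 0"

sublocale consensus_dynamics \<subseteq> continuous_process M X
proof -
  have basis: "brownian_basis M F W" using solution by (simp add: mean_field_solution_def)
  then interpret prob_space M by (simp add: brownian_basis_def)
  have sub: "subalgebra M (F t)" for t using basis by (simp add: brownian_basis_def)
  show "continuous_process M X"
  proof
    show "X t \<in> borel_measurable M" if "0 \<le> t" for t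
      by (rule measurable_from_subalg[OF sub[of t]]) (use solution that in \<open>simp add: mean_field_solution_def\<close>)
    show "continuous_on {0..} (\<lambda>t. X t w)" if "w \<in> space M" for w
      using solution that by (simp add: mean_field_solution_def)
    show "(SUP t\<in>{0..T}. \<integral>\<^sup>+w. ennreal ((norm (X t w))\<^sup>2) \<partial>M) < \<infinity>" if "T > 0" for T
      using solution that by (simp add: mean_field_solution_def)
  qed
qed

context consensus_dynamics
begin

lemma component: "brownian_filtration M F (\<lambda>t w. W t w $ i)"
  using solution by (intro brownian_basis_component) (simp add: mean_field_solution_def)

lemma X_adapted: "0 \<le> t \<Longrightarrow> X t \<in> borel_measurable (F t)"
  using solution by (simp add: mean_field_solution_def)

abbreviation P where "P \<equiv> M \<Otimes>\<^sub>M (lborel :: real measure)"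

definition weight :: "real ^ 'd \<Rightarrow> real" where "weight x = exp (- \<beta> * L x)"
definition wmax :: real where "wmax = exp (- \<beta> * l)"
definition xbar :: "real \<Rightarrow> real ^ 'd" where "xbar t = consensus_point M L \<beta> (X t)"
definition Z :: "real \<Rightarrow> real" where "Z t = laplace_mean M L (X t) \<beta>"
definition Y :: "real \<Rightarrow> 'w \<Rightarrow> real ^ 'd" where "Y t w = X t w - xbar t"
definition mean :: "real \<Rightarrow> real ^ 'd" where "mean t = (\<integral>w. X t w \<partial>M)"
definition D :: "real \<Rightarrow> 'w \<Rightarrow> real ^ 'd" where "D t w = X t w - mean t"
definition V :: "real \<Rightarrow> real" where "V t = mean_sq_deviation M (X t)"
definition a :: "real \<Rightarrow> real" where "a t = (\<integral>w. (norm (Y t w))\<^sup>2 \<partial>M)"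

lemma L_continuous: "continuous_on UNIV L"
  using C2 by (intro differentiable_imp_continuous_on)
    (simp add: twice_continuously_differentiable_def differentiable_on_def differentiable_at_withinI)

lemma weight_continuous: "continuous_on UNIV weight"
  unfolding weight_def by (intro continuous_intros L_continuous)

lemma weight_pos: "0 < weight x"
  by (simp add: weight_def)

lemma weight_le: "weight x \<le> wmax"
  using lower \<beta>_pos by (simp add: weight_def wmax_def)

lemma wmax_pos: "0 < wmax"
  by (simp add: wmax_def)

lemma weight_measurable: "0 \<le> t \<Longrightarrow> (\<lambda>w. weight (X t w)) \<in> borel_measurable M"
  by (rule measurable_compose[OF X_meas borel_measurable_continuous_onI[OF weight_continuous]])

lemma weight_integrable: "0 \<le> t \<Longrightarrow> integrable M (\<lambda>w. weight (X t w))"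
  by (intro integrable_const_bound[of _ wmax] AE_I2 weight_measurable)
     (use weight_pos weight_le in \<open>auto simp: less_imp_le\<close>)

lemma Z_eq: "Z t = (\<integral>w. weight (X t w) \<partial>M)"
  by (simp add: Z_def laplace_mean_def weight_def)

lemma Z_pos: "0 \<le> t \<Longrightarrow> 0 < Z t"
proof -
  assume t: "0 \<le> t"
  have "Z t \<noteq> 0"
  proof
    assume "Z t = 0"
    then have "AE w in M. weight (X t w) = 0"
      using integral_nonneg_eq_0_iff_AE[OF weight_integrable[OF t]] weight_pos
      by (simp add: Z_eq less_imp_le)
    then have "AE w in M. False"
      by eventually_elim (use weight_pos in \<open>metis less_irrefl\<close>)
    then show False by (simp add: AE_False)
  qed
  moreover have "0 \<le> Z t" unfolding Z_eq using weight_pos by (simp add: less_imp_le)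
  ultimately show ?thesis by simp
qed

lemma Z_le: "0 \<le> t \<Longrightarrow> Z t \<le> wmax"
  unfolding Z_eq using integral_mono[OF weight_integrable integrable_const[of wmax]] weight_le
  by (simp add: prob_space)

lemma Z_continuous: "continuous_on {0..} Z"
  unfolding Z_eq by (rule continuous_on_bounded_mean[OF weight_continuous, of wmax])
    (use weight_pos weight_le in \<open>auto simp: less_imp_le\<close>)

lemma xbar_eq: "xbar t = (\<integral>w. weight (X t w) *\<^sub>R X t w \<partial>M) /\<^sub>R Z t"
  by (simp add: xbar_def consensus_point_def weight_def Z_def)

lemma xbar_continuous: "continuous_on {0..} xbar"
  unfolding xbar_eq
proof (intro continuous_intros Z_continuous)
  show "continuous_on {0..} (\<lambda>t. \<integral>w. weight (X t w) *\<^sub>R X t w \<partial>M)"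
    by (rule continuous_on_linear_growth_mean[where g="\<lambda>x. weight x *\<^sub>R x" and C=wmax])
       (use weight_pos weight_le in \<open>auto simp: less_imp_le intro!: continuous_intros weight_continuous mult_right_mono\<close>)
qed (use Z_pos in \<open>auto simp: less_le\<close>)

lemma mean_continuous: "continuous_on {0..} mean"
  unfolding mean_def by (rule continuous_on_linear_growth_mean[where g="\<lambda>x. x" and C=1]) auto

lemma Y_sq: "0 \<le> t \<Longrightarrow> sq_integrable M (Y t)"
  unfolding Y_def by (intro sq_integrable_diff X_sq sq_integrable_const)

lemma D_sq: "0 \<le> t \<Longrightarrow> sq_integrable M (D t)"
  unfolding D_def by (intro sq_integrable_diff X_sq sq_integrable_const)

lemma Y_path: "w \<in> space M \<Longrightarrow> continuous_on {0..} (\<lambda>t. Y t w)"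
  unfolding Y_def by (intro continuous_intros X_path xbar_continuous)

lemma V_eq: "V t = (\<integral>w. (norm (D t w))\<^sup>2 \<partial>M)"
  by (simp add: V_def mean_sq_deviation_def D_def mean_def)

text \<open>Local boundedness comes before continuity: the mean-square continuity of
  \<open>X\<close>, from which continuity of \<open>a\<close> is derived, rests on it. Second
  moments of \<open>X\<close> are locally bounded by the notion of solution, and \<open>xbar\<close>
  is continuous.\<close>

lemma a_bound:
  assumes "T > 0"
  obtains A where "A \<ge> 0" "\<And>t. t \<in> {0..T} \<Longrightarrow> a t \<le> A"
proof -
  obtain C where C: "C \<ge> 0" "\<And>t. t \<in> {0..T} \<Longrightarrow> (\<integral>w. (norm (X t w))\<^sup>2 \<partial>M) \<le> C"
    by (rule X_sq_bound[OF assms]) (rule that)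
  have "compact (xbar ` {0..T})"
    by (intro compact_continuous_image continuous_on_subset[OF xbar_continuous]) auto
  then have "bounded (xbar ` {0..T})" by (rule compact_imp_bounded)
  then obtain B where "\<forall>x\<in>xbar ` {0..T}. norm x \<le> B" unfolding bounded_iff by blast
  then have B: "norm (xbar t) \<le> B" if "t \<in> {0..T}" for t using that by blast
  have "a t \<le> (sqrt C + B)\<^sup>2" if t: "t \<in> {0..T}" for t
  proof -
    have "l2norm M (Y t) \<le> l2norm M (X t) + l2norm M (\<lambda>w. xbar t)"
      unfolding Y_def using t by (intro l2norm_triangle_diff X_sq sq_integrable_const) auto
    also have "l2norm M (\<lambda>w. xbar t) = norm (xbar t)" by (simp add: l2norm_def prob_space)
    also have "l2norm M (X t) \<le> sqrt C"
      unfolding l2norm_def using C(2)[OF t] by simp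
    finally have "l2norm M (Y t) \<le> sqrt C + B" using B[OF t] by simp
    then have "(l2norm M (Y t))\<^sup>2 \<le> (sqrt C + B)\<^sup>2" by (intro power_mono) auto
    then show ?thesis by (simp add: a_def l2norm_sq)
  qed
  then show ?thesis using that[of "(sqrt C + B)\<^sup>2"] by simp
qed

text \<open>The common integrand of drift and noise, cut off to \<open>[s,t]\<close> and viewed on
  the product space \<open>P\<close>; its squared norm is the integral of \<open>a\<close> over
  \<open>[s,t]\<close>.\<close>

definition Ycut :: "real \<Rightarrow> real \<Rightarrow> 'w \<times> real \<Rightarrow> real ^ 'd" where
  "Ycut s t z = indicator {s..t} (snd z) *\<^sub>R Y (snd z) (fst z)"

lemma Ycut_measurable:
  assumes "0 \<le> s"
  shows "Ycut s t \<in> borel_measurable P"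
proof -
  have xb: "(\<lambda>r. xbar (max 0 r)) \<in> borel_measurable borel"
    by (intro borel_measurable_continuous_onI continuous_on_compose2[OF xbar_continuous] continuous_intros) auto
  have "(\<lambda>z. indicator {s..t} (snd z) *\<^sub>R (X (max 0 (snd z)) (fst z) - xbar (max 0 (snd z)))) \<in> borel_measurable P"
    by (intro borel_measurable_scaleR borel_measurable_diff X_jointly_measurable
        measurable_compose[OF _ xb]) measurable
  also have "(\<lambda>z. indicator {s..t} (snd z) *\<^sub>R (X (max 0 (snd z)) (fst z) - xbar (max 0 (snd z)))) = Ycut s t"
    using assms by (auto simp: Ycut_def Y_def indicator_def fun_eq_iff max_absorb2)
  finally show ?thesis .
qed

lemma Ycut_sq:
  assumes st: "0 \<le> s" "s \<le> t"
  shows "sq_integrable P (Ycut s t)"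
proof (rule sq_integrable_if_nn_integral)
  interpret Q: pair_sigma_finite M "lborel :: real measure" ..
  show m: "Ycut s t \<in> borel_measurable P" by (rule Ycut_measurable[OF st(1)])
  obtain A where A: "A \<ge> 0" "\<And>r. r \<in> {0..t + 1} \<Longrightarrow> a r \<le> A"
    using a_bound[of "t + 1"] st by auto
  have m2: "(\<lambda>z. ennreal ((norm (Ycut s t z))\<^sup>2)) \<in> borel_measurable P"
    using m by measurable
  have "(\<integral>\<^sup>+z. ennreal ((norm (Ycut s t z))\<^sup>2) \<partial>P) = (\<integral>\<^sup>+r. \<integral>\<^sup>+w. ennreal ((norm (Ycut s t (w, r)))\<^sup>2) \<partial>M \<partial>lborel)"
    by (rule Q.nn_integral_snd[symmetric]) (use m2 in simp)
  also have "\<dots> \<le> (\<integral>\<^sup>+r. ennreal A * indicator {s..t} r \<partial>lborel)"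
  proof (rule nn_integral_mono)
    fix r :: real
    show "(\<integral>\<^sup>+w. ennreal ((norm (Ycut s t (w, r)))\<^sup>2) \<partial>M) \<le> ennreal A * indicator {s..t} r"
    proof (cases "r \<in> {s..t}")
      case True
      then have "(\<integral>\<^sup>+w. ennreal ((norm (Ycut s t (w, r)))\<^sup>2) \<partial>M) = (\<integral>\<^sup>+w. ennreal ((norm (Y r w))\<^sup>2) \<partial>M)"
        by (simp add: Ycut_def)
      also have "\<dots> = ennreal (a r)"
        unfolding a_def using Y_sq[of r] True st by (intro nn_integral_eq_integral) (auto simp: sq_integrable_def)
      also have "\<dots> \<le> ennreal A" using A(2)[of r] True st by (intro ennreal_leI) auto
      finally show ?thesis using True by simp
    qed (simp add: Ycut_def)
  qed
  also have "\<dots> = ennreal A * ennreal (t - s)"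
    using st by (simp add: nn_integral_cmult)
  also have "\<dots> < \<infinity>" by (simp add: ennreal_mult_less_top)
  finally show "(\<integral>\<^sup>+z. ennreal ((norm (Ycut s t z))\<^sup>2) \<partial>P) < \<infinity>" .
qed

lemma Ycut_l2norm:
  assumes st: "0 \<le> s" "s \<le> t"
  shows "(l2norm P (Ycut s t))\<^sup>2 = (LINT r:{s..t}|lborel. a r)" "set_integrable lborel {s..t} a"
proof -
  interpret Q: pair_sigma_finite M "lborel :: real measure" ..
  have i: "integrable P (\<lambda>(w, r). (norm (Ycut s t (w, r)))\<^sup>2)"
    using Ycut_sq[OF st] by (simp add: sq_integrable_def split_beta')
  have eq: "(\<integral>w. (norm (Ycut s t (w, r)))\<^sup>2 \<partial>M) = indicator {s..t} r * a r" for r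
    by (cases "r \<in> {s..t}") (auto simp: Ycut_def a_def)
  show "(l2norm P (Ycut s t))\<^sup>2 = (LINT r:{s..t}|lborel. a r)"
    using Q.integral_snd[OF i] by (simp add: eq l2norm_sq set_lebesgue_integral_def split_beta')
  show "set_integrable lborel {s..t} a"
    using Q.integrable_snd[OF i] by (simp add: eq set_integrable_def)
qed

definition G :: "real \<Rightarrow> real \<Rightarrow> 'w \<Rightarrow> real ^ 'd" where
  "G s t w = (LINT r:{s..t}|lborel. Y r w)"

lemma Y_set_integrable: "0 \<le> s \<Longrightarrow> w \<in> space M \<Longrightarrow> set_integrable lborel {s..t} (\<lambda>r. Y r w)"
  by (intro borel_integrable_atLeastAtMost' continuous_on_subset[OF Y_path]) auto

lemma G_combine:
  assumes "0 \<le> s" "s \<le> t" "w \<in> space M"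
  shows "G 0 t w - G 0 s w = G s t w"
proof -
  have G: "G u v w = integral {u..v} (\<lambda>r. Y r w)" if "0 \<le> u" for u v
    unfolding G_def using set_borel_integral_eq_integral(2)[OF Y_set_integrable[OF that assms(3)]] .
  have "(\<lambda>r. Y r w) integrable_on {0..t}"
    by (rule set_borel_integral_eq_integral(1)[OF Y_set_integrable[OF _ assms(3)]]) simp
  from Henstock_Kurzweil_Integration.integral_combine[OF assms(1,2) this]
  show ?thesis using assms by (simp add: G algebra_simps)
qed

lemma G_eq: "G s t w = (\<integral>r. Ycut s t (w, r) \<partial>lborel)"
  by (simp add: G_def set_lebesgue_integral_def Ycut_def)

lemma G_measurable:
  assumes "0 \<le> s"
  shows "G s t \<in> borel_measurable M"
  unfolding G_eq by (rule lborel.borel_measurable_lebesgue_integral)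
    (use Ycut_measurable[OF assms] in \<open>simp add: split_beta'\<close>)

text \<open>Cauchy-Schwarz in the time variable, then expectation. The extra factor
  \<open>sqrt (t - s)\<close> makes the drift negligible against the noise in second moments of
  short increments.\<close>

lemma G_sq:
  assumes st: "0 \<le> s" "s \<le> t"
  shows "sq_integrable M (G s t)" "l2norm M (G s t) \<le> sqrt (t - s) * l2norm P (Ycut s t)"
proof -
  interpret Q: pair_sigma_finite M "lborel :: real measure" ..
  let ?g = "\<lambda>w. \<integral>r. (norm (Ycut s t (w, r)))\<^sup>2 \<partial>lborel"
  have i: "integrable P (\<lambda>(w, r). (norm (Ycut s t (w, r)))\<^sup>2)"
    using Ycut_sq[OF st] by (simp add: sq_integrable_def split_beta')
  have gi: "integrable M ?g" using Q.integrable_fst[OF i] by simp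
  have gint: "(\<integral>w. ?g w \<partial>M) = (l2norm P (Ycut s t))\<^sup>2"
    using Q.integral_fst[OF i] by (simp add: l2norm_sq split_beta')
  have le: "(norm (G s t w))\<^sup>2 \<le> (t - s) * ?g w" if w: "w \<in> space M" for w
  proof -
    have path: "continuous_on {s..t} (\<lambda>r. Y r w)"
      by (rule continuous_on_subset[OF Y_path[OF w]]) (use st in auto)
    have "set_integrable lborel {s..t} (\<lambda>r. (norm (Y r w))\<^sup>2)"
      by (intro borel_integrable_atLeastAtMost' continuous_intros path)
    then have "integrable lborel (\<lambda>r. (norm (Ycut s t (w, r)))\<^sup>2)"
      unfolding set_integrable_def
      by (rule Bochner_Integration.integrable_cong[THEN iffD1, rotated 2]) (auto simp: Ycut_def indicator_def)
    moreover have "integrable lborel (\<lambda>r. Ycut s t (w, r))"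
      using Y_set_integrable[OF st(1) w, of t] by (simp add: set_integrable_def Ycut_def)
    ultimately have sq: "sq_integrable lborel (\<lambda>r. Ycut s t (w, r))"
      by (auto simp: sq_integrable_def)
    have ind: "sq_integrable lborel (\<lambda>r. indicator {s..t} r :: real)"
    proof -
      have "(\<lambda>r. (norm (indicator {s..t} r :: real))\<^sup>2) = (indicator {s..t} :: real \<Rightarrow> real)"
        by (auto simp: indicator_def)
      then show ?thesis using st by (simp add: sq_integrable_def)
    qed
    have lind: "l2norm lborel (\<lambda>r. indicator {s..t} r :: real) = sqrt (t - s)"
    proof -
      have "(\<lambda>r. (norm (indicator {s..t} r :: real))\<^sup>2) = (indicator {s..t} :: real \<Rightarrow> real)"
        by (auto simp: indicator_def)
      then show ?thesis using st by (simp add: l2norm_def)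
    qed
    have "norm (G s t w) \<le> (\<integral>r. norm (Ycut s t (w, r)) \<partial>lborel)"
      unfolding G_eq by (rule integral_norm_bound)
    also have "\<dots> = (\<integral>r. norm (indicator {s..t} r :: real) * norm (norm (Ycut s t (w, r))) \<partial>lborel)"
      by (intro Bochner_Integration.integral_cong) (auto simp: Ycut_def indicator_def)
    also have "\<dots> \<le> l2norm lborel (\<lambda>r. indicator {s..t} r :: real) * l2norm lborel (\<lambda>r. norm (Ycut s t (w, r)))"
      by (rule Cauchy_Schwarz_integral(1)[OF ind sq_integrable_norm[OF sq]])
    finally have "(norm (G s t w))\<^sup>2 \<le> (sqrt (t - s) * l2norm lborel (\<lambda>r. norm (Ycut s t (w, r))))\<^sup>2"
      by (intro power_mono) (auto simp: lind)
    then show ?thesis using st by (simp add: power_mult_distrib l2norm_sq)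
  qed
  have int: "integrable M (\<lambda>w. (norm (G s t w))\<^sup>2)"
  proof (rule Bochner_Integration.integrable_bound)
    show "integrable M (\<lambda>w. (t - s) * ?g w)" using gi by simp
    show "AE w in M. norm ((norm (G s t w))\<^sup>2) \<le> norm ((t - s) * ?g w)"
      by (rule AE_I2) (use le st in auto)
  qed (use G_measurable[OF st(1)] in measurable)
  then show sq: "sq_integrable M (G s t)" using G_measurable[OF st(1)] by (simp add: sq_integrable_def)
  have "(l2norm M (G s t))\<^sup>2 \<le> (\<integral>w. (t - s) * ?g w \<partial>M)"
    unfolding l2norm_sq by (intro integral_mono int le) (use gi in simp)
  also have "\<dots> = (sqrt (t - s) * l2norm P (Ycut s t))\<^sup>2"
    using st by (simp add: gint power_mult_distrib)
  finally show "l2norm M (G s t) \<le> sqrt (t - s) * l2norm P (Ycut s t)"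
    by (rule power2_le_imp_le) (use st in simp)
qed

lemma G_inner:
  assumes st: "0 \<le> s" "s \<le> t" and U: "sq_integrable M U"
  shows "(\<integral>w. U w \<bullet> G s t w \<partial>M) = (LINT r:{s..t}|lborel. \<integral>w. U w \<bullet> Y r w \<partial>M)"
proof -
  interpret Q: pair_sigma_finite M "lborel :: real measure" ..
  \<comment> \<open>Time has infinite total measure, so \<open>U\<close> must be cut off as well to
    be square integrable on \<open>P\<close>.\<close>
  let ?U = "\<lambda>z. indicator {s..t} (snd z) *\<^sub>R U (fst z)"
  have Um: "U \<in> borel_measurable M" by (rule sq_integrable_measurable[OF U])
  have "sq_integrable P ?U"
  proof (rule sq_integrable_if_nn_integral)
    show m: "?U \<in> borel_measurable P" using Um by measurable
    have m2: "(\<lambda>z. ennreal ((norm (?U z))\<^sup>2)) \<in> borel_measurable P" using m by measurable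
    have "(\<integral>\<^sup>+z. ennreal ((norm (?U z))\<^sup>2) \<partial>P) = (\<integral>\<^sup>+w. \<integral>\<^sup>+r. ennreal ((norm (?U (w, r)))\<^sup>2) \<partial>lborel \<partial>M)"
      by (rule lborel.nn_integral_fst[symmetric]) (use m2 in simp)
    also have "\<dots> = (\<integral>\<^sup>+w. \<integral>\<^sup>+r. ennreal ((norm (U w))\<^sup>2) * indicator {s..t} r \<partial>lborel \<partial>M)"
      by (intro nn_integral_cong) (auto simp: indicator_def)
    also have "\<dots> = (\<integral>\<^sup>+w. ennreal ((norm (U w))\<^sup>2) * ennreal (t - s) \<partial>M)"
      using st by (simp add: nn_integral_cmult)
    also have "\<dots> = (\<integral>\<^sup>+w. ennreal ((norm (U w))\<^sup>2) \<partial>M) * ennreal (t - s)"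
      using Um by (intro nn_integral_multc) measurable
    also have "\<dots> < \<infinity>"
      using U nn_integral_eq_integral[of M "\<lambda>w. (norm (U w))\<^sup>2"]
      by (simp add: sq_integrable_def ennreal_mult_less_top)
    finally show "(\<integral>\<^sup>+z. ennreal ((norm (?U z))\<^sup>2) \<partial>P) < \<infinity>" .
  qed
  then have i: "integrable P (\<lambda>(w, r). ?U (w, r) \<bullet> Ycut s t (w, r))"
    using integrable_inner_sq(1)[of P ?U, OF _ Ycut_sq[OF st]] by (simp only: split_beta' fst_conv snd_conv prod.collapse)
  have eq: "?U (w, r) \<bullet> Ycut s t (w, r) = U w \<bullet> Ycut s t (w, r)" for w r
    by (auto simp: Ycut_def indicator_def)
  have "(\<integral>w. U w \<bullet> G s t w \<partial>M) = (\<integral>w. \<integral>r. ?U (w, r) \<bullet> Ycut s t (w, r) \<partial>lborel \<partial>M)"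
  proof (intro Bochner_Integration.integral_cong refl)
    fix w assume "w \<in> space M"
    then have "integrable lborel (\<lambda>r. Ycut s t (w, r))"
      using Y_set_integrable[OF st(1), of w t] by (simp add: set_integrable_def Ycut_def)
    then show "U w \<bullet> G s t w = (\<integral>r. ?U (w, r) \<bullet> Ycut s t (w, r) \<partial>lborel)"
      unfolding eq G_eq by simp
  qed
  also have "\<dots> = (\<integral>r. \<integral>w. ?U (w, r) \<bullet> Ycut s t (w, r) \<partial>M \<partial>lborel)"
    using Q.Fubini_integral[OF i] by simp
  also have "\<dots> = (\<integral>r. indicator {s..t} r *\<^sub>R (\<integral>w. U w \<bullet> Y r w \<partial>M) \<partial>lborel)"
    by (intro Bochner_Integration.integral_cong refl) (auto simp: Ycut_def indicator_def)
  finally show ?thesis by (simp add: set_lebesgue_integral_def)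
qed

text \<open>By the equation, \<open>N s t\<close> is a version of the stochastic integral over \<open>(s,t]\<close>.\<close>

definition N :: "real \<Rightarrow> real \<Rightarrow> 'w \<Rightarrow> real ^ 'd" where
  "N s t w = X t w - X s w + \<Lambda> *\<^sub>R G s t w"

text \<open>Subtracting the equation at \<open>s\<close> from that at \<open>t\<close> identifies
  \<open>N s t\<close> almost everywhere with \<open>\<sigma>\<close> times increments of the
  component integrals. The noise is diagonal: component \<open>i\<close> of \<open>N s t\<close>
  involves only the integral against component \<open>i\<close> of \<open>W\<close>, so the squared
  norm is a sum of one-dimensional terms without cross terms.\<close>

lemma N_martingale:
  assumes st: "0 \<le> s" "s \<le> t"
  shows "sq_integrable M (N s t)" "l2norm M (N s t) \<le> \<sigma> * l2norm P (Ycut s t)"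
    and "\<And>U. U \<in> borel_measurable (F s) \<Longrightarrow> sq_integrable M U \<Longrightarrow> (\<integral>w. U w \<bullet> N s t w \<partial>M) = 0"
proof -
  have t: "0 \<le> t" using st by simp
  from solution have "\<exists>J. \<forall>t\<ge>0.
        (\<forall>i. ito_integral M F (\<lambda>s w. W s w $ i) (\<lambda>s w. Y s w $ i) t (J i t)) \<and>
        (AE w in M. X t w = X 0 w - \<Lambda> *\<^sub>R G 0 t w + \<sigma> *\<^sub>R (\<Sum>i\<in>UNIV. J i t w *\<^sub>R axis i 1))"
    by (simp only: mean_field_solution_def Y_def[abs_def] xbar_def G_def)
  then obtain J where J: "\<And>t i. 0 \<le> t \<Longrightarrow> ito_integral M F (\<lambda>s w. W s w $ i) (\<lambda>s w. Y s w $ i) t (J i t)"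
    and X: "\<And>t. 0 \<le> t \<Longrightarrow> AE w in M. X t w = X 0 w - \<Lambda> *\<^sub>R G 0 t w + \<sigma> *\<^sub>R (\<Sum>i\<in>UNIV. J i t w *\<^sub>R axis i 1)"
    by blast
  define K where "K i w = J i t w - J i s w" for i w
  have Yi: "sq_integrable P (\<lambda>z. indicator {u..v} (snd z) * (Y (snd z) (fst z) $ i))" if "0 \<le> u" "u \<le> v" for u v i
  proof (rule sq_integrable_bound[OF Ycut_sq[OF that], of _ 1])
    have "(\<lambda>z. Ycut u v z \<bullet> axis i 1) \<in> borel_measurable P"
      using Ycut_measurable[OF that(1)] by measurable
    then show "(\<lambda>z. indicator {u..v} (snd z) * (Y (snd z) (fst z) $ i)) \<in> borel_measurable P"
      by (simp add: Ycut_def inner_axis)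
  qed (auto simp: Ycut_def indicator_def component_le_norm_cart)
  have K_sq: "sq_integrable M (K i)" for i
    unfolding K_def
    by (rule brownian_filtration.ito_increment_sq_integrable[OF component st J[OF t] J[OF st(1)] Yi[OF order_refl t]])
  let ?y = "\<lambda>i. l2norm P (\<lambda>z. indicator {s..t} (snd z) * (Y (snd z) (fst z) $ i))"
  have K_l2: "l2norm M (K i) \<le> ?y i" for i
    unfolding K_def
    by (rule brownian_filtration.ito_increment_l2norm[OF component st J[OF t] J[OF st(1)] Yi[OF order_refl t]])
  have K_orth: "(\<integral>w. U w * K i w \<partial>M) = 0" if "U \<in> borel_measurable (F s)" "sq_integrable M U" for U i
    unfolding K_def
    by (rule brownian_filtration.ito_increment_orthogonal[OF component st J[OF t] J[OF st(1)] Yi[OF order_refl t] that])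
  let ?K = "\<lambda>w. \<Sum>i\<in>UNIV. K i w *\<^sub>R axis i (1::real)"
  have Kcomp: "?K w $ i = K i w" for w i
    by (simp add: axis_def if_distrib cong: if_cong)
  have KN: "AE w in M. N s t w = \<sigma> *\<^sub>R ?K w"
    using X[OF t] X[OF st(1)] AE_space
  proof eventually_elim
    fix w assume 1: "X t w = X 0 w - \<Lambda> *\<^sub>R G 0 t w + \<sigma> *\<^sub>R (\<Sum>i\<in>UNIV. J i t w *\<^sub>R axis i 1)"
      and 2: "X s w = X 0 w - \<Lambda> *\<^sub>R G 0 s w + \<sigma> *\<^sub>R (\<Sum>i\<in>UNIV. J i s w *\<^sub>R axis i 1)"
      and "w \<in> space M"
    from G_combine[OF st this(3)] have "G s t w = G 0 t w - G 0 s w" by simp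
    then show "N s t w = \<sigma> *\<^sub>R ?K w"
      unfolding N_def 1 2 by (simp add: K_def scaleR_left_diff_distrib sum_subtractf scaleR_right_diff_distrib)
  qed
  show Nsq: "sq_integrable M (N s t)"
    unfolding N_def by (intro sq_integrable_add sq_integrable_diff sq_integrable_scaleR X_sq G_sq st t)
  have Nm: "N s t \<in> borel_measurable M" by (rule sq_integrable_measurable[OF Nsq])
  have Ki: "integrable M (\<lambda>w. (K i w)\<^sup>2)" for i using K_sq[of i] by (simp add: sq_integrable_def)
  have norm_sum: "(norm v)\<^sup>2 = (\<Sum>i\<in>UNIV. (v $ i)\<^sup>2)" for v :: "real ^ 'd"
    unfolding power2_norm_eq_inner inner_vec_def by (simp add: power2_eq_square)
  have Km: "?K \<in> borel_measurable M"
    using sq_integrable_measurable[OF K_sq] by measurable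
  have "(l2norm M (N s t))\<^sup>2 = (\<integral>w. (norm (\<sigma> *\<^sub>R ?K w))\<^sup>2 \<partial>M)"
    unfolding l2norm_sq
    by (rule integral_cong_AE) (use KN Nm Km in auto)
  also have "\<dots> = (\<integral>w. \<sigma>\<^sup>2 * (\<Sum>i\<in>UNIV. (K i w)\<^sup>2) \<partial>M)"
    by (simp only: norm_sum vector_scaleR_component Kcomp real_scaleR_def power_mult_distrib sum_distrib_left)
  also have "\<dots> = \<sigma>\<^sup>2 * (\<Sum>i\<in>UNIV. (l2norm M (K i))\<^sup>2)"
    using Ki by (simp add: l2norm_sq)
  also have "\<dots> \<le> \<sigma>\<^sup>2 * (\<Sum>i\<in>UNIV. (?y i)\<^sup>2)"
    by (intro mult_left_mono sum_mono power_mono K_l2) auto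
  also have "(\<Sum>i\<in>UNIV. (?y i)\<^sup>2)
      = (\<integral>z. (\<Sum>i\<in>UNIV. (norm (indicator {s..t} (snd z) * (Y (snd z) (fst z) $ i)))\<^sup>2) \<partial>P)"
    unfolding l2norm_sq using Yi[OF st]
    by (intro Bochner_Integration.integral_sum[symmetric]) (simp add: sq_integrable_def)
  also have "\<dots> = (l2norm P (Ycut s t))\<^sup>2"
    unfolding l2norm_sq by (simp only: norm_sum Ycut_def vector_scaleR_component real_scaleR_def real_norm_def power2_abs)
  finally have "(l2norm M (N s t))\<^sup>2 \<le> (\<sigma> * l2norm P (Ycut s t))\<^sup>2"
    by (simp add: power_mult_distrib)
  then show "l2norm M (N s t) \<le> \<sigma> * l2norm P (Ycut s t)"
    by (rule power2_le_imp_le) (use \<sigma>_pos in simp)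
  fix U :: "'w \<Rightarrow> real ^ 'd" assume U: "U \<in> borel_measurable (F s)" "sq_integrable M U"
  have Ui: "(\<lambda>w. U w $ i) \<in> borel_measurable (F s)" for i
    using measurable_compose[OF U(1) borel_measurable_continuous_onI[of "\<lambda>v. v $ i"]]
    by (simp add: continuous_on_component)
  have Um: "(\<lambda>w. U w $ i) \<in> borel_measurable M" for i
    using measurable_compose[OF sq_integrable_measurable[OF U(2)] borel_measurable_continuous_onI[of "\<lambda>v. v $ i"]]
    by (simp add: continuous_on_component)
  have Usq: "sq_integrable M (\<lambda>w. U w $ i)" for i
    by (rule sq_integrable_bound[OF U(2) Um, where C=1]) (simp add: component_le_norm_cart)
  have "(\<integral>w. U w \<bullet> N s t w \<partial>M) = (\<integral>w. U w \<bullet> (\<sigma> *\<^sub>R ?K w) \<partial>M)"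
    by (rule integral_cong_AE) (use KN Nm Km sq_integrable_measurable[OF U(2)] in auto)
  also have "\<dots> = (\<integral>w. \<sigma> * (\<Sum>i\<in>UNIV. U w $ i * K i w) \<partial>M)"
    by (simp only: inner_scaleR_right) (simp only: inner_vec_def Kcomp inner_real_def)
  also have "\<dots> = \<sigma> * (\<Sum>i\<in>UNIV. \<integral>w. U w $ i * K i w \<partial>M)"
    using integrable_mult_sq[OF Usq K_sq] by simp
  also have "\<dots> = 0" by (simp add: K_orth[OF Ui Usq])
  finally show "(\<integral>w. U w \<bullet> N s t w \<partial>M) = 0" .
qed

lemma X_increment_l2norm:
  assumes st: "0 \<le> s" "s \<le> t"
  shows "l2norm M (\<lambda>w. X t w - X s w) \<le> (\<sigma> + \<Lambda> * sqrt (t - s)) * l2norm P (Ycut s t)"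
proof -
  have "l2norm M (\<lambda>w. X t w - X s w) = l2norm M (\<lambda>w. N s t w - \<Lambda> *\<^sub>R G s t w)"
    by (simp add: N_def)
  also have "\<dots> \<le> l2norm M (N s t) + l2norm M (\<lambda>w. \<Lambda> *\<^sub>R G s t w)"
    by (intro l2norm_triangle_diff N_martingale sq_integrable_scaleR G_sq st)
  also have "\<dots> \<le> \<sigma> * l2norm P (Ycut s t) + \<Lambda> * (sqrt (t - s) * l2norm P (Ycut s t))"
    unfolding l2norm_scaleR using N_martingale(2)[OF st] G_sq(2)[OF st] \<Lambda>_pos by (intro add_mono mult_mono) auto
  finally show ?thesis by (simp add: algebra_simps)
qed

text \<open>Testing against a variable known at time \<open>s\<close> removes the noise and leaves
  the time-integrated drift. This takes the place of the first-order term of an Ito formula.\<close>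

lemma X_increment_inner:
  assumes st: "0 \<le> s" "s \<le> t" and U: "U \<in> borel_measurable (F s)" "sq_integrable M U"
  shows "(\<integral>w. U w \<bullet> (X t w - X s w) \<partial>M) = - \<Lambda> * (LINT r:{s..t}|lborel. \<integral>w. U w \<bullet> Y r w \<partial>M)"
proof -
  have "(\<integral>w. U w \<bullet> (X t w - X s w) \<partial>M) = (\<integral>w. U w \<bullet> N s t w - \<Lambda> * (U w \<bullet> G s t w) \<partial>M)"
    by (simp add: N_def inner_add_right)
  also have "\<dots> = (\<integral>w. U w \<bullet> N s t w \<partial>M) - \<Lambda> * (\<integral>w. U w \<bullet> G s t w \<partial>M)"
    using integrable_inner_sq(1)[OF U(2) N_martingale(1)[OF st]] integrable_inner_sq(1)[OF U(2) G_sq(1)[OF st]]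
    by simp
  finally show ?thesis by (simp add: N_martingale(3)[OF st U] G_inner[OF st U(2)])
qed

text \<open>An increment over a time \<open>h\<close> has L2 norm of order \<open>sqrt h\<close>,
  uniformly near \<open>s\<close>, because its noise and drift parts are both bounded by the norm of
  \<open>Ycut\<close>; the local bound \<open>A\<close> on \<open>a\<close> provides the
  constant.\<close>

lemma X_l2_continuous: "l2_continuous M X"
  unfolding l2_continuous_def
proof (intro conjI allI impI)
  show "sq_integrable M (X t)" if "t \<ge> 0" for t by (rule X_sq[OF that])
  fix s :: real assume s: "s \<ge> 0"
  obtain A where A: "A \<ge> 0" "\<And>t. t \<in> {0..s + 1} \<Longrightarrow> a t \<le> A"
    using a_bound[of "s + 1"] s by auto
  have inc: "l2norm M (\<lambda>w. X v w - X u w) \<le> (\<sigma> + \<Lambda> * sqrt (v - u)) * sqrt (A * (v - u))"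
    if uv: "0 \<le> u" "u \<le> v" "v \<le> s + 1" for u v
  proof -
    have "(l2norm P (Ycut u v))\<^sup>2 = (LINT r:{u..v}|lborel. a r)" by (rule Ycut_l2norm[OF uv(1,2)])
    also have "\<dots> \<le> (LINT r:{u..v}|lborel. A)"
      using A(2) uv by (intro set_integral_mono Ycut_l2norm) (auto simp: set_integrable_def)
    also have "\<dots> = A * (v - u)" using uv by (simp add: set_lebesgue_integral_def)
    finally have "l2norm P (Ycut u v) \<le> sqrt (A * (v - u))"
      by (simp add: real_le_rsqrt)
    then show ?thesis
      using X_increment_l2norm[OF uv(1,2)] \<sigma>_pos \<Lambda>_pos uv
      by (elim order_trans) (auto intro!: mult_left_mono)
  qed
  have sym: "l2norm M (\<lambda>w. X t w - X s w) = l2norm M (\<lambda>w. X s w - X t w)" for t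
    unfolding l2norm_def by (simp add: norm_minus_commute)
  have le: "l2norm M (\<lambda>w. X t w - X s w) \<le> (\<sigma> + \<Lambda> * sqrt \<bar>t - s\<bar>) * sqrt (A * \<bar>t - s\<bar>)"
    if "0 \<le> t" "\<bar>t - s\<bar> < 1" for t
  proof (cases "s \<le> t")
    case True
    then show ?thesis using inc[of s t] that s by auto
  next
    case False
    then show ?thesis using inc[of t s] that s by (simp add: sym[of t])
  qed
  have "((\<lambda>t. (\<sigma> + \<Lambda> * sqrt \<bar>t - s\<bar>) * sqrt (A * \<bar>t - s\<bar>)) \<longlongrightarrow>
      (\<sigma> + \<Lambda> * sqrt \<bar>s - s\<bar>) * sqrt (A * \<bar>s - s\<bar>)) (at s within {0..})"
    by (intro tendsto_intros)
  then have "((\<lambda>t. (\<sigma> + \<Lambda> * sqrt \<bar>t - s\<bar>) * sqrt (A * \<bar>t - s\<bar>)) \<longlongrightarrow> 0) (at s within {0..})"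
    by simp
  moreover have "\<forall>\<^sub>F t in at s within {0..}. norm (l2norm M (\<lambda>w. X t w - X s w)) \<le> (\<sigma> + \<Lambda> * sqrt \<bar>t - s\<bar>) * sqrt (A * \<bar>t - s\<bar>)"
    unfolding eventually_at using le by (intro exI[of _ 1]) (auto simp: dist_real_def)
  ultimately show "((\<lambda>t. l2norm M (\<lambda>w. X t w - X s w)) \<longlongrightarrow> 0) (at s within {0..})"
    by (rule Lim_null_comparison[rotated])
qed

lemma Y_l2_continuous: "l2_continuous M Y"
  unfolding Y_def[abs_def]
  by (intro l2_continuous_diff X_l2_continuous l2_continuous_deterministic xbar_continuous)

lemma D_l2_continuous: "l2_continuous M D"
  unfolding D_def[abs_def]
  by (intro l2_continuous_diff X_l2_continuous l2_continuous_deterministic mean_continuous)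

lemma a_continuous: "continuous_on {0..} a"
  using l2_continuous_inner[OF Y_l2_continuous Y_l2_continuous] by (simp add: a_def[abs_def] power2_norm_eq_inner)

lemma V_continuous: "continuous_on {0..} V"
  using l2_continuous_inner[OF D_l2_continuous D_l2_continuous] by (simp add: V_eq[abs_def] power2_norm_eq_inner)

lemma inner_Y_continuous:
  assumes "sq_integrable M U"
  shows "continuous_on {0..} (\<lambda>r. \<integral>w. U w \<bullet> Y r w \<partial>M)"
proof (rule l2_continuous_inner[OF _ Y_l2_continuous])
  show "l2_continuous M (\<lambda>t. U)" using assms by (simp add: l2_continuous_def l2norm_def)
qed

section \<open>Mean, consensus point and variance\<close>

lemma mean_Y: "0 \<le> t \<Longrightarrow> (\<integral>w. Y t w \<partial>M) = mean t - xbar t"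
  unfolding Y_def mean_def using X_integrable[of t] by (simp add: prob_space)

lemma mean_D: "0 \<le> t \<Longrightarrow> (\<integral>w. D t w \<partial>M) = 0"
  unfolding D_def mean_def using X_integrable[of t] by (simp add: prob_space)

lemma weighted_integrable:
  assumes t: "0 \<le> t" and U: "sq_integrable M U"
  shows "integrable M (\<lambda>w. weight (X t w) *\<^sub>R U w)"
proof (rule sq_integrable_imp_integrable, rule sq_integrable_bound[OF U, of _ wmax])
  show "(\<lambda>w. weight (X t w) *\<^sub>R U w) \<in> borel_measurable M"
    by (intro borel_measurable_scaleR weight_measurable sq_integrable_measurable[OF U] t)
  show "norm (weight (X t w) *\<^sub>R U w) \<le> wmax * norm (U w)" for w
    using weight_pos[of "X t w"] weight_le[of "X t w"] by (auto intro: mult_right_mono)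
qed

text \<open>The consensus point is the barycentre for the tilted density \<open>weight(X)/Z\<close>.\<close>

lemma weighted_mean_Y:
  assumes t: "0 \<le> t"
  shows "(\<integral>w. weight (X t w) *\<^sub>R Y t w \<partial>M) = 0"
proof -
  have "(\<integral>w. weight (X t w) *\<^sub>R Y t w \<partial>M) =
      (\<integral>w. weight (X t w) *\<^sub>R X t w \<partial>M) - (\<integral>w. weight (X t w) *\<^sub>R xbar t \<partial>M)"
    unfolding Y_def scaleR_right_diff_distrib
    by (intro Bochner_Integration.integral_diff weighted_integrable X_sq integrable_scaleR_left weight_integrable t)
  also have "(\<integral>w. weight (X t w) *\<^sub>R xbar t \<partial>M) = Z t *\<^sub>R xbar t"
    using weight_integrable[OF t] by (simp add: Z_eq)
  also have "\<dots> = (\<integral>w. weight (X t w) *\<^sub>R X t w \<partial>M)"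
    using Z_pos[OF t] by (simp add: xbar_eq)
  finally show ?thesis by simp
qed

lemma a_decomposition:
  assumes t: "0 \<le> t"
  shows "a t = V t + (norm (mean t - xbar t))\<^sup>2"
proof -
  have "(\<integral>w. D t w \<bullet> (mean t - xbar t) \<partial>M) = 0"
    using sq_integrable_imp_integrable[OF D_sq[OF t]] mean_D[OF t] by simp
  then show ?thesis
    using integral_norm_add_sq[OF D_sq[OF t] sq_integrable_const[of "mean t - xbar t"]]
    by (simp add: a_def V_eq Y_def D_def prob_space)
qed

text \<open>As \<open>Y\<close> has weighted mean zero, the mean of \<open>weight(X) D\<close> is
  \<open>Z\<close> times the vector from the mean to \<open>xbar\<close>. Cauchy-Schwarz for the
  measure with density \<open>weight(X)\<close> gives a factor \<open>Z\<close> for the total mass;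
  the weight is replaced by \<open>wmax\<close> in the other factor only.\<close>

lemma mean_xbar_distance:
  assumes t: "0 \<le> t"
  shows "(norm (mean t - xbar t))\<^sup>2 \<le> wmax / Z t * V t"
proof -
  let ?d = "xbar t - mean t"
  let ?s = "\<lambda>w. sqrt (weight (X t w))"
  have sm: "?s \<in> borel_measurable M" using weight_measurable[OF t] by measurable
  have s: "sq_integrable M ?s"
    by (rule sq_integrable_bounded[OF sm, of "sqrt wmax"])
       (use weight_pos weight_le in \<open>auto simp: less_imp_le\<close>)
  have sD: "sq_integrable M (\<lambda>w. ?s w *\<^sub>R D t w)"
    by (rule sq_integrable_bound[OF D_sq[OF t], of _ "sqrt wmax"])
       (use sm weight_pos weight_le sq_integrable_measurable[OF D_sq[OF t]] in \<open>auto simp: less_imp_le intro!: mult_right_mono\<close>)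
  have wD: "integrable M (\<lambda>w. weight (X t w) *\<^sub>R D t w)"
    by (intro weighted_integrable D_sq t)
  have "(\<integral>w. weight (X t w) *\<^sub>R D t w - weight (X t w) *\<^sub>R ?d \<partial>M) = 0"
    using weighted_mean_Y[OF t] by (simp add: Y_def D_def algebra_simps)
  then have "(\<integral>w. weight (X t w) *\<^sub>R D t w \<partial>M) = Z t *\<^sub>R ?d"
    using wD weight_integrable[OF t] by (simp add: Z_eq)
  then have "Z t * norm ?d = norm (\<integral>w. weight (X t w) *\<^sub>R D t w \<partial>M)"
    using Z_pos[OF t] by simp
  also have "\<dots> \<le> (\<integral>w. norm (weight (X t w) *\<^sub>R D t w) \<partial>M)" by (rule integral_norm_bound)
  also have "\<dots> = (\<integral>w. norm (?s w) * norm (norm (?s w *\<^sub>R D t w)) \<partial>M)"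
    using weight_pos by (intro Bochner_Integration.integral_cong)
      (auto simp: less_imp_le mult.assoc[symmetric])
  also have "\<dots> \<le> l2norm M ?s * l2norm M (\<lambda>w. norm (?s w *\<^sub>R D t w))"
    by (rule Cauchy_Schwarz_integral(1)[OF s sq_integrable_norm[OF sD]])
  finally have "(Z t * norm ?d)\<^sup>2 \<le> (l2norm M ?s * l2norm M (\<lambda>w. norm (?s w *\<^sub>R D t w)))\<^sup>2"
    using Z_pos[OF t] by (intro power_mono) auto
  also have "\<dots> = Z t * (\<integral>w. weight (X t w) * (norm (D t w))\<^sup>2 \<partial>M)"
    using weight_pos by (simp add: power_mult_distrib l2norm_sq Z_eq less_imp_le)
  also have "(\<integral>w. weight (X t w) * (norm (D t w))\<^sup>2 \<partial>M) \<le> (\<integral>w. wmax * (norm (D t w))\<^sup>2 \<partial>M)"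
  proof (rule integral_mono)
    show "integrable M (\<lambda>w. weight (X t w) * (norm (D t w))\<^sup>2)"
      using sD weight_pos by (simp add: sq_integrable_def power_mult_distrib less_imp_le)
    show "integrable M (\<lambda>w. wmax * (norm (D t w))\<^sup>2)"
      using D_sq[OF t] by (simp add: sq_integrable_def)
  qed (use weight_le in \<open>auto intro: mult_right_mono\<close>)
  also have "\<dots> = wmax * V t" by (simp add: V_eq)
  finally have "Z t * (Z t * (norm ?d)\<^sup>2) \<le> Z t * (wmax * V t)"
    using Z_pos[OF t] by (simp add: power_mult_distrib power2_eq_square ac_simps)
  then have "Z t * (norm ?d)\<^sup>2 \<le> wmax * V t" using Z_pos[OF t] by simp
  then show ?thesis using Z_pos[OF t] by (simp add: field_simps norm_minus_commute)
qed

end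

section \<open>Dini derivatives of variance and Laplace mean\<close>

text \<open>The upper right Dini derivative of \<open>f\<close> at \<open>s\<close> is at most \<open>g\<close>.\<close>

definition upper_dini :: "(real \<Rightarrow> real) \<Rightarrow> real \<Rightarrow> real \<Rightarrow> bool" where
  "upper_dini f s g \<longleftrightarrow> (\<exists>h. (\<forall>\<^sub>F t in at_right s. f t - f s \<le> h t * (t - s)) \<and> (h \<longlongrightarrow> g) (at_right s))"

lemma upper_dini_eventuallyI:
  assumes "\<forall>\<^sub>F t in at_right s. f t - f s \<le> h t * (t - s)" "(h \<longlongrightarrow> g) (at_right s)"
  shows "upper_dini f s g"
  unfolding upper_dini_def using assms by (intro exI[of _ h] conjI)

lemma upper_diniI:
  assumes "\<And>t. s < t \<Longrightarrow> f t - f s \<le> h t * (t - s)" "(h \<longlongrightarrow> g) (at_right s)"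
  shows "upper_dini f s g"
  by (rule upper_dini_eventuallyI[OF eventually_mono[OF eventually_at_right_less] assms(2)]) (rule assms(1))

lemma upper_dini_mono:
  assumes "upper_dini f s g" "g \<le> g'"
  shows "upper_dini f s g'"
proof -
  obtain h where h: "\<forall>\<^sub>F t in at_right s. f t - f s \<le> h t * (t - s)" "(h \<longlongrightarrow> g) (at_right s)"
    using assms(1) by (auto simp: upper_dini_def)
  have "\<forall>\<^sub>F t in at_right s. f t - f s \<le> (h t + (g' - g)) * (t - s)"
    using h(1) eventually_at_right_less
  proof eventually_elim
    case (elim t)
    have "0 \<le> (g' - g) * (t - s)" using elim assms(2) by simp
    with elim show ?case by (simp add: distrib_right)
  qed
  moreover have "((\<lambda>t. h t + (g' - g)) \<longlongrightarrow> g + (g' - g)) (at_right s)"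
    by (intro tendsto_intros h)
  ultimately have "upper_dini f s (g + (g' - g))" by (rule upper_dini_eventuallyI)
  then show ?thesis by simp
qed

text \<open>The function is tilted by a small slope \<open>\<delta>\<close>. At the last time where
  the tilted function is nonpositive, the Dini bound keeps it nonpositive a little longer, which
  contradicts the choice of that time.\<close>

lemma upper_dini_nonincreasing:
  assumes ab: "a \<le> b" and cont: "continuous_on {a..b} f"
    and dini: "\<And>s. a \<le> s \<Longrightarrow> s < b \<Longrightarrow> upper_dini f s 0"
  shows "f b \<le> f a"
proof -
  have "f b \<le> f a + \<epsilon>" if \<epsilon>: "\<epsilon> > 0" for \<epsilon>
  proof (rule ccontr)
    assume "\<not> f b \<le> f a + \<epsilon>"
    \<comment> \<open>The summand 1 covers \<open>a = b\<close>; what counts is that the tilt costs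
      at most \<open>\<epsilon>\<close> over the whole interval.\<close>
    define \<delta> where "\<delta> = \<epsilon> / (b - a + 1)"
    have \<delta>: "\<delta> > 0" using \<epsilon> ab by (simp add: \<delta>_def)
    have "\<delta> * (b - a) \<le> \<epsilon>" using \<epsilon> ab by (simp add: \<delta>_def field_simps)
    define g where "g t = f t - f a - \<delta> * (t - a)" for t
    have gb: "g b > 0" using \<open>\<not> f b \<le> f a + \<epsilon>\<close> \<open>\<delta> * (b - a) \<le> \<epsilon>\<close> by (simp add: g_def)
    have gc: "continuous_on {a..b} g" unfolding g_def by (intro continuous_intros cont)
    let ?S = "{t \<in> {a..b}. g t \<le> 0}"
    have "compact ({a..b} \<inter> g -` {..0})"
      unfolding compact_eq_bounded_closed
      by (intro conjI continuous_closed_preimage gc bounded_subset[OF bounded_closed_interval[of a b]]) auto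
    moreover have "{a..b} \<inter> g -` {..0} = ?S" by auto
    ultimately have "compact ?S" by simp
    moreover have "a \<in> ?S" using ab by (simp add: g_def)
    ultimately obtain s where s: "s \<in> ?S" and smax: "\<And>t. t \<in> ?S \<Longrightarrow> t \<le> s"
      using compact_attains_sup[of ?S] by blast
    have sb: "s < b" using s gb by (cases "s = b") auto
    obtain h where h: "\<forall>\<^sub>F t in at_right s. f t - f s \<le> h t * (t - s)" "(h \<longlongrightarrow> 0) (at_right s)"
      using dini[of s] s sb by (auto simp: upper_dini_def)
    have "\<forall>\<^sub>F t in at_right s. h t < \<delta>" using order_tendstoD(2)[OF h(2) \<delta>] .
    moreover have "\<forall>\<^sub>F t in at_right s. t < b" using sb by (rule eventually_at_right_real[THEN eventually_mono]) auto
    ultimately have "\<forall>\<^sub>F t in at_right s. False"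
      using h(1) eventually_at_right_less
    proof eventually_elim
      case (elim t)
      have "h t * (t - s) \<le> \<delta> * (t - s)" using elim by (intro mult_right_mono) auto
      then have "g t \<le> g s" using elim by (simp add: g_def algebra_simps)
      then have "t \<in> ?S" using s elim by auto
      then show False using smax[of t] elim by simp
    qed
    then show False by (simp add: eventually_False trivial_limit_at_right_real)
  qed
  then show ?thesis by (rule field_le_epsilon)
qed

lemma tendsto_difference_quotient:
  assumes "(p has_real_derivative p') (at s)"
  shows "((\<lambda>t. (p t - p s) / (t - s)) \<longlongrightarrow> p') (at_right s)"
  using has_field_derivative_at_within[OF assms, of "{s<..}"] by (simp add: has_field_derivative_iff)

lemma upper_dini_mult:
  assumes f: "upper_dini f s g" and p: "(p has_real_derivative p') (at s)" and pos: "\<And>t. p t > 0"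
  shows "upper_dini (\<lambda>t. p t * f t) s (p s * g + p' * f s)"
proof -
  obtain h where h: "\<forall>\<^sub>F t in at_right s. f t - f s \<le> h t * (t - s)" "(h \<longlongrightarrow> g) (at_right s)"
    using f by (auto simp: upper_dini_def)
  have pc: "(p \<longlongrightarrow> p s) (at_right s)"
    using DERIV_isCont[OF p] by (auto simp: isCont_def intro: tendsto_within_subset)
  have "\<forall>\<^sub>F t in at_right s. p t * f t - p s * f s \<le> (p t * h t + ((p t - p s) / (t - s)) * f s) * (t - s)"
    using h(1) eventually_at_right_less
  proof eventually_elim
    case (elim t)
    have "p t * (f t - f s) \<le> p t * (h t * (t - s))"
      using elim pos[of t] by (intro mult_left_mono) auto
    moreover have "((p t - p s) / (t - s)) * f s * (t - s) = (p t - p s) * f s" using elim by simp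
    ultimately show ?case by (simp add: algebra_simps)
  qed
  moreover have "((\<lambda>t. p t * h t + ((p t - p s) / (t - s)) * f s) \<longlongrightarrow> p s * g + p' * f s) (at_right s)"
    by (intro tendsto_intros h pc tendsto_difference_quotient p)
  ultimately show ?thesis by (rule upper_dini_eventuallyI)
qed

lemma upper_dini_add:
  assumes f: "upper_dini f s g" and q: "(q has_real_derivative q') (at s)"
  shows "upper_dini (\<lambda>t. f t + q t) s (g + q')"
proof -
  obtain h where h: "\<forall>\<^sub>F t in at_right s. f t - f s \<le> h t * (t - s)" "(h \<longlongrightarrow> g) (at_right s)"
    using f by (auto simp: upper_dini_def)
  have "\<forall>\<^sub>F t in at_right s. (f t + q t) - (f s + q s) \<le> (h t + (q t - q s) / (t - s)) * (t - s)"
    using h(1) eventually_at_right_less by eventually_elim (simp add: distrib_right)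
  moreover have "((\<lambda>t. h t + (q t - q s) / (t - s)) \<longlongrightarrow> g + q') (at_right s)"
    by (intro tendsto_intros h tendsto_difference_quotient q)
  ultimately show ?thesis by (rule upper_dini_eventuallyI)
qed

text \<open>The difference of squares has the factor \<open>f t + f s\<close>, which is positive
  close to \<open>s\<close> and tends to \<open>2 * f s\<close>.\<close>

lemma upper_dini_neg_square:
  assumes f: "upper_dini (\<lambda>t. - f t) s g" and cont: "(f \<longlongrightarrow> f s) (at_right s)" and pos: "f s > 0"
  shows "upper_dini (\<lambda>t. - (f t)\<^sup>2) s (2 * f s * g)"
proof -
  obtain h where h: "\<forall>\<^sub>F t in at_right s. - f t - - f s \<le> h t * (t - s)" "(h \<longlongrightarrow> g) (at_right s)"
    using f by (auto simp: upper_dini_def)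
  have "\<forall>\<^sub>F t in at_right s. f t > 0" using order_tendstoD(1)[OF cont pos] .
  then have "\<forall>\<^sub>F t in at_right s. - (f t)\<^sup>2 - - (f s)\<^sup>2 \<le> (h t * (f t + f s)) * (t - s)"
    using h(1)
  proof eventually_elim
    case (elim t)
    have "(- f t - - f s) * (f t + f s) \<le> (h t * (t - s)) * (f t + f s)"
      using elim pos by (intro mult_right_mono) auto
    then show ?case by (simp add: power2_eq_square algebra_simps)
  qed
  moreover have "((\<lambda>t. h t * (f t + f s)) \<longlongrightarrow> g * (f s + f s)) (at_right s)"
    by (intro tendsto_intros h cont)
  ultimately have "upper_dini (\<lambda>t. - (f t)\<^sup>2) s (g * (f s + f s))" by (rule upper_dini_eventuallyI)
  then show ?thesis by (simp add: mult_ac)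
qed

lemma integral_average_tendsto:
  fixes k :: "real \<Rightarrow> real"
  assumes k: "continuous_on {0..} k" and s: "0 \<le> s"
  shows "((\<lambda>t. (LINT r:{s..t}|lborel. k r) / (t - s)) \<longlongrightarrow> k s) (at_right s)"
proof -
  have eq: "(LINT r:{s..t}|lborel. k r) = integral {s..t} k" for t
    by (intro set_borel_integral_eq_integral borel_integrable_atLeastAtMost' continuous_on_subset[OF k]) (use s in auto)
  have "((\<lambda>t. integral {s..t} k) has_real_derivative k s) (at s within {s..s + 1})"
    by (intro integral_has_real_derivative continuous_on_subset[OF k]) (use s in auto)
  then show ?thesis
    by (simp add: has_field_derivative_iff eq at_within_Icc_at_right)
qed

context consensus_dynamics
begin

lemma c_nonneg: "0 \<le> c"
proof -
  let ?e = "axis undefined 1 :: real ^ 'd"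
  have "0 \<le> c * (?e \<bullet> ?e)" by (rule order_trans[OF abs_ge_zero hess])
  then show ?thesis by (simp add: inner_axis_axis)
qed

text \<open>An upper bound for the second moment of \<open>X t - X s\<close> divided by
  \<open>t - s\<close>, in the shape demanded by \<open>upper_diniI\<close>. The drift contributes
  only the vanishing term with \<open>sqrt (t - s)\<close>.\<close>

definition rate :: "real \<Rightarrow> real \<Rightarrow> real" where
  "rate s t = (LINT r:{s..t}|lborel. a r) / (t - s) * (\<sigma> + \<Lambda> * sqrt (t - s))\<^sup>2"

lemma increment_rate_tendsto:
  assumes s: "0 \<le> s"
  shows "(rate s \<longlongrightarrow> a s * \<sigma>\<^sup>2) (at_right s)"
proof -
  have "(rate s \<longlongrightarrow> a s * (\<sigma> + \<Lambda> * sqrt (s - s))\<^sup>2) (at_right s)"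
    unfolding rate_def by (intro tendsto_intros integral_average_tendsto a_continuous s)
  then show ?thesis by simp
qed

lemma increment_second_moment:
  assumes st: "0 \<le> s" "s < t"
  shows "(\<integral>w. (norm (X t w - X s w))\<^sup>2 \<partial>M) \<le> rate s t * (t - s)"
proof -
  have "(l2norm M (\<lambda>w. X t w - X s w))\<^sup>2 \<le> ((\<sigma> + \<Lambda> * sqrt (t - s)) * l2norm P (Ycut s t))\<^sup>2"
    by (intro power_mono X_increment_l2norm) (use st in auto)
  also have "\<dots> = (LINT r:{s..t}|lborel. a r) * (\<sigma> + \<Lambda> * sqrt (t - s))\<^sup>2"
    using Ycut_l2norm(1)[of s t] st by (simp add: power_mult_distrib)
  finally show ?thesis using st by (simp add: l2norm_sq rate_def)
qed

text \<open>Freezing the centre at \<open>mean s\<close> can only increase the second moment, so the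
  motion of the mean drops out. In the expansion around \<open>D s\<close> the cross term sees the
  drift alone, and the square of the increment contributes \<open>\<sigma>^2 a\<close>.\<close>

lemma V_upper_dini:
  assumes s: "0 \<le> s"
  shows "upper_dini V s (- 2 * \<Lambda> * V s + \<sigma>\<^sup>2 * a s)"
proof (rule upper_diniI)
  let ?k = "\<lambda>r. \<integral>w. D s w \<bullet> Y r w \<partial>M"
  let ?h = "\<lambda>t. - 2 * \<Lambda> * ((LINT r:{s..t}|lborel. ?k r) / (t - s)) + rate s t"
  \<comment> \<open>\<open>Y s\<close> and \<open>D s\<close> differ by a deterministic vector, and
    \<open>D s\<close> is centred.\<close>
  have "?k s = (\<integral>w. D s w \<bullet> D s w + D s w \<bullet> (mean s - xbar s) \<partial>M)"
    by (simp add: Y_def D_def inner_add_right[symmetric])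
  also have "\<dots> = (\<integral>w. D s w \<bullet> D s w \<partial>M) + (\<integral>w. D s w \<bullet> (mean s - xbar s) \<partial>M)"
    by (intro Bochner_Integration.integral_add integrable_inner_sq D_sq s sq_integrable_const)
  also have "\<dots> = V s"
    using sq_integrable_imp_integrable[OF D_sq[OF s]] mean_D[OF s] by (simp add: V_eq power2_norm_eq_inner)
  finally have ks: "?k s = V s" .
  have "((\<lambda>t. (LINT r:{s..t}|lborel. ?k r) / (t - s)) \<longlongrightarrow> V s) (at_right s)"
    using integral_average_tendsto[OF inner_Y_continuous[OF D_sq[OF s]] s] by (simp add: ks)
  from tendsto_add[OF tendsto_mult_left[OF this, of "- 2 * \<Lambda>"] increment_rate_tendsto[OF s]]
  show "(?h \<longlongrightarrow> - 2 * \<Lambda> * V s + \<sigma>\<^sup>2 * a s) (at_right s)"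
    by (simp add: mult.commute)
  fix t assume st: "s < t"
  then have t: "0 \<le> t" using s by simp
  have Dm: "D s \<in> borel_measurable (F s)"
    unfolding D_def using X_adapted[OF s] by measurable
  have "V t \<le> (\<integral>w. (norm (X t w - mean s))\<^sup>2 \<partial>M)"
  proof -
    have "(\<integral>w. D t w \<bullet> (mean t - mean s) \<partial>M) = 0"
      using sq_integrable_imp_integrable[OF D_sq[OF t]] mean_D[OF t] by simp
    then have "(\<integral>w. (norm (X t w - mean s))\<^sup>2 \<partial>M) = V t + (norm (mean t - mean s))\<^sup>2"
      using integral_norm_add_sq[OF D_sq[OF t] sq_integrable_const[of "mean t - mean s"]]
      by (simp add: V_eq D_def prob_space)
    then show ?thesis by simp
  qed
  also have "\<dots> = (\<integral>w. (norm (D s w + (X t w - X s w)))\<^sup>2 \<partial>M)"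
    by (simp add: D_def)
  also have "\<dots> = V s + 2 * (\<integral>w. D s w \<bullet> (X t w - X s w) \<partial>M) + (\<integral>w. (norm (X t w - X s w))\<^sup>2 \<partial>M)"
    unfolding V_eq by (intro integral_norm_add_sq D_sq sq_integrable_diff X_sq s t)
  also have "(\<integral>w. D s w \<bullet> (X t w - X s w) \<partial>M) = - \<Lambda> * (LINT r:{s..t}|lborel. ?k r)"
    by (intro X_increment_inner s less_imp_le[OF st] Dm D_sq)
  finally have "V t \<le> V s + 2 * (- \<Lambda> * (LINT r:{s..t}|lborel. ?k r)) + (\<integral>w. (norm (X t w - X s w))\<^sup>2 \<partial>M)" .
  moreover have "- 2 * \<Lambda> * ((LINT r:{s..t}|lborel. ?k r) / (t - s)) * (t - s) = 2 * (- \<Lambda> * (LINT r:{s..t}|lborel. ?k r))"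
    using st by simp
  ultimately show "V t - V s \<le> ?h t * (t - s)"
    unfolding distrib_right using increment_second_moment[OF s st] by linarith
qed

text \<open>The inequality \<open>exp (- u) \<ge> 1 - u\<close> turns the upper bound on
  \<open>L y\<close> into a lower bound on \<open>weight y\<close>. The nonnegative contribution
  quadratic in the gradient is discarded with it, so the coefficient involves \<open>c\<close> but
  no bound on \<open>grad L\<close>.\<close>

lemma weight_semiconvex:
  "weight x - \<beta> * ((weight x *\<^sub>R grad L x) \<bullet> (y - x)) - \<beta> * c / 2 * wmax * (norm (y - x))\<^sup>2 \<le> weight y"
proof -
  have "L y - L x \<le> grad L x \<bullet> (y - x) + c / 2 * (norm (y - x))\<^sup>2"
    using descent[OF C2 hess, of y x] by simp
  then have "\<beta> * (L y - L x) \<le> \<beta> * (grad L x \<bullet> (y - x) + c / 2 * (norm (y - x))\<^sup>2)"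
    using \<beta>_pos by (intro mult_left_mono) auto
  moreover have "1 + - (\<beta> * (L y - L x)) \<le> exp (- (\<beta> * (L y - L x)))"
    by (rule exp_ge_add_one_self)
  ultimately have "1 - \<beta> * (grad L x \<bullet> (y - x) + c / 2 * (norm (y - x))\<^sup>2) \<le> exp (- (\<beta> * (L y - L x)))"
    by linarith
  then have "weight x * (1 - \<beta> * (grad L x \<bullet> (y - x) + c / 2 * (norm (y - x))\<^sup>2)) \<le> weight x * exp (- (\<beta> * (L y - L x)))"
    using weight_pos[of x] by (intro mult_left_mono) auto
  also have "weight x * exp (- (\<beta> * (L y - L x))) = weight y"
    by (simp add: weight_def exp_add[symmetric] algebra_simps)
  also have "weight x * (1 - \<beta> * (grad L x \<bullet> (y - x) + c / 2 * (norm (y - x))\<^sup>2)) =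
     weight x - \<beta> * ((weight x *\<^sub>R grad L x) \<bullet> (y - x)) - weight x * (\<beta> * c / 2 * (norm (y - x))\<^sup>2)"
    by (simp add: algebra_simps)
  finally have "weight x - \<beta> * ((weight x *\<^sub>R grad L x) \<bullet> (y - x)) - weight x * (\<beta> * c / 2 * (norm (y - x))\<^sup>2) \<le> weight y" .
  moreover have "weight x * (\<beta> * c / 2 * (norm (y - x))\<^sup>2) \<le> wmax * (\<beta> * c / 2 * (norm (y - x))\<^sup>2)"
    using \<beta>_pos c_nonneg by (intro mult_right_mono weight_le) auto
  moreover have "wmax * (\<beta> * c / 2 * (norm (y - x))\<^sup>2) = \<beta> * c / 2 * wmax * (norm (y - x))\<^sup>2" by simp
  ultimately show ?thesis by linarith
qed

text \<open>The gradient grows at most like the square root of \<open>L - l\<close>, and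
  \<open>u exp (- 2 \<beta> u)\<close> is at most \<open>1 / (2 \<beta>)\<close>. Boundedness makes
  \<open>weight(X) grad L(X)\<close> an admissible test variable although \<open>grad L\<close>
  itself may be unbounded.\<close>

lemma weighted_grad_bound: "norm (weight x *\<^sub>R grad L x) \<le> wmax * sqrt ((c + 1) / \<beta>)"
proof (rule power2_le_imp_le)
  \<comment> \<open>\<open>c\<close> may be 0, whereas the gradient estimate divides by its
    constant; \<open>c + 1\<close> is positive.\<close>
  have b: "\<bar>v \<bullet> (hessian L x *v v)\<bar> \<le> (c + 1) * (v \<bullet> v)" for x v
    unfolding distrib_right using hess[of v x] inner_ge_zero[of v] by linarith
  have g: "(norm (grad L x))\<^sup>2 \<le> 2 * (c + 1) * (L x - l)"
    using c_nonneg by (intro grad_sq_le[OF C2 b _ lower]) auto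
  let ?u = "L x - l"
  have "2 * \<beta> * ?u \<le> exp (2 * \<beta> * ?u)"
    using exp_ge_add_one_self[of "2 * \<beta> * ?u"] by linarith
  then have "exp (- (2 * \<beta> * ?u)) * (2 * \<beta> * ?u) \<le> exp (- (2 * \<beta> * ?u)) * exp (2 * \<beta> * ?u)"
    by (intro mult_left_mono) auto
  then have u: "exp (- (2 * \<beta> * ?u)) * ?u \<le> 1 / (2 * \<beta>)"
    using \<beta>_pos by (simp add: exp_add[symmetric] field_simps)
  have "(weight x)\<^sup>2 = wmax\<^sup>2 * exp (- (2 * \<beta> * ?u))"
    by (simp add: weight_def wmax_def power2_eq_square exp_add[symmetric] algebra_simps)
  then have "(norm (weight x *\<^sub>R grad L x))\<^sup>2 = wmax\<^sup>2 * exp (- (2 * \<beta> * ?u)) * (norm (grad L x))\<^sup>2"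
    by (simp add: power_mult_distrib)
  also have "\<dots> \<le> wmax\<^sup>2 * exp (- (2 * \<beta> * ?u)) * (2 * (c + 1) * ?u)"
    by (intro mult_left_mono g) auto
  also have "\<dots> = wmax\<^sup>2 * (2 * (c + 1)) * (exp (- (2 * \<beta> * ?u)) * ?u)" by simp
  also have "\<dots> \<le> wmax\<^sup>2 * (2 * (c + 1)) * (1 / (2 * \<beta>))"
    using c_nonneg by (intro mult_left_mono u) auto
  also have "\<dots> = (wmax * sqrt ((c + 1) / \<beta>))\<^sup>2"
    using c_nonneg \<beta>_pos by (simp add: power_mult_distrib field_simps)
  finally show "(norm (weight x *\<^sub>R grad L x))\<^sup>2 \<le> (wmax * sqrt ((c + 1) / \<beta>))\<^sup>2" .
qed (use wmax_pos c_nonneg \<beta>_pos in simp)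

text \<open>Up to the factor \<open>- \<beta>\<close> this is the gradient of
  \<open>weight\<close>.\<close>

definition wgrad :: "real ^ 'd \<Rightarrow> real ^ 'd" where "wgrad x = weight x *\<^sub>R grad L x"

lemma wgrad_continuous: "continuous_on UNIV wgrad"
proof -
  have "continuous_on UNIV (grad L)"
    using C2 by (intro differentiable_imp_continuous_on)
      (simp add: twice_continuously_differentiable_def differentiable_on_def differentiable_at_withinI)
  then show ?thesis unfolding wgrad_def by (intro continuous_intros weight_continuous)
qed

lemma wgrad_adapted: "0 \<le> t \<Longrightarrow> (\<lambda>w. wgrad (X t w)) \<in> borel_measurable (F t)"
  by (rule measurable_compose[OF X_adapted borel_measurable_continuous_onI[OF wgrad_continuous]])

lemma wgrad_sq: "0 \<le> t \<Longrightarrow> sq_integrable M (\<lambda>w. wgrad (X t w))"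
  by (rule sq_integrable_bounded[OF measurable_compose[OF X_meas borel_measurable_continuous_onI[OF wgrad_continuous]],
      where C="wmax * sqrt ((c + 1) / \<beta>)"])
     (simp_all only: wgrad_def weighted_grad_bound)

text \<open>As \<open>Y\<close> has weighted mean zero, the constant vector
  \<open>grad L (xbar t)\<close> may be subtracted from the gradient. The Hessian bound then
  controls the difference of gradients and yields a quadratic instead of a linear expression in
  \<open>Y\<close>, which makes the drift term comparable to \<open>a\<close>.\<close>

lemma wgrad_inner_Y:
  assumes t: "0 \<le> t"
  shows "(\<integral>w. wgrad (X t w) \<bullet> Y t w \<partial>M) \<ge> - c * wmax * a t"
proof -
  have wY: "integrable M (\<lambda>w. weight (X t w) *\<^sub>R Y t w)"
    by (intro weighted_integrable Y_sq t)
  have int: "integrable M (\<lambda>w. wgrad (X t w) \<bullet> Y t w)"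
    by (intro integrable_inner_sq wgrad_sq Y_sq t)
  have "- c * wmax * a t = (\<integral>w. - c * wmax * (norm (Y t w))\<^sup>2 \<partial>M)" by (simp add: a_def)
  also have "\<dots> \<le> (\<integral>w. wgrad (X t w) \<bullet> Y t w - grad L (xbar t) \<bullet> (weight (X t w) *\<^sub>R Y t w) \<partial>M)"
  proof (rule integral_mono)
    show "integrable M (\<lambda>w. - c * wmax * (norm (Y t w))\<^sup>2)"
      using Y_sq[OF t] by (simp add: sq_integrable_def)
    show "integrable M (\<lambda>w. wgrad (X t w) \<bullet> Y t w - grad L (xbar t) \<bullet> (weight (X t w) *\<^sub>R Y t w))"
      by (intro Bochner_Integration.integrable_diff int integrable_inner_right impI wY)
    fix w
    have "weight (X t w) * (- c * (norm (Y t w))\<^sup>2) \<le> weight (X t w) * ((grad L (X t w) - grad L (xbar t)) \<bullet> Y t w)"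
      unfolding Y_def using weight_pos by (intro mult_left_mono grad_one_sided[OF C2 hess]) (simp add: less_imp_le)
    moreover have "weight (X t w) * (c * (norm (Y t w))\<^sup>2) \<le> wmax * (c * (norm (Y t w))\<^sup>2)"
      using c_nonneg by (intro mult_right_mono weight_le) auto
    ultimately show "- c * wmax * (norm (Y t w))\<^sup>2 \<le> wgrad (X t w) \<bullet> Y t w - grad L (xbar t) \<bullet> (weight (X t w) *\<^sub>R Y t w)"
      by (simp add: wgrad_def algebra_simps inner_diff_left)
  qed
  also have "\<dots> = (\<integral>w. wgrad (X t w) \<bullet> Y t w \<partial>M) - grad L (xbar t) \<bullet> (\<integral>w. weight (X t w) *\<^sub>R Y t w \<partial>M)"
    using int wY by (simp only: Bochner_Integration.integral_diff integrable_inner_right integral_inner_right)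
  finally show ?thesis by (simp add: weighted_mean_Y[OF t])
qed

text \<open>Semiconvexity with base point \<open>X s\<close> is evaluated at \<open>X t\<close> and
  integrated. The drift contributes \<open>\<beta> c wmax \<Lambda> a\<close> through
  \<open>wgrad_inner_Y\<close>, the noise \<open>\<beta> c wmax \<sigma>^2 a / 2\<close> through
  \<open>rate\<close>.\<close>

lemma neg_Z_upper_dini:
  assumes s: "0 \<le> s"
  shows "upper_dini (\<lambda>t. - Z t) s (\<beta> * c * wmax * (2 * \<Lambda> + \<sigma>\<^sup>2) / 2 * a s)"
proof -
  let ?U = "\<lambda>w. wgrad (X s w)"
  let ?k = "\<lambda>r. \<integral>w. ?U w \<bullet> Y r w \<partial>M"
  let ?h = "\<lambda>t. - \<beta> * \<Lambda> * ((LINT r:{s..t}|lborel. ?k r) / (t - s)) +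
     \<beta> * c / 2 * wmax * rate s t"
  have "upper_dini (\<lambda>t. - Z t) s (- \<beta> * \<Lambda> * ?k s + \<beta> * c / 2 * wmax * (a s * \<sigma>\<^sup>2))"
  proof (rule upper_diniI)
    show "(?h \<longlongrightarrow> - \<beta> * \<Lambda> * ?k s + \<beta> * c / 2 * wmax * (a s * \<sigma>\<^sup>2)) (at_right s)"
      by (intro tendsto_add tendsto_mult_left increment_rate_tendsto integral_average_tendsto
          inner_Y_continuous wgrad_sq s)
    fix t assume st: "s < t"
    then have t: "0 \<le> t" using s by simp
    let ?d = "\<lambda>w. X t w - X s w"
    have d: "sq_integrable M ?d" by (intro sq_integrable_diff X_sq s t)
    have i1: "integrable M (\<lambda>w. ?U w \<bullet> ?d w)" by (intro integrable_inner_sq wgrad_sq d s)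
    have i2: "integrable M (\<lambda>w. (norm (?d w))\<^sup>2)" using d by (simp add: sq_integrable_def)
    have "Z s - \<beta> * (\<integral>w. ?U w \<bullet> ?d w \<partial>M) - \<beta> * c / 2 * wmax * (\<integral>w. (norm (?d w))\<^sup>2 \<partial>M) =
       (\<integral>w. weight (X s w) - \<beta> * (?U w \<bullet> ?d w) - \<beta> * c / 2 * wmax * (norm (?d w))\<^sup>2 \<partial>M)"
      using i1 i2 weight_integrable[OF s] by (simp add: Z_eq)
    also have "\<dots> \<le> Z t"
      unfolding Z_eq using i1 i2 weight_integrable[OF s] weight_integrable[OF t] weight_semiconvex
      by (intro integral_mono) (auto simp: wgrad_def)
    finally have "Z s - Z t \<le> \<beta> * (\<integral>w. ?U w \<bullet> ?d w \<partial>M) + \<beta> * c / 2 * wmax * (\<integral>w. (norm (?d w))\<^sup>2 \<partial>M)" by simp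
    also have "(\<integral>w. ?U w \<bullet> ?d w \<partial>M) = - \<Lambda> * (LINT r:{s..t}|lborel. ?k r)"
      by (intro X_increment_inner s less_imp_le[OF st] wgrad_adapted wgrad_sq)
    also have "\<beta> * c / 2 * wmax * (\<integral>w. (norm (?d w))\<^sup>2 \<partial>M) \<le>
        \<beta> * c / 2 * wmax * (rate s t * (t - s))"
      using \<beta>_pos c_nonneg wmax_pos by (intro mult_left_mono increment_second_moment s st) auto
    finally have "Z s - Z t \<le> \<beta> * (- \<Lambda> * (LINT r:{s..t}|lborel. ?k r)) +
        \<beta> * c / 2 * wmax * (rate s t * (t - s))" by simp
    moreover have "- \<beta> * \<Lambda> * ((LINT r:{s..t}|lborel. ?k r) / (t - s)) * (t - s) = \<beta> * (- \<Lambda> * (LINT r:{s..t}|lborel. ?k r))"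
      using st by simp
    ultimately show "- Z t - - Z s \<le> ?h t * (t - s)"
      unfolding distrib_right mult.assoc[symmetric, of _ _ "t - s"] by (simp only: mult.assoc)
  qed
  moreover have "- \<beta> * \<Lambda> * ?k s + \<beta> * c / 2 * wmax * (a s * \<sigma>\<^sup>2) \<le> \<beta> * c * wmax * (2 * \<Lambda> + \<sigma>\<^sup>2) / 2 * a s"
  proof -
    have "\<beta> * \<Lambda> * (- c * wmax * a s) \<le> \<beta> * \<Lambda> * ?k s"
      using \<beta>_pos \<Lambda>_pos by (intro mult_left_mono wgrad_inner_Y s) auto
    then show ?thesis by (simp add: field_simps)
  qed
  ultimately show ?thesis by (rule upper_dini_mono)
qed

end

section \<open>Contraction and consensus\<close>

lemma tends_exponentiallyI:
  fixes q :: "real \<Rightarrow> 'a::real_normed_vector"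
  assumes "\<kappa> > 0" "\<And>t. 0 \<le> t \<Longrightarrow> norm (q t - q0) \<le> C * exp (- \<kappa> * t)"
  shows "tends_exponentially q q0"
proof -
  \<comment> \<open>\<open>tends_exponentially\<close> asks for a strictly positive constant, hence
    the summand 1.\<close>
  have "norm (q t - q0) \<le> (\<bar>C\<bar> + 1) * exp (- \<kappa> * t)" if "0 \<le> t" for t
    by (rule order_trans[OF assms(2)[OF that]]) (auto intro!: mult_right_mono)
  moreover have "\<bar>C\<bar> + 1 > 0" by simp
  ultimately show ?thesis unfolding tends_exponentially_def using assms(1) by blast
qed

context consensus_dynamics
begin

lemma V_nonneg: "0 \<le> V t"
  by (simp add: V_eq)

lemma a_le: "0 \<le> t \<Longrightarrow> a t \<le> V t * (1 + wmax / Z t)"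
  using a_decomposition[of t] mean_xbar_distance[of t] by (simp add: distrib_left mult.commute)

text \<open>Weaker than \<open>a_le\<close>, but homogeneous in \<open>1 / Z\<close>: multiplied by
  \<open>Z\<close>, as happens for the derivative of \<open>Z^2\<close>, it leaves a bound in terms
  of \<open>V\<close> alone.\<close>

lemma a_le_double:
  assumes t: "0 \<le> t"
  shows "a t \<le> 2 * (wmax / Z t) * V t"
proof -
  have "1 \<le> wmax / Z t" using Z_pos[OF t] Z_le[OF t] by simp
  then have "V t * (1 + wmax / Z t) \<le> V t * (2 * (wmax / Z t))"
    using V_nonneg by (intro mult_left_mono) auto
  then show ?thesis using a_le[OF t] by (simp add: mult_ac)
qed

end

text \<open>\<open>\<mu>\<close> is the decay rate of \<open>V\<close> while \<open>Z\<close> is at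
  least \<open>Z 0 / 2\<close>: there \<open>1 + wmax / Z\<close> is at most
  \<open>1 + 2 wmax / Z 0\<close>. With \<open>V\<close> decaying at this rate,
  \<open>\<nu> (Z 0)^2\<close> bounds the total loss of \<open>Z^2\<close> over all times.\<close>

locale contracting_consensus = consensus_dynamics +
  fixes \<mu> \<nu> :: real
  assumes \<mu>_eq: "\<mu> = 2 * \<Lambda> - \<sigma>\<^sup>2 - 2 * \<sigma>\<^sup>2 * (wmax / Z 0)" and \<mu>_pos: "\<mu> > 0"
    and \<nu>_eq: "\<nu> = 2 * V 0 / (\<mu> * (Z 0)\<^sup>2) * \<beta> * wmax\<^sup>2 * c * (2 * \<Lambda> + \<sigma>\<^sup>2)"
    and \<nu>_le: "\<nu> \<le> 3 / 4"
begin

lemma Z0_pos: "0 < Z 0"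
  by (rule Z_pos) simp

lemma \<nu>_nonneg: "0 \<le> \<nu>"
  unfolding \<nu>_eq using \<mu>_pos \<beta>_pos c_nonneg V_nonneg[of 0] \<Lambda>_pos by (intro mult_nonneg_nonneg divide_nonneg_nonneg) auto

lemma V_decay:
  assumes T: "0 \<le> T" and half: "\<And>s. s \<in> {0..T} \<Longrightarrow> Z 0 / 2 \<le> Z s"
  shows "V T \<le> V 0 * exp (- \<mu> * T)"
proof -
  have "exp (\<mu> * T) * V T \<le> exp (\<mu> * 0) * V 0"
  proof (rule upper_dini_nonincreasing[OF T])
    show "continuous_on {0..T} (\<lambda>t. exp (\<mu> * t) * V t)"
      by (intro continuous_intros continuous_on_subset[OF V_continuous]) auto
    fix s assume s: "0 \<le> s" "s < T"
    have "wmax / Z s \<le> wmax / (Z 0 / 2)"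
      using half[of s] s Z0_pos wmax_pos by (intro divide_left_mono mult_pos_pos Z_pos) auto
    then have "V s * (1 + wmax / Z s) \<le> V s * (1 + 2 * (wmax / Z 0))"
      using V_nonneg by (intro mult_left_mono) (auto simp: mult.commute)
    then have "a s \<le> V s * (1 + 2 * (wmax / Z 0))" using a_le[OF s(1)] by linarith
    then have "\<sigma>\<^sup>2 * a s \<le> \<sigma>\<^sup>2 * (V s * (1 + 2 * (wmax / Z 0)))" by (intro mult_left_mono) auto
    then have "- 2 * \<Lambda> * V s + \<sigma>\<^sup>2 * a s \<le> - \<mu> * V s"
      unfolding \<mu>_eq by (simp add: algebra_simps)
    then have "upper_dini V s (- \<mu> * V s)"
      by (rule upper_dini_mono[OF V_upper_dini[OF s(1)]])
    then have "upper_dini (\<lambda>t. exp (\<mu> * t) * V t) s (exp (\<mu> * s) * (- \<mu> * V s) + (exp (\<mu> * s) * \<mu>) * V s)"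
      by (rule upper_dini_mult) (auto intro!: derivative_eq_intros)
    then show "upper_dini (\<lambda>t. exp (\<mu> * t) * V t) s 0" by (simp add: mult_ac)
  qed
  then have "exp (- (\<mu> * T)) * (exp (\<mu> * T) * V T) \<le> exp (- (\<mu> * T)) * V 0"
    by (intro mult_left_mono) auto
  moreover have "exp (- (\<mu> * T)) * (exp (\<mu> * T) * V T) = V T"
    by (simp add: exp_minus)
  ultimately have "V T \<le> exp (- (\<mu> * T)) * V 0" by (simp only:)
  then show ?thesis by (simp add: mult.commute)
qed

lemma Z_square_lower:
  assumes T: "0 \<le> T" and half: "\<And>s. s \<in> {0..T} \<Longrightarrow> Z 0 / 2 \<le> Z s"
  shows "(Z 0)\<^sup>2 * (1 - \<nu> * (1 - exp (- \<mu> * T))) \<le> (Z T)\<^sup>2"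
proof -
  define \<kappa> where "\<kappa> = \<beta> * c * wmax * (2 * \<Lambda> + \<sigma>\<^sup>2)"
  have \<kappa>: "0 \<le> \<kappa>" using \<beta>_pos c_nonneg wmax_pos \<Lambda>_pos by (simp add: \<kappa>_def)
  \<comment> \<open>An antiderivative of minus the Dini bound for \<open>- Z^2\<close>: adding it
    reduces integration to monotonicity. Its value at time 0 is
    \<open>\<nu> (Z 0)^2\<close>.\<close>
  define q where "q t = (2 * \<kappa> * wmax * V 0 / \<mu>) * exp (- \<mu> * t)" for t
  have \<nu>Z: "2 * \<kappa> * wmax * V 0 / \<mu> = \<nu> * (Z 0)\<^sup>2"
    using Z0_pos by (simp add: \<nu>_eq \<kappa>_def power2_eq_square)
  have "- (Z T)\<^sup>2 + q T \<le> - (Z 0)\<^sup>2 + q 0"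
  proof (rule upper_dini_nonincreasing[OF T])
    show "continuous_on {0..T} (\<lambda>t. - (Z t)\<^sup>2 + q t)"
      unfolding q_def by (intro continuous_intros continuous_on_subset[OF Z_continuous]) auto
    fix s assume s: "0 \<le> s" "s < T"
    have "(Z \<longlongrightarrow> Z s) (at s within {0..})"
      using Z_continuous s by (simp add: continuous_on_def)
    then have Zc: "(Z \<longlongrightarrow> Z s) (at_right s)"
      by (rule tendsto_within_subset) (use s in auto)
    have "upper_dini (\<lambda>t. - Z t) s (\<kappa> / 2 * a s)"
      using neg_Z_upper_dini[OF s(1)] by (simp add: \<kappa>_def)
    from upper_dini_neg_square[OF this Zc Z_pos[OF s(1)]]
    have "upper_dini (\<lambda>t. - (Z t)\<^sup>2) s (2 * Z s * (\<kappa> / 2 * a s))" .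
    moreover have "2 * Z s * (\<kappa> / 2 * a s) \<le> 2 * \<kappa> * wmax * (V 0 * exp (- \<mu> * s))"
    proof -
      have "2 * Z s * (\<kappa> / 2 * a s) = Z s * \<kappa> * a s" by simp
      also have "\<dots> \<le> Z s * \<kappa> * (2 * (wmax / Z s) * V s)"
        using Z_pos[OF s(1)] \<kappa> by (intro mult_left_mono a_le_double s) auto
      also have "\<dots> = 2 * \<kappa> * wmax * V s" using Z_pos[OF s(1)] by simp
      also have "\<dots> \<le> 2 * \<kappa> * wmax * (V 0 * exp (- \<mu> * s))"
        using \<kappa> wmax_pos half s by (intro mult_left_mono V_decay) auto
      finally show ?thesis .
    qed
    ultimately have "upper_dini (\<lambda>t. - (Z t)\<^sup>2) s (2 * \<kappa> * wmax * (V 0 * exp (- \<mu> * s)))"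
      by (rule upper_dini_mono)
    moreover have "(q has_real_derivative - (2 * \<kappa> * wmax * (V 0 * exp (- \<mu> * s)))) (at s)"
      unfolding q_def using \<mu>_pos by (auto intro!: derivative_eq_intros)
    ultimately have "upper_dini (\<lambda>t. - (Z t)\<^sup>2 + q t) s
        (2 * \<kappa> * wmax * (V 0 * exp (- \<mu> * s)) + - (2 * \<kappa> * wmax * (V 0 * exp (- \<mu> * s))))"
      by (rule upper_dini_add)
    then show "upper_dini (\<lambda>t. - (Z t)\<^sup>2 + q t) s 0" by simp
  qed
  then show ?thesis unfolding q_def \<nu>Z by (simp add: algebra_simps)
qed

text \<open>Continuity argument: at the first time with \<open>Z = Z(0)/2\<close> the previous bound would give
  \<open>Z\<^sup>2 > Z(0)\<^sup>2/4\<close>, because \<open>\<nu> \<le> 3/4\<close>.\<close>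

lemma Z_gt_half:
  assumes "0 \<le> t"
  shows "Z 0 / 2 < Z t"
proof (rule ccontr)
  assume "\<not> Z 0 / 2 < Z t"
  then have Zt: "Z t \<le> Z 0 / 2" by simp
  have cont: "continuous_on {0..u} Z" for u by (rule continuous_on_subset[OF Z_continuous]) auto
  let ?S = "{0..t} \<inter> Z -` {..Z 0 / 2}"
  have "compact ?S"
    unfolding compact_eq_bounded_closed
    by (intro conjI continuous_closed_preimage cont bounded_subset[OF bounded_closed_interval[of 0 t]]) auto
  moreover have "t \<in> ?S" using Zt assms by simp
  ultimately obtain s where s: "s \<in> ?S" and smin: "\<And>u. u \<in> ?S \<Longrightarrow> s \<le> u"
    using compact_attains_inf[of ?S] by blast
  \<comment> \<open>Membership in \<open>?S\<close> yields only \<open>Z s \<le> Z 0 / 2\<close>. A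
    point \<open>x \<le> s\<close> with equality belongs to \<open>?S\<close> too, so minimality
    forces \<open>x = s\<close>.\<close>
  have "\<exists>x\<ge>0. x \<le> s \<and> Z x = Z 0 / 2"
    using s Z0_pos by (intro IVT2' cont) auto
  then obtain x where x: "0 \<le> x" "x \<le> s" "Z x = Z 0 / 2" by blast
  have "s \<le> x" using x s by (intro smin) auto
  with x have Zs: "Z s = Z 0 / 2" by simp
  have "Z 0 / 2 \<le> Z u" if u: "u \<in> {0..s}" for u
  proof (cases "u = s")
    case False
    then have "u \<notin> ?S" using smin[of u] u by auto
    then show ?thesis using u s by auto
  qed (simp add: Zs)
  then have "(Z 0)\<^sup>2 * (1 - \<nu> * (1 - exp (- \<mu> * s))) \<le> (Z s)\<^sup>2"
    using s by (intro Z_square_lower) auto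
  also have "(Z s)\<^sup>2 = (Z 0)\<^sup>2 * (1 / 4)" by (simp add: Zs power_divide)
  finally have "1 - \<nu> * (1 - exp (- \<mu> * s)) \<le> 1 / 4" using Z0_pos by simp
  \<comment> \<open>The strict positivity of \<open>exp (- \<mu> * s)\<close> produces the
    contradiction, so the borderline value \<open>\<nu> = 3 / 4\<close> is allowed.\<close>
  moreover have "\<nu> * (1 - exp (- \<mu> * s)) \<le> 3 / 4 * (1 - exp (- \<mu> * s))"
    using \<mu>_pos s by (intro mult_right_mono \<nu>_le) auto
  moreover have "exp (- \<mu> * s) > 0" by simp
  ultimately show False by argo
qed

lemma V_bound: "0 \<le> t \<Longrightarrow> V t \<le> V 0 * exp (- \<mu> * t)"
  using Z_gt_half by (intro V_decay) (auto simp: less_imp_le)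

lemma Z_bound:
  assumes t: "0 \<le> t"
  shows "Z 0 * sqrt (1 - \<nu>) \<le> Z t"
proof (rule power2_le_imp_le)
  have "(Z 0 * sqrt (1 - \<nu>))\<^sup>2 = (Z 0)\<^sup>2 * (1 - \<nu>)"
    using \<nu>_le by (simp add: power_mult_distrib)
  also have "\<dots> \<le> (Z 0)\<^sup>2 * (1 - \<nu> * (1 - exp (- \<mu> * t)))"
    using \<nu>_nonneg by (intro mult_left_mono) (auto simp: algebra_simps)
  also have "\<dots> \<le> (Z t)\<^sup>2"
    using t Z_gt_half by (intro Z_square_lower) (auto simp: less_imp_le)
  finally show "(Z 0 * sqrt (1 - \<nu>))\<^sup>2 \<le> (Z t)\<^sup>2" .
qed (use Z_pos[OF t] in simp)

section \<open>Convergence of the mean and of the consensus point\<close>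

lemma exp_decay: "(\<lambda>n. exp (- (\<mu> / 2) * real n)) \<longlonglongrightarrow> 0"
proof -
  have "filterlim (\<lambda>n. (\<mu> / 2) * real n) at_top sequentially"
    using \<mu>_pos by (intro filterlim_tendsto_pos_mult_at_top[OF tendsto_const] filterlim_real_sequentially) auto
  then show ?thesis
    by (intro filterlim_compose[OF exp_at_bot]) (simp add: filterlim_uminus_at_bot)
qed

lemma mean_xbar_decay:
  assumes t: "0 \<le> t"
  shows "norm (mean t - xbar t) \<le> sqrt (2 * (wmax / Z 0) * V 0) * exp (- (\<mu> / 2) * t)"
proof (rule power2_le_imp_le)
  have "(norm (mean t - xbar t))\<^sup>2 \<le> wmax / Z t * V t" by (rule mean_xbar_distance[OF t])
  also have "\<dots> \<le> (2 * (wmax / Z 0)) * (V 0 * exp (- \<mu> * t))"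
  proof (rule mult_mono)
    have "wmax / Z t \<le> wmax / (Z 0 / 2)"
      using Z_gt_half[OF t] Z0_pos wmax_pos Z_pos[OF t] by (intro divide_left_mono) auto
    then show "wmax / Z t \<le> 2 * (wmax / Z 0)" by (simp add: mult.commute)
  qed (use V_bound[OF t] V_nonneg wmax_pos Z0_pos in auto)
  also have "\<dots> = (sqrt (2 * (wmax / Z 0) * V 0) * exp (- (\<mu> / 2) * t))\<^sup>2"
    using V_nonneg[of 0] wmax_pos Z0_pos by (simp add: power_mult_distrib exp_double[symmetric])
  finally show "(norm (mean t - xbar t))\<^sup>2 \<le> (sqrt (2 * (wmax / Z 0) * V 0) * exp (- (\<mu> / 2) * t))\<^sup>2" .
qed (use V_nonneg[of 0] wmax_pos Z0_pos in simp)

text \<open>Testing the equation with the constant vector \<open>mean t - mean s\<close> removes the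
  noise. The speed of the mean is \<open>\<Lambda>\<close> times its distance from
  \<open>xbar\<close>, whose exponential bound is integrated from \<open>s\<close> on.\<close>

lemma mean_increment:
  assumes st: "0 \<le> s" "s \<le> t"
  shows "norm (mean t - mean s) \<le> 2 * \<Lambda> * sqrt (2 * (wmax / Z 0) * V 0) / \<mu> * exp (- (\<mu> / 2) * s)"
\<comment> \<open>The last step of the main case divides by the norm of the increment.\<close>
proof (cases "mean t = mean s")
  case True
  then show ?thesis using \<Lambda>_pos \<mu>_pos V_nonneg[of 0] wmax_pos Z0_pos by simp
next
  case False
  let ?K = "sqrt (2 * (wmax / Z 0) * V 0)"
  let ?v = "mean t - mean s"
  have t: "0 \<le> t" using st by simp
  have K: "0 \<le> ?K" using V_nonneg[of 0] wmax_pos Z0_pos by simp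
  have vY: "(\<integral>w. ?v \<bullet> Y r w \<partial>M) = ?v \<bullet> (mean r - xbar r)" if "0 \<le> r" for r
    using sq_integrable_imp_integrable[OF Y_sq[OF that]] mean_Y[OF that] by simp
  have "?v \<bullet> ?v = (\<integral>w. ?v \<bullet> (X t w - X s w) \<partial>M)"
    using X_integrable[OF t] X_integrable[OF st(1)] by (simp add: mean_def)
  also have "\<dots> = - \<Lambda> * (LINT r:{s..t}|lborel. \<integral>w. ?v \<bullet> Y r w \<partial>M)"
    by (intro X_increment_inner st sq_integrable_const) simp
  also have "(LINT r:{s..t}|lborel. \<integral>w. ?v \<bullet> Y r w \<partial>M) = (LINT r:{s..t}|lborel. ?v \<bullet> (mean r - xbar r))"
    using st vY by (intro set_lebesgue_integral_cong) auto
  finally have 1: "?v \<bullet> ?v = \<Lambda> * (LINT r:{s..t}|lborel. - (?v \<bullet> (mean r - xbar r)))"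
    by (simp add: set_lebesgue_integral_def)
  let ?f = "\<lambda>r. norm ?v * (?K * exp (- (\<mu> / 2) * r))"
  have "(LINT r:{s..t}|lborel. - (?v \<bullet> (mean r - xbar r))) \<le> (LINT r:{s..t}|lborel. ?f r)"
  proof (rule set_integral_mono)
    show "set_integrable lborel {s..t} (\<lambda>r. - (?v \<bullet> (mean r - xbar r)))"
      by (intro borel_integrable_atLeastAtMost' continuous_intros continuous_on_subset[OF mean_continuous]
           continuous_on_subset[OF xbar_continuous]) (use st in auto)
    show "set_integrable lborel {s..t} ?f"
      by (intro borel_integrable_atLeastAtMost' continuous_intros)
    fix r assume r: "r \<in> {s..t}"
    have "- (?v \<bullet> (mean r - xbar r)) \<le> norm ?v * norm (mean r - xbar r)"
      using Cauchy_Schwarz_ineq2[of ?v "mean r - xbar r"] by linarith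
    also have "\<dots> \<le> ?f r" using r st by (intro mult_left_mono mean_xbar_decay) auto
    finally show "- (?v \<bullet> (mean r - xbar r)) \<le> ?f r" .
  qed
  also have "(LINT r:{s..t}|lborel. ?f r) = norm ?v * ?K * (2 / \<mu>) * (exp (- (\<mu> / 2) * s) - exp (- (\<mu> / 2) * t))"
  proof -
    let ?F = "\<lambda>r. - (norm ?v * ?K * (2 / \<mu>)) * exp (- (\<mu> / 2) * r)"
    have "(LINT r:{s..t}|lborel. ?f r) = integral {s..t} ?f"
      by (intro set_borel_integral_eq_integral borel_integrable_atLeastAtMost' continuous_intros)
    also have "(?f has_integral (?F t - ?F s)) {s..t}"
      using \<mu>_pos st(2) by (intro fundamental_theorem_of_calculus)
        (auto intro!: derivative_eq_intros simp flip: has_real_derivative_iff_has_vector_derivative)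
    then have "integral {s..t} ?f = ?F t - ?F s" by (rule integral_unique)
    also have "?F t - ?F s = norm ?v * ?K * (2 / \<mu>) * (exp (- (\<mu> / 2) * s) - exp (- (\<mu> / 2) * t))"
      by (simp only: mult_minus_left[of "norm ?v * ?K * (2 / \<mu>)"] right_diff_distrib minus_diff_minus minus_diff_eq)
    finally show ?thesis .
  qed
  also have "\<dots> \<le> norm ?v * ?K * (2 / \<mu>) * exp (- (\<mu> / 2) * s)"
    using K \<mu>_pos by (intro mult_left_mono) auto
  finally have "?v \<bullet> ?v \<le> \<Lambda> * (norm ?v * ?K * (2 / \<mu>) * exp (- (\<mu> / 2) * s))"
    unfolding 1 using \<Lambda>_pos by (intro mult_left_mono) auto
  then have "norm ?v * norm ?v \<le> norm ?v * (2 * \<Lambda> * ?K / \<mu> * exp (- (\<mu> / 2) * s))"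
    by (simp add: power2_norm_eq_inner[symmetric] power2_eq_square mult_ac)
  then show ?thesis using False by (subst (asm) mult_le_cancel_left_pos) auto
qed

text \<open>The increment bound does not depend on the later time, so it gives the Cauchy property
  along the integers and then passes to the limit for every real \<open>t\<close>.\<close>

lemma mean_limit:
  obtains xt where "\<And>t. 0 \<le> t \<Longrightarrow>
    norm (mean t - xt) \<le> 2 * \<Lambda> * sqrt (2 * (wmax / Z 0) * V 0) / \<mu> * exp (- (\<mu> / 2) * t)"
proof -
  let ?C = "2 * \<Lambda> * sqrt (2 * (wmax / Z 0) * V 0) / \<mu>"
  have C: "0 \<le> ?C" using V_nonneg[of 0] wmax_pos Z0_pos \<Lambda>_pos \<mu>_pos by simp
  have lim: "(\<lambda>n. ?C * exp (- (\<mu> / 2) * real n)) \<longlonglongrightarrow> ?C * 0"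
    by (rule tendsto_mult_left[OF exp_decay])
  have "Cauchy (\<lambda>n. mean (real n))"
  proof (rule metric_CauchyI)
    fix e :: real assume "e > 0"
    then have "\<forall>\<^sub>F n in sequentially. ?C * exp (- (\<mu> / 2) * real n) < e / 2"
      using order_tendstoD(2)[OF lim, of "e / 2"] by simp
    then obtain n0 where n0: "?C * exp (- (\<mu> / 2) * real n0) < e / 2"
      by (auto simp: eventually_sequentially)
    have "dist (mean (real m)) (mean (real n0)) < e / 2" if "m \<ge> n0" for m
      using mean_increment[of "real n0" "real m"] that n0 by (simp add: dist_norm)
    then have "dist (mean (real m)) (mean (real n)) < e" if "m \<ge> n0" "n \<ge> n0" for m n
      using dist_triangle_half_l[of "mean (real m)" "mean (real n0)" e "mean (real n)"] that by blast
    then show "\<exists>N. \<forall>m\<ge>N. \<forall>n\<ge>N. dist (mean (real m)) (mean (real n)) < e" by blast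
  qed
  then obtain xt where xt: "(\<lambda>n. mean (real n)) \<longlonglongrightarrow> xt"
    using Cauchy_convergent convergent_def by blast
  show ?thesis
  proof (rule that)
    fix t :: real assume t: "0 \<le> t"
    have "(\<lambda>n. norm (mean t - mean (real n))) \<longlonglongrightarrow> norm (mean t - xt)"
      by (intro tendsto_intros xt)
    moreover obtain n0 where "t \<le> real n0" using real_arch_simple by blast
    have "norm (mean t - mean (real n)) \<le> ?C * exp (- (\<mu> / 2) * t)" if "n0 \<le> n" for n
      unfolding norm_minus_commute[of "mean t"]
      by (rule mean_increment[OF t]) (use \<open>t \<le> real n0\<close> that in linarith)
    ultimately show "norm (mean t - xt) \<le> ?C * exp (- (\<mu> / 2) * t)"
      by (intro LIMSEQ_le_const2) blast+
  qed
qed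

text \<open>Semiconvexity with base point \<open>X t\<close> and target \<open>xt\<close> compares
  \<open>weight xt\<close> with \<open>Z t\<close>. The error is governed by the L2 distance of
  \<open>X t\<close> from \<open>xt\<close>, which tends to 0 because the variance and the distance
  of the mean from \<open>xt\<close> do. The uniform lower bound on \<open>Z\<close> is thus
  inherited by \<open>weight xt\<close>.\<close>

lemma weight_limit_lower:
  assumes xt: "\<And>t. 0 \<le> t \<Longrightarrow> norm (mean t - xt) \<le> C * exp (- (\<mu> / 2) * t)"
  shows "Z 0 * sqrt (1 - \<nu>) \<le> weight xt"
proof -
  define b where "b = wmax * sqrt ((c + 1) / \<beta>)"
  let ?l = "\<lambda>t. l2norm M (\<lambda>w. xt - X t w)"
  have sq: "sq_integrable M (\<lambda>w. xt - X t w)" if "0 \<le> t" for t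
    by (intro sq_integrable_diff sq_integrable_const X_sq that)
  have lower: "Z 0 * sqrt (1 - \<nu>) - \<beta> * (b * ?l t) - \<beta> * c / 2 * wmax * (?l t)\<^sup>2 \<le> weight xt" if t: "0 \<le> t" for t
  proof -
    let ?U = "\<lambda>w. wgrad (X t w)"
    have i1: "integrable M (\<lambda>w. ?U w \<bullet> (xt - X t w))" by (intro integrable_inner_sq wgrad_sq sq t)
    have i2: "integrable M (\<lambda>w. (norm (xt - X t w))\<^sup>2)" using sq[OF t] by (simp add: sq_integrable_def)
    have "Z t - \<beta> * (\<integral>w. ?U w \<bullet> (xt - X t w) \<partial>M) - \<beta> * c / 2 * wmax * (?l t)\<^sup>2 =
       (\<integral>w. weight (X t w) - \<beta> * (?U w \<bullet> (xt - X t w)) - \<beta> * c / 2 * wmax * (norm (xt - X t w))\<^sup>2 \<partial>M)"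
      using i1 i2 weight_integrable[OF t] by (simp add: Z_eq l2norm_sq)
    also have "\<dots> \<le> (\<integral>w. weight xt \<partial>M)"
      using i1 i2 weight_integrable[OF t] weight_semiconvex
      by (intro integral_mono) (auto simp: wgrad_def)
    finally have "Z t - \<beta> * (\<integral>w. ?U w \<bullet> (xt - X t w) \<partial>M) - \<beta> * c / 2 * wmax * (?l t)\<^sup>2 \<le> weight xt"
      by (simp add: prob_space)
    moreover have "\<beta> * (\<integral>w. ?U w \<bullet> (xt - X t w) \<partial>M) \<le> \<beta> * (b * ?l t)"
    proof (rule mult_left_mono)
      have "(\<integral>w. ?U w \<bullet> (xt - X t w) \<partial>M) \<le> l2norm M ?U * ?l t"
        using Cauchy_Schwarz_integral(2)[OF wgrad_sq[OF t] sq[OF t]] by linarith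
      also have "l2norm M ?U \<le> l2norm M (\<lambda>w. b)"
        using sq_integrable_measurable[OF wgrad_sq[OF t]] weighted_grad_bound
        by (intro l2norm_mono sq_integrable_const) (auto simp: wgrad_def b_def intro: order_trans[OF _ abs_ge_self])
      also have "l2norm M (\<lambda>w. b) = b"
        using wmax_pos c_nonneg \<beta>_pos by (simp add: l2norm_def prob_space b_def)
      finally show "(\<integral>w. ?U w \<bullet> (xt - X t w) \<partial>M) \<le> b * ?l t" by (simp add: mult_right_mono)
    qed (use \<beta>_pos in simp)
    ultimately show ?thesis using Z_bound[OF t] by linarith
  qed
  have lt: "?l t \<le> sqrt (V 0) * exp (- (\<mu> / 2) * t) + C * exp (- (\<mu> / 2) * t)" if t: "0 \<le> t" for t
  proof -
    have "?l t = l2norm M (\<lambda>w. (xt - mean t) - D t w)" by (simp add: D_def)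
    also have "\<dots> \<le> l2norm M (\<lambda>w. xt - mean t) + l2norm M (D t)"
      by (intro l2norm_triangle_diff sq_integrable_const D_sq t)
    also have "l2norm M (\<lambda>w. xt - mean t) = norm (mean t - xt)"
      by (simp add: l2norm_def prob_space norm_minus_commute)
    also have "l2norm M (D t) = sqrt (V t)" by (simp add: l2norm_def V_eq)
    also have "sqrt (V t) \<le> sqrt (V 0 * exp (- \<mu> * t))" using V_bound[OF t] by simp
    also have "sqrt (V 0 * exp (- \<mu> * t)) = sqrt (V 0) * exp (- (\<mu> / 2) * t)"
    proof -
      have "exp (- \<mu> * t) = (exp (- (\<mu> / 2) * t))\<^sup>2" by (simp add: exp_double[symmetric])
      then show ?thesis by (simp add: real_sqrt_mult)
    qed
    finally show ?thesis using xt[OF t] by simp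
  qed
  have "(\<lambda>n. ?l (real n)) \<longlonglongrightarrow> 0"
  proof (rule tendsto_sandwich[OF _ _ tendsto_const])
    show "(\<lambda>n. sqrt (V 0) * exp (- (\<mu> / 2) * real n) + C * exp (- (\<mu> / 2) * real n)) \<longlonglongrightarrow> 0"
      using tendsto_add[OF tendsto_mult_left[OF exp_decay, of "sqrt (V 0)"] tendsto_mult_left[OF exp_decay, of C]] by simp
  qed (use lt in auto)
  then have "(\<lambda>n. Z 0 * sqrt (1 - \<nu>) - \<beta> * (b * ?l (real n)) - \<beta> * c / 2 * wmax * (?l (real n))\<^sup>2)
      \<longlonglongrightarrow> Z 0 * sqrt (1 - \<nu>) - \<beta> * (b * 0) - \<beta> * c / 2 * wmax * 0\<^sup>2"
    by (intro tendsto_intros)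
  then have "Z 0 * sqrt (1 - \<nu>) - \<beta> * (b * 0) - \<beta> * c / 2 * wmax * 0\<^sup>2 \<le> weight xt"
    by (rule LIMSEQ_le_const2) (use lower in auto)
  then show ?thesis by simp
qed

lemma limit_cost:
  assumes "Z 0 * sqrt (1 - \<nu>) \<le> weight xt"
  shows "L xt \<le> - (1 / \<beta>) * ln (Z 0) - 1 / (2 * \<beta>) * ln (1 - \<nu>)"
proof -
  have pos: "1 - \<nu> > 0" using \<nu>_le by simp
  have "ln (Z 0 * sqrt (1 - \<nu>)) \<le> ln (weight xt)"
    using assms Z0_pos pos by (subst ln_le_cancel_iff) (auto simp: weight_pos)
  then have "ln (Z 0) + ln (1 - \<nu>) / 2 \<le> - \<beta> * L xt"
    using Z0_pos pos by (simp add: ln_mult ln_sqrt weight_def)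
  then show ?thesis using \<beta>_pos by (simp add: field_simps)
qed

text \<open>From \<open>\<nu> \<le> 3 / 4\<close> the square root of \<open>1 - \<nu>\<close> is at
  least one half, the source of the term \<open>ln 2\<close>.\<close>

lemma \<nu>_cost: "- 1 / (2 * \<beta>) * ln (1 - \<nu>) \<le> ln 2 / \<beta>"
proof -
  have "ln (1 / 4) \<le> ln (1 - \<nu>)" using \<nu>_le by (subst ln_le_cancel_iff) auto
  moreover have "ln (1 / 4 :: real) = - 2 * ln 2"
    using ln_realpow[of "2::real" 2] by (simp add: ln_div)
  ultimately show ?thesis using \<beta>_pos by (simp add: field_simps)
qed

lemma consensus:
  "tends_exponentially V 0 \<and>
   (\<exists>xt. tends_exponentially xbar xt \<and> tends_exponentially mean xt \<and>
     L xt \<le> - (1 / \<beta>) * ln (Z 0) - 1 / (2 * \<beta>) * ln (1 - \<nu>))"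
proof (intro conjI)
  show "tends_exponentially V 0"
    using V_bound V_nonneg by (intro tends_exponentiallyI[OF \<mu>_pos, where C="V 0"]) simp
  define C where "C = 2 * \<Lambda> * sqrt (2 * (wmax / Z 0) * V 0) / \<mu>"
  define K where "K = sqrt (2 * (wmax / Z 0) * V 0)"
  obtain xt where xt: "\<And>t. 0 \<le> t \<Longrightarrow> norm (mean t - xt) \<le> C * exp (- (\<mu> / 2) * t)"
    using mean_limit unfolding C_def by blast
  have "norm (xbar t - xt) \<le> (C + K) * exp (- (\<mu> / 2) * t)" if "0 \<le> t" for t
  proof -
    have "norm (xbar t - xt) \<le> norm (mean t - xt) + norm (mean t - xbar t)"
      using norm_triangle_ineq4[of "mean t - xt" "mean t - xbar t"] by simp
    then show ?thesis
      using xt[OF that] mean_xbar_decay[OF that, folded K_def] unfolding distrib_right by linarith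
  qed
  then have "tends_exponentially xbar xt"
    using \<mu>_pos by (intro tends_exponentiallyI[of "\<mu> / 2"]) auto
  moreover have "tends_exponentially mean xt"
    using \<mu>_pos xt by (intro tends_exponentiallyI[of "\<mu> / 2"]) auto
  ultimately show "\<exists>xt. tends_exponentially xbar xt \<and> tends_exponentially mean xt \<and>
     L xt \<le> - (1 / \<beta>) * ln (Z 0) - 1 / (2 * \<beta>) * ln (1 - \<nu>)"
    using limit_cost[OF weight_limit_lower[OF xt]] by blast
qed

end

text \<open>Laplace's method for a fixed law. The bound \<open>L \<ge> Inf (range L)\<close> makes
  the gap nonnegative; restricting the mean to the event where
  \<open>L (U w) < Inf (range L) + \<epsilon>\<close>, of probability \<open>p > 0\<close>, bounds
  it above by \<open>\<epsilon> - ln p / \<beta>\<close>.\<close>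

lemma laplace_gap_tendsto_zero:
  fixes L :: "real ^ 'd \<Rightarrow> real"
  assumes "prob_space M" and U: "U \<in> borel_measurable M" and L: "L \<in> borel_measurable borel"
    and lower: "\<And>x. Inf (range L) \<le> L x" and reach: "law_reaches_infimum M L U"
  shows "(laplace_gap M L U \<longlongrightarrow> 0) at_top"
proof -
  interpret prob_space M by fact
  let ?m = "Inf (range L)"
  have [measurable]: "(\<lambda>w. L (U w)) \<in> borel_measurable M" by (rule measurable_compose[OF U L])
  have int: "integrable M (\<lambda>w. exp (- \<beta> * L (U w)))" if "\<beta> > 0" for \<beta>
    by (rule integrable_const_bound[of _ "exp (- \<beta> * ?m)"]) (use lower that in auto)
  have pos: "laplace_mean M L U \<beta> > 0" if \<beta>: "\<beta> > 0" for \<beta>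
  proof -
    have "laplace_mean M L U \<beta> \<noteq> 0"
    proof
      assume "laplace_mean M L U \<beta> = 0"
      then have "AE w in M. exp (- \<beta> * L (U w)) = 0"
        using integral_nonneg_eq_0_iff_AE[OF int[OF \<beta>]] by (simp add: laplace_mean_def)
      then show False by (simp add: AE_False)
    qed
    moreover have "0 \<le> laplace_mean M L U \<beta>" by (simp add: laplace_mean_def)
    ultimately show ?thesis by simp
  qed
  have nonneg: "0 \<le> laplace_gap M L U \<beta>" if \<beta>: "\<beta> > 0" for \<beta>
  proof -
    have "laplace_mean M L U \<beta> \<le> (\<integral>w. exp (- \<beta> * ?m) \<partial>M)"
      unfolding laplace_mean_def using lower \<beta> by (intro integral_mono int) auto
    then have "ln (laplace_mean M L U \<beta>) \<le> ln (exp (- \<beta> * ?m))"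
      using pos[OF \<beta>] by (subst ln_le_cancel_iff) (auto simp: prob_space)
    then show ?thesis using \<beta> by (simp add: laplace_gap_def field_simps)
  qed
  have upper: "laplace_gap M L U \<beta> \<le> \<epsilon> - ln (prob {w\<in>space M. L (U w) < ?m + \<epsilon>}) / \<beta>"
    if \<beta>: "\<beta> > 0" and \<epsilon>: "\<epsilon> > 0" for \<beta> \<epsilon>
  proof -
    let ?A = "{w\<in>space M. L (U w) < ?m + \<epsilon>}"
    have A: "?A \<in> events" by measurable
    have p: "prob ?A > 0" using reach \<epsilon> by (simp add: law_reaches_infimum_def)
    have i: "integrable M (\<lambda>w. indicator ?A w * exp (- \<beta> * (?m + \<epsilon>)))"
      by (intro integrable_mult_left integrable_real_indicator A impI) (simp add: emeasure_eq_measure)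
    have "prob ?A * exp (- \<beta> * (?m + \<epsilon>)) = (\<integral>w. indicator ?A w * exp (- \<beta> * (?m + \<epsilon>)) \<partial>M)"
      using A by simp
    also have "\<dots> \<le> laplace_mean M L U \<beta>"
      unfolding laplace_mean_def
      using \<beta> by (intro integral_mono i int) (auto simp: indicator_def)
    finally have "ln (prob ?A * exp (- \<beta> * (?m + \<epsilon>))) \<le> ln (laplace_mean M L U \<beta>)"
      using p pos[OF \<beta>] by (subst ln_le_cancel_iff) auto
    then have "ln (prob ?A) - \<beta> * (?m + \<epsilon>) \<le> ln (laplace_mean M L U \<beta>)"
      using p by (simp add: ln_mult)
    then have "(ln (prob ?A) - \<beta> * (?m + \<epsilon>)) / \<beta> \<le> ln (laplace_mean M L U \<beta>) / \<beta>"
      using \<beta> by (intro divide_right_mono) auto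
    moreover have "(ln (prob ?A) - \<beta> * (?m + \<epsilon>)) / \<beta> = ln (prob ?A) / \<beta> - (?m + \<epsilon>)"
      using \<beta> by (simp add: diff_divide_distrib)
    moreover have "laplace_gap M L U \<beta> = - (ln (laplace_mean M L U \<beta>) / \<beta>) - ?m"
      by (simp add: laplace_gap_def)
    ultimately show ?thesis by linarith
  qed
  show ?thesis
  proof (rule tendstoI)
    fix e :: real assume e: "e > 0"
    let ?p = "prob {w\<in>space M. L (U w) < ?m + e / 2}"
    have "((\<lambda>\<beta>. e / 2 - ln ?p / \<beta>) \<longlongrightarrow> e / 2 - 0) at_top"
      by (intro tendsto_intros tendsto_divide_0[OF tendsto_const] filterlim_at_top_imp_at_infinity filterlim_ident)
    then have "\<forall>\<^sub>F \<beta> in at_top. e / 2 - ln ?p / \<beta> < e"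
      by (rule order_tendstoD(2)) (use e in simp)
    then show "\<forall>\<^sub>F \<beta> in at_top. dist (laplace_gap M L U \<beta>) 0 < e"
      using eventually_gt_at_top[of 0]
    proof eventually_elim
      case (elim \<beta>)
      then show ?case using nonneg[of \<beta>] upper[of \<beta> "e / 2"] e by simp
    qed
  qed
qed

theorem theorem3p1:
  fixes M :: "'w measure" and F :: "real \<Rightarrow> 'w measure"
    and W X :: "real \<Rightarrow> 'w \<Rightarrow> real ^ 'd"
    and L :: "real ^ 'd \<Rightarrow> real"
    and \<beta> \<Lambda> \<sigma> L\<^sub>m c\<^sub>L \<mu> \<nu> :: real
    and V M\<^sub>L :: "real \<Rightarrow> real" and xbar :: "real \<Rightarrow> real ^ 'd"
  assumes "twice_continuously_differentiable L"
    and "\<exists>!x. \<forall>y. L x \<le> L y"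
    and "L\<^sub>m = Inf (range L)" and "L\<^sub>m > 0"
    and "hessian_bound L < \<infinity>" and "c\<^sub>L = enn2real (hessian_bound L)"
    and "\<beta> > 0" and "\<Lambda> > 0" and "\<sigma> > 0"
    and "mean_field_solution M F W L \<beta> \<Lambda> \<sigma> X"
    and "xbar = (\<lambda>t. consensus_point M L \<beta> (X t))"
    and "V = (\<lambda>t. mean_sq_deviation M (X t))"
    and "M\<^sub>L = (\<lambda>t. laplace_mean M L (X t) \<beta>)"
    and "\<mu> = 2 * \<Lambda> - \<sigma>\<^sup>2 - 2 * \<sigma>\<^sup>2 * (exp (- \<beta> * L\<^sub>m) / M\<^sub>L 0)" and "\<mu> > 0"
    and "\<nu> = 2 * V 0 / (\<mu> * (M\<^sub>L 0)\<^sup>2) * \<beta> * exp (- 2 * \<beta> * L\<^sub>m) * c\<^sub>L * (2 * \<Lambda> + \<sigma>\<^sup>2)"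
    and "\<nu> \<le> 3 / 4"
  shows "tends_exponentially V 0 \<and>
    (\<exists>xt. tends_exponentially xbar xt \<and>
          tends_exponentially (\<lambda>t. \<integral>\<omega>. X t \<omega> \<partial>M) xt \<and>
          L xt \<le> - (1 / \<beta>) * ln (M\<^sub>L 0) - 1 / (2 * \<beta>) * ln (1 - \<nu>) \<and>
          - (1 / \<beta>) * ln (M\<^sub>L 0) - 1 / (2 * \<beta>) * ln (1 - \<nu>)
            \<le> L\<^sub>m + laplace_gap M L (X 0) \<beta> + ln 2 / \<beta>) \<and>
    (law_reaches_infimum M L (X 0) \<longrightarrow> (laplace_gap M L (X 0) \<longlongrightarrow> 0) at_top)"
proof -
  from assms(2) obtain x0 where x0: "\<And>y. L x0 \<le> L y" by blast
  \<comment> \<open>The minimiser bounds the range of \<open>L\<close> below, as is needed for the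
    real \<open>Inf\<close> to be a lower bound of it.\<close>
  have "bdd_below (range L)" by (rule bdd_belowI[of _ "L x0"]) (use x0 in auto)
  then have low: "Inf (range L) \<le> L x" for x by (intro cInf_lower) auto
  have dyn: "consensus_dynamics M F W X L \<beta> \<Lambda> \<sigma> c\<^sub>L L\<^sub>m"
    using assms(1,3,5-10) low hessian_quadratic_form_le[OF assms(1,5)]
    by (simp add: consensus_dynamics_def)
  note eqs = consensus_dynamics.V_def[OF dyn] consensus_dynamics.Z_def[OF dyn]
    consensus_dynamics.wmax_def[OF dyn] consensus_dynamics.xbar_def[OF dyn]
    consensus_dynamics.mean_def[OF dyn]
  have wsq: "(exp (- \<beta> * L\<^sub>m))\<^sup>2 = exp (- 2 * \<beta> * L\<^sub>m)"
    by (simp add: exp_double[symmetric])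
  have contr: "contracting_consensus M F W X L \<beta> \<Lambda> \<sigma> c\<^sub>L L\<^sub>m \<mu> \<nu>"
    unfolding contracting_consensus_def contracting_consensus_axioms_def eqs wsq
    using dyn assms(12-17) by simp
  have V: "V = consensus_dynamics.V M X" and xb: "xbar = consensus_dynamics.xbar M X L \<beta>"
    and mean: "(\<lambda>t. \<integral>\<omega>. X t \<omega> \<partial>M) = consensus_dynamics.mean M X"
    and Z: "M\<^sub>L 0 = consensus_dynamics.Z M X L \<beta> 0"
    using assms(11-13) by (auto simp: eqs fun_eq_iff)
  \<comment> \<open>By this identity the second bound on the cost reduces to the estimate of the
    \<open>\<nu>\<close>-term in \<open>\<nu>_cost\<close>.\<close>
  have gap: "- (1 / \<beta>) * ln (M\<^sub>L 0) = L\<^sub>m + laplace_gap M L (X 0) \<beta>"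
    by (simp add: laplace_gap_def assms(3,13))
  have "- (1 / \<beta>) * ln (M\<^sub>L 0) - 1 / (2 * \<beta>) * ln (1 - \<nu>) \<le> L\<^sub>m + laplace_gap M L (X 0) \<beta> + ln 2 / \<beta>"
    unfolding gap using contracting_consensus.\<nu>_cost[OF contr] by simp
  moreover have "(laplace_gap M L (X 0) \<longlongrightarrow> 0) at_top" if "law_reaches_infimum M L (X 0)"
  proof (rule laplace_gap_tendsto_zero[OF _ _ _ low that])
    interpret consensus_dynamics M F W X L \<beta> \<Lambda> \<sigma> c\<^sub>L L\<^sub>m by (rule dyn)
    show "prob_space M" by unfold_locales
    show "X 0 \<in> borel_measurable M" by (rule X_meas) simp
    show "L \<in> borel_measurable borel" by (rule borel_measurable_continuous_onI[OF L_continuous])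
  qed
  ultimately show ?thesis
    using contracting_consensus.consensus[OF contr] unfolding V xb mean Z by blast
qed

end
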